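(* Let $\alpha\in(0,1)$, $\eta>-1$, and let $\omega$ be a weight on the unit disk $\mathbb{D}$ such that $\frac{\omega(z)}{(1-|z|^2)^\eta}\in B_2(\eta)$. Let $L_a^2(\omega)$ be the corresponding weighted Bergman space, with reproducing kernel $K^{\eta,\omega}(z,\lambda)=K_{\lambda}^{\eta,\omega}(z)$, let $L$ be a bounded linear operator on $L_a^2(\omega)$, and let $\{\lambda_n\}_{n=1}^{\infty}\subset\mathbb{D}$ be a sequence of distinct points. For $\lambda\in\mathbb{D}$ put $D_{\lambda,\alpha}=\{z\in\mathbb{D}:|z-\lambda|<\alpha(1-|\lambda|)\}$. Then the following statements are equivalent: (i) $\left\{K_{\lambda_n}^{\eta,\omega}\left(\int_{D_{\lambda_n,\alpha}}\omega\, dA\right)^{1/2}\right\}_{n=1}^{\infty}$ is an atomic system for $L$, i.e. the series $\sum_{n=1}^{\infty} c_n K_{\lambda_n}^{\eta,\omega}\left(\int_{D_{\lambda_n,\alpha}}\omega\, dA\right)^{1/2}$ converges in $L_a^2(\omega)$ for all $\{c_n\}\in l^2$, and there exists $C>0$ such that for every $f\in L_a^2(\omega)$ there exists $a_f=(a_n)\in l^2$ with $\|a_f\|_{l^2}\leq C\|f\|$ and $Lf=\sum_{n=1}^{\infty} a_nK_{\lambda_n}^{\eta,\omega}\left(\int_{D_{\lambda_n,\alpha}}\omega\, dA\right)^{1/2}$; (ii) $\{\lambda_n\}_{n=1}^{\infty}$ is a sampling sequence for $L$, i.e. there exist constants $A,B>0$ such that $$A\|L^*f\|^2\leq\sum_{n=1}^{\infty}|f(\lambda_n)|^2\left(\int_{D_{\lambda_n,\alpha}}\omega\,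 dA\right)\leq B\|f\|^2\quad\text{for all } f\in L_a^2(\omega);$$ (iii) $\left\{K_{\lambda_n}^{\eta,\omega}\left(\int_{D_{\lambda_n,\alpha}}\omega\, dA\right)^{1/2}\right\}_{n=1}^{\infty}$ is a Bessel sequence and there exists a Bessel sequence $\{g_n\}_{n=1}^{\infty}\subset L_a^2(\omega)$ such that $$Lf=\sum_{n=1}^{\infty}\langle f,g_n\rangle K_{\lambda_n}^{\eta,\omega}\left(\int_{D_{\lambda_n,\alpha}}\omega\, dA\right)^{1/2}\quad\text{for all } f\in L_a^2(\omega);$$ (iv) $\sum_{n=1}^{\infty}|f(\lambda_n)|^2\left(\int_{D_{\lambda_n,\alpha}}\omega\, dA\right)<\infty$ for all $f\in L_a^2(\omega)$, and there exists a Bessel sequence $\{g_n\}_{n=1}^{\infty}\subset L_a^2(\omega)$ such that $$L^*f=\sum_{n=1}^{\infty}f(\lambda_n)\left(\int_{D_{\lambda_n,\alpha}}\omega\, dA\right)^{1/2}g_n\quad\text{for all } f\in L_a^2(\omega).$$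
   Context: $\mathbb{D}=\{z\in\mathbb{C}:|z|<1\}$, $dA(z)=\frac{1}{\pi}dx\,dy$ is normalized area measure on $\mathbb{D}$, and for $\eta>-1$, $dA_{\eta}(z)=(\eta+1)(1-|z|^2)^{\eta}dA(z)$. A weight is a measurable function $\mathbb{D}\to(0,\infty)$. The class $B_2(\eta)$ (Békollé weights) consists of the weights $v$ for which there is a constant $c>0$ with $$\left(\int_{S(\theta,h)}v\, dA_{\eta}\right)\left(\int_{S(\theta,h)}v^{-1} dA_{\eta}\right)\leq c\,[A_{\eta}(S(\theta,h))]^2$$ for every Carleson square $S(\theta,h)=\{z=re^{it}:1-h<r<1,\ |\theta-t|<h/2\}$, $\theta\in[0,2\pi]$, $h\in(0,1)$. The weighted Bergman space $L_a^2(\omega)$ is the space of analytic functions $f$ on $\mathbb{D}$ with $\|f\|^2=\int_{\mathbb{D}}|f(z)|^2\omega(z)\,dA(z)<\infty$, with inner product $\langle f,g\rangle=\int_{\mathbb{D}}f\overline{g}\,\omega\,dA$. Under the stated assumption on $\omega$ it is a reproducing kernel Hilbert space; $K_\lambda^{\eta,\omega}\in L_a^2(\omega)$ denotes its reproducing kernel, i.e. $f(\lambda)=\langle f,K_\lambda^{\eta,\omega}\rangle$ for all $f\in L_a^2(\omega)$ and $\lambda\in\mathbb{D}$. $L^*$ is the Hilbert space adjoint of $L$. Series of functions converge in the norm of the space. A sequence $\{f_n\}_{n=1}^{\infty}$ in a Hilbert space $\mathcal{H}$ is a Bessel sequence if there is a constant $B>0$ such that $\sum_{n=1}^{\infty}|\langle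 x,f_n\rangle|^2\leq B\|x\|^2$ for all $x\in\mathcal{H}$. *)

theory Defs
  imports "HOL-Analysis.Analysis"
begin

section \<open>Area measures and weights on the unit disk\<close>

definition unit_disk :: "complex set" where
  "unit_disk = ball 0 1"

definition disk_area :: "complex measure" where
  "disk_area = density (lebesgue_on unit_disk) (\<lambda>_. ennreal (1 / pi))"

definition weighted_area :: "real \<Rightarrow> complex measure" where
  "weighted_area \<eta> =
     density disk_area (\<lambda>z. ennreal ((\<eta> + 1) * (1 - (cmod z)\<^sup>2) powr \<eta>))"

text \<open>Only the values of a weight on the disk are relevant.\<close>

definition is_weight :: "(complex \<Rightarrow> real) \<Rightarrow> bool" where
  "is_weight w \<longleftrightarrow>
     w \<in> borel_measurable (lebesgue_on unit_disk) \<and> (\<forall>z\<in>unit_disk. 0 < w z)"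

definition carleson_square :: "real \<Rightarrow> real \<Rightarrow> complex set" where
  "carleson_square \<theta> h =
     {complex_of_real r * cis t | r t. 1 - h < r \<and> r < 1 \<and> \<bar>\<theta> - t\<bar> < h / 2}"

text \<open>The integrals are taken in the extended nonnegative reals, so the inequality
  also asserts that they are finite (both are positive).\<close>

definition bekolle_B2 :: "real \<Rightarrow> (complex \<Rightarrow> real) set" where
  "bekolle_B2 \<eta> = {v. is_weight v \<and>
     (\<exists>c>0. \<forall>\<theta>\<in>{0..2 * pi}. \<forall>h\<in>{0<..<1}.
        (\<integral>\<^sup>+ z \<in> carleson_square \<theta> h. ennreal (v z) \<partial>weighted_area \<eta>) *
        (\<integral>\<^sup>+ z \<in> carleson_square \<theta> h. ennreal (inverse (v z)) \<partial>weighted_area \<eta>)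
        \<le> ennreal c * (emeasure (weighted_area \<eta>) (carleson_square \<theta> h))\<^sup>2)}"


section \<open>Weighted Bergman spaces\<close>

text \<open>Functions on the disk are represented by functions on the plane that vanish
  off the disk, so that equality in the space is equality of functions.\<close>

definition bergman_space :: "(complex \<Rightarrow> real) \<Rightarrow> (complex \<Rightarrow> complex) set" where
  "bergman_space w = {f. f holomorphic_on unit_disk \<and> (\<forall>z. z \<notin> unit_disk \<longrightarrow> f z = 0) \<and>
     integrable disk_area (\<lambda>z. (cmod (f z))\<^sup>2 * w z)}"

definition bergman_inner ::
  "(complex \<Rightarrow> real) \<Rightarrow> (complex \<Rightarrow> complex) \<Rightarrow> (complex \<Rightarrow> complex) \<Rightarrow> complex" where
  "bergman_inner w f g = (LINT z|disk_area. f z * cnj (g z) * complex_of_real (w z))"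

definition bergman_norm :: "(complex \<Rightarrow> real) \<Rightarrow> (complex \<Rightarrow> complex) \<Rightarrow> real" where
  "bergman_norm w f = sqrt (LINT z|disk_area. (cmod (f z))\<^sup>2 * w z)"

definition bergman_kernel :: "(complex \<Rightarrow> real) \<Rightarrow> complex \<Rightarrow> complex \<Rightarrow> complex" where
  "bergman_kernel w l =
     (THE k. k \<in> bergman_space w \<and> (\<forall>f\<in>bergman_space w. f l = bergman_inner w f k))"

definition bergman_sums ::
  "(complex \<Rightarrow> real) \<Rightarrow> (nat \<Rightarrow> complex \<Rightarrow> complex) \<Rightarrow> (complex \<Rightarrow> complex) \<Rightarrow> bool" where
  "bergman_sums w u s \<longleftrightarrow> (\<forall>n. u n \<in> bergman_space w) \<and> s \<in> bergman_space w \<and>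
     (\<lambda>N. bergman_norm w (\<lambda>z. (\<Sum>n<N. u n z) - s z)) \<longlonglongrightarrow> 0"

definition bergman_bounded_operator ::
  "(complex \<Rightarrow> real) \<Rightarrow> ((complex \<Rightarrow> complex) \<Rightarrow> (complex \<Rightarrow> complex)) \<Rightarrow> bool" where
  "bergman_bounded_operator w L \<longleftrightarrow>
     (\<forall>f\<in>bergman_space w. L f \<in> bergman_space w) \<and>
     (\<forall>f\<in>bergman_space w. \<forall>g\<in>bergman_space w. L (\<lambda>z. f z + g z) = (\<lambda>z. L f z + L g z)) \<and>
     (\<forall>c. \<forall>f\<in>bergman_space w. L (\<lambda>z. c * f z) = (\<lambda>z. c * L f z)) \<and>
     (\<exists>C. \<forall>f\<in>bergman_space w. bergman_norm w (L f) \<le> C * bergman_norm w f)"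

definition bergman_adjoint ::
  "(complex \<Rightarrow> real) \<Rightarrow> ((complex \<Rightarrow> complex) \<Rightarrow> (complex \<Rightarrow> complex)) \<Rightarrow>
   (complex \<Rightarrow> complex) \<Rightarrow> (complex \<Rightarrow> complex)" where
  "bergman_adjoint w L g =
     (THE k. k \<in> bergman_space w \<and>
        (\<forall>f\<in>bergman_space w. bergman_inner w (L f) g = bergman_inner w f k))"


section \<open>Sequences in weighted Bergman spaces\<close>

definition in_l2 :: "(nat \<Rightarrow> complex) \<Rightarrow> bool" where
  "in_l2 c \<longleftrightarrow> summable (\<lambda>n. (cmod (c n))\<^sup>2)"

definition l2_norm :: "(nat \<Rightarrow> complex) \<Rightarrow> real" where
  "l2_norm c = sqrt (\<Sum>n. (cmod (c n))\<^sup>2)"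

definition bergman_bessel ::
  "(complex \<Rightarrow> real) \<Rightarrow> (nat \<Rightarrow> complex \<Rightarrow> complex) \<Rightarrow> bool" where
  "bergman_bessel w u \<longleftrightarrow> (\<forall>n. u n \<in> bergman_space w) \<and>
     (\<exists>B>0. \<forall>f\<in>bergman_space w.
        summable (\<lambda>n. (cmod (bergman_inner w f (u n)))\<^sup>2) \<and>
        (\<Sum>n. (cmod (bergman_inner w f (u n)))\<^sup>2) \<le> B * (bergman_norm w f)\<^sup>2)"

definition bergman_atomic_system ::
  "(complex \<Rightarrow> real) \<Rightarrow> ((complex \<Rightarrow> complex) \<Rightarrow> (complex \<Rightarrow> complex)) \<Rightarrow>
   (nat \<Rightarrow> complex \<Rightarrow> complex) \<Rightarrow> bool" where
  "bergman_atomic_system w L u \<longleftrightarrow>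
     (\<forall>c. in_l2 c \<longrightarrow> (\<exists>s. bergman_sums w (\<lambda>n z. c n * u n z) s)) \<and>
     (\<exists>C>0. \<forall>f\<in>bergman_space w. \<exists>a. in_l2 a \<and> l2_norm a \<le> C * bergman_norm w f \<and>
        bergman_sums w (\<lambda>n z. a n * u n z) (L f))"

definition small_disk :: "real \<Rightarrow> complex \<Rightarrow> complex set" where
  "small_disk \<alpha> l = {z \<in> unit_disk. cmod (z - l) < \<alpha> * (1 - cmod l)}"

definition disk_mass :: "(complex \<Rightarrow> real) \<Rightarrow> real \<Rightarrow> complex \<Rightarrow> real" where
  "disk_mass w \<alpha> l = (LINT z:small_disk \<alpha> l|disk_area. w z)"

definition scaled_kernel ::
  "(complex \<Rightarrow> real) \<Rightarrow> real \<Rightarrow> complex \<Rightarrow> complex \<Rightarrow> complex" where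
  "scaled_kernel w \<alpha> l = (\<lambda>z. bergman_kernel w l z * complex_of_real (sqrt (disk_mass w \<alpha> l)))"

definition sampling_sequence ::
  "(complex \<Rightarrow> real) \<Rightarrow> real \<Rightarrow> ((complex \<Rightarrow> complex) \<Rightarrow> (complex \<Rightarrow> complex)) \<Rightarrow>
   (nat \<Rightarrow> complex) \<Rightarrow> bool" where
  "sampling_sequence w \<alpha> L l \<longleftrightarrow>
     (\<exists>A>0. \<exists>B>0. \<forall>f\<in>bergman_space w.
        summable (\<lambda>n. (cmod (f (l n)))\<^sup>2 * disk_mass w \<alpha> (l n)) \<and>
        A * (bergman_norm w (bergman_adjoint w L f))\<^sup>2
          \<le> (\<Sum>n. (cmod (f (l n)))\<^sup>2 * disk_mass w \<alpha> (l n)) \<and>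
        (\<Sum>n. (cmod (f (l n)))\<^sup>2 * disk_mass w \<alpha> (l n)) \<le> B * (bergman_norm w f)\<^sup>2)"

end

theory Submission
  imports Defs "HOL-Complex_Analysis.Complex_Analysis"
begin

text \<open>
  The four conditions are reformulations of a single operator inequality. Let \<open>u n\<close> be the normalised
  kernels. By the reproducing property the inner product of \<open>f\<close> with \<open>u n\<close> is \<open>f (l n)\<close> times the square
  root of the mass of the disk at \<open>l n\<close>, so every sampling sum is a sum of squared moduli of inner
  products with \<open>u n\<close>, and the statement is about a sequence \<open>u\<close> in a Hilbert space. Let \<open>T\<close> be the
  analysis operator, which sends \<open>f\<close> to its sequence of inner products with \<open>u\<close>, and let \<open>T*\<close>, the
  synthesis operator, be its adjoint. Apart from the boundedness of \<open>T\<close>, the conditions say: the range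
  of \<open>L\<close> lies in the range of \<open>T*\<close> with norm control; \<open>\<parallel>L* f\<parallel>\<close> is at most a constant times \<open>\<parallel>T f\<parallel>\<close>; \<open>L\<close>
  factors as \<open>T* X\<close> with \<open>X\<close> bounded; and \<open>L*\<close> factors as \<open>X* T\<close>. A bounded \<open>X\<close> into \<open>l2\<close> is the same
  thing as a Bessel sequence \<open>g\<close>. Their equivalence is Douglas's lemma on range inclusion, majorization
  and factorization; the implication with content is \<open>douglas_factorization\<close>. Where boundedness
  of \<open>T\<close> is not part of the condition it follows from the principle of uniform boundedness, applied
  in \<open>l2\<close> to the partial synthesis sums (\<open>bessel_if_synthesis\<close>), or in the space itself to the
  truncations of \<open>T\<close> (\<open>bessel_if_summable\<close>).

  Two facts connect this with analysis: the weighted Bergman space is complete and its point evaluations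
  are bounded. Both follow from a bound on evaluations that is locally uniform in the disk
  (\<open>evaluation_bound_cball\<close>). Away from the origin, the area mean value property bounds a value by the
  mean of \<open>\<bar>f\<bar>\<close> over a small disk, and a Cauchy-Schwarz argument bounds that mean by the norm
  as soon as \<open>1 / w\<close> is integrable there; at the origin the maximum principle takes over. The
  Bekolle condition enters only through this local integrability (\<open>bekolle_inverse_locally_integrable\<close>):
  every point other than the origin has a neighbourhood inside a Carleson square, and over that
  neighbourhood the product of the integrals of the weight and of its inverse is finite while the first
  factor is positive.
\<close>

section \<open>Hilbert spaces of functions\<close>

text \<open>
  The vectors are functions with pointwise operations, collected in a carrier set because the space
  varies with the weight. Bounded evaluations make the form definite, and they identify norm
  limits with pointwise limits; this covers both \<open>l2\<close> and the Bergman spaces.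
\<close>

locale function_hilbert_space =
  fixes H :: "('a \<Rightarrow> complex) set"
    and ip :: "('a \<Rightarrow> complex) \<Rightarrow> ('a \<Rightarrow> complex) \<Rightarrow> complex"
  assumes zero_mem: "(\<lambda>x. 0) \<in> H"
    and add_mem: "f \<in> H \<Longrightarrow> g \<in> H \<Longrightarrow> (\<lambda>x. f x + g x) \<in> H"
    and scale_mem: "f \<in> H \<Longrightarrow> (\<lambda>x. c * f x) \<in> H"
    and ip_add_left: "f \<in> H \<Longrightarrow> g \<in> H \<Longrightarrow> h \<in> H \<Longrightarrow> ip (\<lambda>x. f x + g x) h = ip f h + ip g h"
    and ip_scale_left: "f \<in> H \<Longrightarrow> h \<in> H \<Longrightarrow> ip (\<lambda>x. c * f x) h = c * ip f h"
    and ip_commute: "f \<in> H \<Longrightarrow> g \<in> H \<Longrightarrow> ip g f = cnj (ip f g)"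
    and ip_self_nonneg: "f \<in> H \<Longrightarrow> 0 \<le> Re (ip f f)"
    and evaluation_bounded: "\<exists>C. \<forall>f\<in>H. cmod (f x) \<le> C * sqrt (Re (ip f f))"
    and Cauchy_converges: "(\<And>n. F n \<in> H) \<Longrightarrow>
      (\<And>e. 0 < e \<Longrightarrow> \<exists>N. \<forall>m\<ge>N. \<forall>n\<ge>N.
         sqrt (Re (ip (\<lambda>x. F m x - F n x) (\<lambda>x. F m x - F n x))) < e) \<Longrightarrow>
      \<exists>f\<in>H. (\<lambda>n. sqrt (Re (ip (\<lambda>x. F n x - f x) (\<lambda>x. F n x - f x)))) \<longlonglongrightarrow> 0"
begin

definition nrm :: "('a \<Rightarrow> complex) \<Rightarrow> real" where
  "nrm f = sqrt (Re (ip f f))"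

lemma diff_mem: "f \<in> H \<Longrightarrow> g \<in> H \<Longrightarrow> (\<lambda>x. f x - g x) \<in> H"
  using add_mem[OF _ scale_mem[of g "-1"], of f] by simp

lemma sum_mem: "(\<And>n. n \<in> S \<Longrightarrow> u n \<in> H) \<Longrightarrow> (\<lambda>x. \<Sum>n\<in>S. u n x) \<in> H"
  by (induction S rule: infinite_finite_induct) (auto intro: zero_mem add_mem)

lemmas mem = zero_mem add_mem scale_mem diff_mem

lemma ip_zero_left: "g \<in> H \<Longrightarrow> ip (\<lambda>x. 0) g = 0"
  using ip_scale_left[of "\<lambda>x. 0" g 0] zero_mem by simp

lemma ip_diff_left:
  assumes "f \<in> H" "g \<in> H" "h \<in> H" shows "ip (\<lambda>x. f x - g x) h = ip f h - ip g h"
  using ip_add_left[of f "\<lambda>x. (-1) * g x" h] ip_scale_left[of g h "-1"] assms scale_mem[of g "-1"]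
  by simp

lemma ip_add_right: "f \<in> H \<Longrightarrow> g \<in> H \<Longrightarrow> h \<in> H \<Longrightarrow> ip h (\<lambda>x. f x + g x) = ip h f + ip h g"
  by (subst (1 2 3) ip_commute) (auto simp: mem ip_add_left)

lemma ip_diff_right: "f \<in> H \<Longrightarrow> g \<in> H \<Longrightarrow> h \<in> H \<Longrightarrow> ip h (\<lambda>x. f x - g x) = ip h f - ip h g"
  by (subst (1 2 3) ip_commute) (auto simp: mem ip_diff_left)

lemma ip_scale_right: "f \<in> H \<Longrightarrow> h \<in> H \<Longrightarrow> ip h (\<lambda>x. c * f x) = cnj c * ip h f"
  by (subst (1 2) ip_commute) (auto simp: mem ip_scale_left)

lemmas ip_simps = ip_zero_left ip_add_left ip_diff_left ip_scale_left
  ip_add_right ip_diff_right ip_scale_right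

lemma ip_sum_right:
  "(\<And>n. n \<in> S \<Longrightarrow> u n \<in> H) \<Longrightarrow> f \<in> H \<Longrightarrow> ip f (\<lambda>x. \<Sum>n\<in>S. c n * u n x) = (\<Sum>n\<in>S. cnj (c n) * ip f (u n))"
proof (induction S rule: infinite_finite_induct)
  case (insert n S)
  then show ?case by (simp add: ip_simps mem sum_mem)
qed (use ip_commute[OF _ zero_mem, of f] in \<open>simp_all add: ip_zero_left\<close>)

lemma nrm_nonneg: "0 \<le> nrm f" if "f \<in> H"
  using ip_self_nonneg[OF that] by (simp add: nrm_def)

lemma ip_self: "f \<in> H \<Longrightarrow> ip f f = complex_of_real ((nrm f)\<^sup>2)"
  using ip_commute[of f f] ip_self_nonneg[of f]
  by (simp add: nrm_def complex_eq_iff)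

lemma nrm_power2: "f \<in> H \<Longrightarrow> (nrm f)\<^sup>2 = Re (ip f f)"
  by (simp add: ip_self)

lemma nrm_scale: "f \<in> H \<Longrightarrow> nrm (\<lambda>x. c * f x) = cmod c * nrm f"
proof -
  assume f: "f \<in> H"
  have "ip (\<lambda>x. c * f x) (\<lambda>x. c * f x) = complex_of_real ((cmod c)\<^sup>2 * (nrm f)\<^sup>2)"
    using f by (simp add: ip_simps mem ip_self complex_norm_square mult.assoc mult.left_commute del: of_real_power)
  then show ?thesis
    using nrm_nonneg[OF f] by (simp add: nrm_def[of "\<lambda>x. c * f x"] real_sqrt_mult)
qed

lemma nrm_zero: "nrm (\<lambda>x. 0) = 0"
  by (simp add: nrm_def ip_zero_left zero_mem)

lemma nrm_eq_0D:
  assumes "f \<in> H" "nrm f = 0" shows "f = (\<lambda>x. 0)"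
proof
  fix x
  show "f x = 0" using evaluation_bounded[of x] assms by (auto simp: nrm_def)
qed

lemma nrm_diff_commute: "f \<in> H \<Longrightarrow> g \<in> H \<Longrightarrow> nrm (\<lambda>x. f x - g x) = nrm (\<lambda>x. g x - f x)"
  using nrm_scale[of "\<lambda>x. f x - g x" "-1"] by (simp add: mem)

lemma Cauchy_Schwarz:
  assumes "f \<in> H" "g \<in> H" shows "cmod (ip f g) \<le> nrm f * nrm g"
proof (cases "nrm g = 0")
  case True
  then have "g = (\<lambda>x. 0)" using nrm_eq_0D assms by blast
  then show ?thesis
    using ip_zero_left[OF assms(1)] ip_commute[of g f] assms nrm_nonneg[of f] nrm_nonneg[of g] by simp
next
  case False
  \<comment> \<open>The component of \<open>f\<close> along \<open>g\<close>; the remainder has nonnegative square norm.\<close>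
  define c where "c = ip f g / complex_of_real ((nrm g)\<^sup>2)"
  have comm: "ip g f = cnj (ip f g)" using ip_commute assms by blast
  have g0: "complex_of_real (nrm g) \<noteq> 0" using False by simp
  have "ip (\<lambda>x. f x - c * g x) (\<lambda>x. f x - c * g x)
      = complex_of_real ((nrm f)\<^sup>2 - (cmod (ip f g))\<^sup>2 / (nrm g)\<^sup>2)"
  proof -
    have "ip (\<lambda>x. f x - c * g x) (\<lambda>x. f x - c * g x)
        = ip f f - cnj c * ip f g - c * ip g f + c * cnj c * ip g g"
      using assms by (simp add: ip_simps mem algebra_simps)
    also have "\<dots> = complex_of_real ((nrm f)\<^sup>2 - (cmod (ip f g))\<^sup>2 / (nrm g)\<^sup>2)"
      using g0 unfolding comm ip_self[OF assms(1)] ip_self[OF assms(2)] c_def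
      by (simp add: field_simps power2_eq_square flip: complex_norm_square[unfolded power2_eq_square])
    finally show ?thesis .
  qed
  then have "0 \<le> (nrm f)\<^sup>2 - (cmod (ip f g))\<^sup>2 / (nrm g)\<^sup>2"
    using ip_self_nonneg[of "\<lambda>x. f x - c * g x"] assms by (simp add: mem)
  moreover have "0 < (nrm g)\<^sup>2" using False by simp
  ultimately have "(cmod (ip f g))\<^sup>2 \<le> (nrm f * nrm g)\<^sup>2"
    by (simp add: field_simps)
  then show ?thesis
    using assms nrm_nonneg by (meson mult_nonneg_nonneg power2_le_imp_le)
qed

lemma nrm_add_power2:
  "f \<in> H \<Longrightarrow> g \<in> H \<Longrightarrow> (nrm (\<lambda>x. f x + g x))\<^sup>2 = (nrm f)\<^sup>2 + 2 * Re (ip g f) + (nrm g)\<^sup>2"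
  using ip_commute[of f g] by (simp add: nrm_power2 mem ip_simps)

lemma nrm_add:
  assumes "f \<in> H" "g \<in> H" shows "nrm (\<lambda>x. f x + g x) \<le> nrm f + nrm g"
proof (rule power2_le_imp_le)
  have "Re (ip g f) \<le> nrm g * nrm f"
    using Cauchy_Schwarz[of g f] complex_Re_le_cmod[of "ip g f"] assms by linarith
  then show "(nrm (\<lambda>x. f x + g x))\<^sup>2 \<le> (nrm f + nrm g)\<^sup>2"
    by (simp add: nrm_add_power2 assms power2_sum algebra_simps)
qed (use nrm_nonneg assms in simp)

lemma nrm_triangle:
  assumes "f \<in> H" "g \<in> H" "h \<in> H"
  shows "nrm (\<lambda>x. f x - h x) \<le> nrm (\<lambda>x. f x - g x) + nrm (\<lambda>x. g x - h x)"
  using nrm_add[of "\<lambda>x. f x - g x" "\<lambda>x. g x - h x"] assms by (simp add: mem)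

lemma nrm_sum_le:
  "finite S \<Longrightarrow> (\<And>n. n \<in> S \<Longrightarrow> u n \<in> H) \<Longrightarrow> nrm (\<lambda>x. \<Sum>n\<in>S. u n x) \<le> (\<Sum>n\<in>S. nrm (u n))"
proof (induction S rule: finite_induct)
  case (insert n S)
  then show ?case using nrm_add[of "u n" "\<lambda>x. \<Sum>n\<in>S. u n x"] sum_mem[of S u] by simp
qed (simp add: nrm_zero)

lemma complete:
  assumes "\<And>n. F n \<in> H"
    and "\<And>e. 0 < e \<Longrightarrow> \<exists>N. \<forall>m\<ge>N. \<forall>n\<ge>N. nrm (\<lambda>x. F m x - F n x) < e"
  obtains f where "f \<in> H" "(\<lambda>n. nrm (\<lambda>x. F n x - f x)) \<longlonglongrightarrow> 0"
  using Cauchy_converges[of F] assms unfolding nrm_def by blast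

lemma ip_tendsto_left:
  assumes "\<And>n. F n \<in> H" "f \<in> H" "g \<in> H" "(\<lambda>n. nrm (\<lambda>x. F n x - f x)) \<longlonglongrightarrow> 0"
  shows "(\<lambda>n. ip (F n) g) \<longlonglongrightarrow> ip f g"
proof -
  have "(\<lambda>n. ip (F n) g - ip f g) \<longlonglongrightarrow> 0"
  proof (rule Lim_null_comparison)
    show "\<forall>\<^sub>F n in sequentially. norm (ip (F n) g - ip f g) \<le> nrm (\<lambda>x. F n x - f x) * nrm g"
      using Cauchy_Schwarz[of "\<lambda>x. F _ x - f x" g] assms by (simp add: mem ip_simps)
    show "(\<lambda>n. nrm (\<lambda>x. F n x - f x) * nrm g) \<longlonglongrightarrow> 0"
      using tendsto_mult_right[OF assms(4), of "nrm g"] by simp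
  qed
  then show ?thesis using LIM_zero_iff by blast
qed

lemma ip_tendsto_right:
  assumes "\<And>n. F n \<in> H" "f \<in> H" "g \<in> H" "(\<lambda>n. nrm (\<lambda>x. F n x - f x)) \<longlonglongrightarrow> 0"
  shows "(\<lambda>n. ip g (F n)) \<longlonglongrightarrow> ip g f"
proof -
  have "(\<lambda>n. cnj (ip (F n) g)) \<longlonglongrightarrow> cnj (ip f g)"
    by (intro tendsto_cnj ip_tendsto_left assms)
  moreover have "cnj (ip (F n) g) = ip g (F n)" for n
    using ip_commute[OF assms(1,3)] by simp
  moreover have "cnj (ip f g) = ip g f"
    using ip_commute[OF assms(2,3)] by simp
  ultimately show ?thesis by simp
qed

lemma nrm_tendsto:
  assumes "\<And>n. F n \<in> H" "f \<in> H" "(\<lambda>n. nrm (\<lambda>x. F n x - f x)) \<longlonglongrightarrow> 0"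
  shows "(\<lambda>n. nrm (F n)) \<longlonglongrightarrow> nrm f"
proof -
  have "(\<lambda>n. nrm (F n) - nrm f) \<longlonglongrightarrow> 0"
  proof (rule Lim_null_comparison)
    have "norm (nrm (F n) - nrm f) \<le> nrm (\<lambda>x. F n x - f x)" for n
    proof -
      have "nrm (F n) \<le> nrm (\<lambda>x. F n x - f x) + nrm f"
        using nrm_add[of "\<lambda>x. F n x - f x" f] assms(1,2) by (simp add: diff_mem)
      moreover have "nrm f \<le> nrm (\<lambda>x. F n x - f x) + nrm (F n)"
        using nrm_add[of "\<lambda>x. f x - F n x" "F n"] assms(1,2)
        by (simp add: diff_mem nrm_diff_commute[of "F n" f])
      ultimately show ?thesis by (simp add: abs_le_iff)
    qed
    then show "\<forall>\<^sub>F n in sequentially. norm (nrm (F n) - nrm f) \<le> nrm (\<lambda>x. F n x - f x)" by simp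
  qed fact
  then show ?thesis using LIM_zero_iff by blast
qed

lemma eq_if_ip_eq:
  assumes "f \<in> H" "g \<in> H" "\<And>h. h \<in> H \<Longrightarrow> ip h f = ip h g" shows "f = g"
proof -
  have "ip (\<lambda>x. f x - g x) (\<lambda>x. f x - g x) = 0"
    using assms by (simp add: ip_diff_right mem)
  then have "nrm (\<lambda>x. f x - g x) = 0" by (simp add: nrm_def)
  then have "(\<lambda>x. f x - g x) = (\<lambda>x. 0)" using nrm_eq_0D assms by (simp add: mem)
  then show ?thesis by (auto simp: fun_eq_iff)
qed

text \<open>
  A bounded linear functional on a subspace, given by its graph \<open>G\<close>, is represented by a vector. The
  graph form suits a functional that is specified on the values \<open>T f\<close> of an operator in terms of \<open>f\<close>: the
  bound forces it to be single-valued. The vector is the limit of a minimising sequence for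
  \<open>\<parallel>f\<parallel>\<^sup>2 - 2 Re s\<close>. The last conclusion says that it lies in the closure of the domain, which makes it
  unique even when the domain is not dense.
\<close>

theorem riesz_relation:
  assumes G: "G \<subseteq> H \<times> UNIV" and G0: "((\<lambda>x. 0), 0) \<in> G"
    and Gadd: "\<And>f s g t. (f, s) \<in> G \<Longrightarrow> (g, t) \<in> G \<Longrightarrow> ((\<lambda>x. f x + g x), s + t) \<in> G"
    and Gscale: "\<And>f s c. (f, s) \<in> G \<Longrightarrow> ((\<lambda>x. c * f x), c * s) \<in> G"
    and bound: "\<And>f s. (f, s) \<in> G \<Longrightarrow> cmod s \<le> C * nrm f"
  obtains b where "b \<in> H" "\<And>f s. (f, s) \<in> G \<Longrightarrow> s = ip f b" "nrm b \<le> \<bar>C\<bar>"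
    "\<And>d. d \<in> H \<Longrightarrow> (\<And>f s. (f, s) \<in> G \<Longrightarrow> ip f d = 0) \<Longrightarrow> ip b d = 0"
proof -
  define J where "J = (\<lambda>(f, s). (nrm f)\<^sup>2 - 2 * Re s)"
  define d where "d = Inf (J ` G)"
  have GH: "f \<in> H" if "(f, s) \<in> G" for f s using that G by auto
  have lower: "- (C\<^sup>2) \<le> J p" if "p \<in> G" for p
  proof -
    obtain f s where p: "p = (f, s)" by force
    have "Re s \<le> C * nrm f" using bound[of f s] complex_Re_le_cmod[of s] that p by auto
    then show ?thesis
      using zero_le_power2[of "nrm f - C"] by (simp add: J_def p power2_diff algebra_simps)
  qed
  have bdd: "bdd_below (J ` G)" using lower by (auto intro!: bdd_belowI2)
  have d_le: "d \<le> J p" if "p \<in> G" for p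
    unfolding d_def using bdd that by (rule cINF_lower)
  have "\<exists>p\<in>G. J p < d + 1 / real (Suc n)" for n
  proof -
    have "Inf (J ` G) < d + 1 / real (Suc n)" by (simp add: d_def)
    then show ?thesis using cINF_less_iff[OF _ bdd, of "d + 1 / real (Suc n)"] G0 by blast
  qed
  then obtain P where P: "\<And>n. P n \<in> G" "\<And>n. J (P n) < d + 1 / real (Suc n)" by metis
  define F S where "F = fst \<circ> P" and "S = snd \<circ> P"
  have FS: "(F n, S n) \<in> G" for n using P(1)[of n] by (simp add: F_def S_def)
  have JFS: "(nrm (F n))\<^sup>2 - 2 * Re (S n) < d + 1 / real (Suc n)" for n
    using P(2)[of n] by (simp add: F_def S_def J_def case_prod_beta)
  have FH: "F n \<in> H" for n using FS GH by blast
  \<comment> \<open>By the parallelogram law the minimising sequence is Cauchy.\<close>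
  have dist: "(nrm (\<lambda>x. F m x - F n x))\<^sup>2 \<le> 2 / real (Suc m) + 2 / real (Suc n)" for m n
  proof -
    have "((\<lambda>x. (1/2) * (F m x + F n x)), (1/2) * (S m + S n)) \<in> G"
      using FS Gadd Gscale by blast
    from d_le[OF this] have "d \<le> (nrm (\<lambda>x. (1/2) * (F m x + F n x)))\<^sup>2 - (Re (S m) + Re (S n))"
      by (simp add: J_def add_divide_distrib)
    moreover have "(nrm (\<lambda>x. (1/2) * (F m x + F n x)))\<^sup>2 = (nrm (\<lambda>x. F m x + F n x))\<^sup>2 / 4"
      using nrm_scale[OF add_mem[OF FH FH], of "1/2" m n] by (simp only:) (simp add: power_divide)
    moreover have "(nrm (\<lambda>x. F m x + F n x))\<^sup>2 + (nrm (\<lambda>x. F m x - F n x))\<^sup>2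
        = 2 * (nrm (F m))\<^sup>2 + 2 * (nrm (F n))\<^sup>2"
      using FH by (simp add: nrm_power2 mem ip_simps)
    moreover have "2 / real (Suc m) = 2 * (1 / real (Suc m))" "2 / real (Suc n) = 2 * (1 / real (Suc n))"
      by simp_all
    ultimately show ?thesis using JFS[of m] JFS[of n] by linarith
  qed
  obtain b where b: "b \<in> H" "(\<lambda>n. nrm (\<lambda>x. F n x - b x)) \<longlonglongrightarrow> 0"
  proof (rule complete[of F])
    fix e :: real assume e: "0 < e"
    then obtain N where N: "4 / real (Suc N) < e\<^sup>2"
      using reals_Archimedean[of "e\<^sup>2 / 4"] by (auto simp: field_simps)
    have "nrm (\<lambda>x. F m x - F n x) < e" if "N \<le> m" "N \<le> n" for m n
    proof (rule power_less_imp_less_base)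
      have "2 / real (Suc m) \<le> 2 / real (Suc N)" "2 / real (Suc n) \<le> 2 / real (Suc N)"
        using that by (simp_all add: frac_le)
      then show "(nrm (\<lambda>x. F m x - F n x))\<^sup>2 < e\<^sup>2" using dist[of m n] N by simp
    qed (use e in simp)
    then show "\<exists>N. \<forall>m\<ge>N. \<forall>n\<ge>N. nrm (\<lambda>x. F m x - F n x) < e" by blast
  qed (use FH in auto)
  have Re_eq: "Re s = Re (ip f b)" if fs: "(f, s) \<in> G" for f s
  proof -
    have f: "f \<in> H" using GH fs by blast
    have perturb: "0 \<le> 2 * t * (Re (ip f b) - Re s) + t\<^sup>2 * (nrm f)\<^sup>2" for t :: real
    proof -
      have "0 \<le> 2 * t * (Re (ip f (F n)) - Re s) + t\<^sup>2 * (nrm f)\<^sup>2 + 1 / real (Suc n)" for n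
      proof -
        have "((\<lambda>x. F n x + of_real t * f x), S n + of_real t * s) \<in> G"
          using FS Gadd Gscale fs by blast
        from d_le[OF this]
        have "d \<le> (nrm (\<lambda>x. F n x + of_real t * f x))\<^sup>2 - 2 * Re (S n + of_real t * s)"
          by (simp add: J_def)
        then show ?thesis
          using JFS[of n] nrm_add_power2[of "F n" "\<lambda>x. of_real t * f x"] f FH[of n]
          by (simp add: mem ip_simps nrm_scale power_mult_distrib algebra_simps)
      qed
      moreover have "(\<lambda>n. 2 * t * (Re (ip f (F n)) - Re s) + t\<^sup>2 * (nrm f)\<^sup>2 + 1 / real (Suc n))
        \<longlonglongrightarrow> 2 * t * (Re (ip f b) - Re s) + t\<^sup>2 * (nrm f)\<^sup>2 + 0"
        by (intro tendsto_intros ip_tendsto_right FH b f lim_1_over_n[THEN LIMSEQ_Suc])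
      ultimately show ?thesis
        using LIMSEQ_le_const by (metis (no_types, lifting) add.right_neutral)
    qed
    \<comment> \<open>A quadratic in \<open>t\<close> that vanishes at \<open>0\<close> and is nonnegative has no linear term. Its minimiser is
        \<open>- q / k\<close> up to the summand \<open>1\<close> in \<open>k\<close>, which avoids a division by zero.\<close>
    define q where "q = Re (ip f b) - Re s"
    define k where "k = (nrm f)\<^sup>2 + 1"
    have k: "0 < k" unfolding k_def by (simp add: add_nonneg_pos)
    have "0 \<le> 2 * (- q / k) * q + (- q / k)\<^sup>2 * (nrm f)\<^sup>2"
      using perturb[of "- q / k"] by (simp add: q_def)
    also have "\<dots> \<le> 2 * (- q / k) * q + (- q / k)\<^sup>2 * k"
      by (intro add_left_mono mult_left_mono) (auto simp: k_def)
    also have "\<dots> = - (q\<^sup>2 / k)" using k by (simp add: field_simps power2_eq_square)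
    finally have "q\<^sup>2 / k \<le> 0" by simp
    then have "q = 0" using k by (simp add: divide_le_0_iff)
    then show ?thesis by (simp add: q_def)
  qed
  have rep: "s = ip f b" if fs: "(f, s) \<in> G" for f s
  proof (rule complex_eqI)
    show "Re s = Re (ip f b)" using Re_eq fs by blast
    \<comment> \<open>The imaginary part is the real part for the multiple by \<open>\<i>\<close>.\<close>
    have "((\<lambda>x. \<i> * f x), \<i> * s) \<in> G" using Gscale fs by blast
    from Re_eq[OF this] show "Im s = Im (ip f b)"
      using GH[OF fs] b(1) by (simp add: ip_simps)
  qed
  have "nrm b \<le> \<bar>C\<bar>"
  proof -
    have "Re (ip (F n) b) \<le> \<bar>C\<bar> * nrm (F n)" for n
    proof -
      have "cmod (ip (F n) b) \<le> C * nrm (F n)" using bound FS rep by metis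
      moreover have "C * nrm (F n) \<le> \<bar>C\<bar> * nrm (F n)"
        using nrm_nonneg[OF FH] by (intro mult_right_mono) auto
      ultimately show ?thesis using complex_Re_le_cmod[of "ip (F n) b"] by linarith
    qed
    moreover have "(\<lambda>n. Re (ip (F n) b)) \<longlonglongrightarrow> Re (ip b b)"
      by (intro tendsto_intros ip_tendsto_left FH b)
    moreover have "(\<lambda>n. \<bar>C\<bar> * nrm (F n)) \<longlonglongrightarrow> \<bar>C\<bar> * nrm b"
      by (intro tendsto_intros nrm_tendsto FH b)
    ultimately have "Re (ip b b) \<le> \<bar>C\<bar> * nrm b" using LIMSEQ_le by blast
    then have "nrm b * nrm b \<le> \<bar>C\<bar> * nrm b"
      using nrm_power2[OF b(1)] by (simp add: power2_eq_square)
    then show ?thesis using nrm_nonneg[OF b(1)] by (cases "nrm b = 0") auto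
  qed
  moreover have "ip b g = 0" if g: "g \<in> H" "\<And>f s. (f, s) \<in> G \<Longrightarrow> ip f g = 0" for g
  proof -
    have "(\<lambda>n. ip (F n) g) \<longlonglongrightarrow> ip b g" by (intro ip_tendsto_left FH b g)
    moreover have "ip (F n) g = 0" for n using g(2) FS by blast
    ultimately show ?thesis by (simp add: LIMSEQ_const_iff)
  qed
  ultimately show ?thesis using that b(1) rep by blast
qed

corollary riesz:
  assumes "\<And>f g. f \<in> H \<Longrightarrow> g \<in> H \<Longrightarrow> \<phi> (\<lambda>x. f x + g x) = \<phi> f + \<phi> g"
    and "\<And>f c. f \<in> H \<Longrightarrow> \<phi> (\<lambda>x. c * f x) = c * \<phi> f"
    and "\<And>f. f \<in> H \<Longrightarrow> cmod (\<phi> f) \<le> C * nrm f"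
  shows "\<exists>!b. b \<in> H \<and> (\<forall>f\<in>H. \<phi> f = ip f b)"
proof -
  have \<phi>0: "\<phi> (\<lambda>x. 0) = 0" using assms(2)[of "\<lambda>x. 0" 0] by (simp add: mem)
  obtain b where b: "b \<in> H" "\<And>f s. (f, s) \<in> {(f, \<phi> f) | f. f \<in> H} \<Longrightarrow> s = ip f b"
  proof (rule riesz_relation[of "{(f, \<phi> f) | f. f \<in> H}" C])
  qed (use assms \<phi>0 in \<open>auto simp: mem\<close>)
  show ?thesis
  proof (rule ex1I)
    show "b \<in> H \<and> (\<forall>f\<in>H. \<phi> f = ip f b)" using b by blast
    show "b' = b" if "b' \<in> H \<and> (\<forall>f\<in>H. \<phi> f = ip f b')" for b'
    proof (rule eq_if_ip_eq)
      show "ip h b' = ip h b" if "h \<in> H" for h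
        using that b(2)[of h "\<phi> h"] \<open>b' \<in> H \<and> _\<close> by auto
    qed (use that b in auto)
  qed
qed

end

section \<open>Square-integrable functions with bounded evaluations\<close>

text \<open>
  The only issue is completeness. Bounded evaluations turn a norm-Cauchy sequence into a pointwise
  convergent one, and Fatou's lemma shows that it also converges in norm. What depends on
  the space, that the pointwise limit is again admissible, is left as a hypothesis.
\<close>

lemma function_hilbert_space_L2I:
  fixes M :: "'a measure" and P :: "('a \<Rightarrow> complex) \<Rightarrow> bool"
  defines "V \<equiv> {f. P f \<and> integrable M (\<lambda>x. (cmod (f x))\<^sup>2)}"
  assumes meas: "\<And>f. P f \<Longrightarrow> f \<in> borel_measurable M"
    and P0: "P (\<lambda>x. 0)"
    and Padd: "\<And>f g. P f \<Longrightarrow> P g \<Longrightarrow> P (\<lambda>x. f x + g x)"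
    and Pscale: "\<And>f c. P f \<Longrightarrow> P (\<lambda>x. c * f x)"
    and eval: "\<And>x. \<exists>C. \<forall>f\<in>V. cmod (f x) \<le> C * sqrt (LINT x|M. (cmod (f x))\<^sup>2)"
    and closed: "\<And>F f. (\<And>n. F n \<in> V) \<Longrightarrow> (\<And>m n. (\<lambda>x. F m x - F n x) \<in> V) \<Longrightarrow>
      (\<And>e. 0 < e \<Longrightarrow> \<exists>N. \<forall>m\<ge>N. \<forall>n\<ge>N. sqrt (LINT x|M. (cmod (F m x - F n x))\<^sup>2) < e) \<Longrightarrow>
      (\<And>x. (\<lambda>n. F n x) \<longlonglongrightarrow> f x) \<Longrightarrow> P f"
  shows "function_hilbert_space V (\<lambda>f g. LINT x|M. f x * cnj (g x))"
proof -
  have VI: "f \<in> V" if "P f" "integrable M (\<lambda>x. (cmod (f x))\<^sup>2)" for f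
    using that by (simp add: V_def)
  have VP: "P f" and Vint: "integrable M (\<lambda>x. (cmod (f x))\<^sup>2)" if "f \<in> V" for f
    using that by (simp_all add: V_def)
  have Vmeas[measurable_dest]: "f \<in> borel_measurable M" if "f \<in> V" for f
    using that VP meas by blast
  have add: "(\<lambda>x. f x + g x) \<in> V" if fg: "f \<in> V" "g \<in> V" for f g
  proof (rule VI)
    show "P (\<lambda>x. f x + g x)" using fg VP Padd by blast
    note [measurable] = Vmeas[OF fg(1)] Vmeas[OF fg(2)]
    show "integrable M (\<lambda>x. (cmod (f x + g x))\<^sup>2)"
    proof (rule Bochner_Integration.integrable_bound)
      show "integrable M (\<lambda>x. 2 * (cmod (f x))\<^sup>2 + 2 * (cmod (g x))\<^sup>2)"
        using fg by (auto intro!: Vint)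
      have "(cmod (a + b))\<^sup>2 \<le> 2 * (cmod a)\<^sup>2 + 2 * (cmod b)\<^sup>2" for a b :: complex
      proof -
        have "(cmod (a + b))\<^sup>2 \<le> (cmod a + cmod b)\<^sup>2"
          by (intro power_mono norm_triangle_ineq) auto
        then show ?thesis using zero_le_power2[of "cmod a - cmod b"]
          by (simp add: power2_sum power2_diff)
      qed
      then show "AE x in M. norm ((cmod (f x + g x))\<^sup>2) \<le> norm (2 * (cmod (f x))\<^sup>2 + 2 * (cmod (g x))\<^sup>2)"
        by (simp add: abs_of_nonneg)
    qed measurable
  qed
  have scale: "(\<lambda>x. c * f x) \<in> V" if "f \<in> V" for f c
    using VI[of "\<lambda>x. c * f x"] VP[OF that] Vint[OF that] Pscale
    by (simp add: norm_mult power_mult_distrib)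
  have diff: "(\<lambda>x. f x - g x) \<in> V" if "f \<in> V" "g \<in> V" for f g
    using add[OF that(1) scale[OF that(2), of "-1"]] by simp
  have prod_int: "integrable M (\<lambda>x. f x * cnj (g x))" if fg: "f \<in> V" "g \<in> V" for f g
  proof (rule Bochner_Integration.integrable_bound)
    note [measurable] = Vmeas[OF fg(1)] Vmeas[OF fg(2)]
    show "integrable M (\<lambda>x. (cmod (f x))\<^sup>2 + (cmod (g x))\<^sup>2)"
      using fg by (auto intro!: Vint)
    have "(\<lambda>x. cnj (g x)) \<in> borel_measurable M"
      by (rule measurable_compose[OF Vmeas[OF fg(2)] borel_measurable_continuous_onI]) (intro continuous_intros)
    then show "(\<lambda>x. f x * cnj (g x)) \<in> borel_measurable M" by measurable
    have "a * b \<le> a\<^sup>2 + b\<^sup>2" if "0 \<le> a" "0 \<le> b" for a b :: real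
      using zero_le_power2[of "a - b"] mult_nonneg_nonneg[OF that] by (simp add: power2_diff)
    then show "AE x in M. norm (f x * cnj (g x)) \<le> norm ((cmod (f x))\<^sup>2 + (cmod (g x))\<^sup>2)"
      by (simp add: norm_mult)
  qed
  have self: "(LINT x|M. f x * cnj (f x)) = complex_of_real (LINT x|M. (cmod (f x))\<^sup>2)" for f
    by (simp flip: complex_norm_square integral_complex_of_real)
  show ?thesis
  proof
    show "(\<lambda>x. 0) \<in> V" using P0 by (simp add: V_def)
  next
    fix F :: "nat \<Rightarrow> 'a \<Rightarrow> complex"
    assume FV: "\<And>n. F n \<in> V"
      and "\<And>e. 0 < e \<Longrightarrow> \<exists>N. \<forall>m\<ge>N. \<forall>n\<ge>N.
        sqrt (Re (LINT x|M. (F m x - F n x) * cnj (F m x - F n x))) < e"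
    then have Cau: "\<exists>N. \<forall>m\<ge>N. \<forall>n\<ge>N. sqrt (LINT x|M. (cmod (F m x - F n x))\<^sup>2) < e"
      if "0 < e" for e
      using that by (simp add: self del: complex_cnj_diff)
    have "Cauchy (\<lambda>n. F n x)" for x
    proof -
      obtain C where C: "\<And>f. f \<in> V \<Longrightarrow> cmod (f x) \<le> C * sqrt (LINT x|M. (cmod (f x))\<^sup>2)"
        using eval by blast
      show ?thesis
      proof (rule CauchyI)
        fix e :: real assume e: "0 < e"
        have "0 < e / (\<bar>C\<bar> + 1)" using e by (simp add: add_nonneg_pos)
        then obtain N where N: "\<And>m n. N \<le> m \<Longrightarrow> N \<le> n \<Longrightarrow>
            sqrt (LINT x|M. (cmod (F m x - F n x))\<^sup>2) < e / (\<bar>C\<bar> + 1)"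
          using Cau by blast
        have "norm (F m x - F n x) < e" if "N \<le> m" "N \<le> n" for m n
        proof -
          let ?s = "sqrt (LINT x|M. (cmod (F m x - F n x))\<^sup>2)"
          have "norm (F m x - F n x) \<le> C * ?s" using C[OF diff[OF FV FV]] .
          also have "\<dots> \<le> (\<bar>C\<bar> + 1) * ?s" by (intro mult_right_mono) auto
          also have "\<dots> < (\<bar>C\<bar> + 1) * (e / (\<bar>C\<bar> + 1))"
            using N[OF that] by (intro mult_strict_left_mono) auto
          finally show ?thesis by simp
        qed
        then show "\<exists>N. \<forall>m\<ge>N. \<forall>n\<ge>N. norm (F m x - F n x) < e" by blast
      qed
    qed
    then have "\<exists>y. (\<lambda>n. F n x) \<longlonglongrightarrow> y" for x
      by (auto simp: Cauchy_convergent_iff convergent_def)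
    then obtain f where f: "\<And>x. (\<lambda>n. F n x) \<longlonglongrightarrow> f x"
      using choice[of "\<lambda>x y. (\<lambda>n. F n x) \<longlonglongrightarrow> y"] by blast
    have Pf: "P f" using closed[OF FV diff[OF FV FV] Cau f] .
    note [measurable] = Vmeas[OF FV] meas[OF Pf]
    \<comment> \<open>Fatou's lemma turns the Cauchy estimate into an estimate for the pointwise limit.\<close>
    have fatou: "(\<integral>\<^sup>+x. ennreal ((cmod (F n x - f x))\<^sup>2) \<partial>M) \<le> ennreal (e\<^sup>2)"
      if N: "\<And>m n. N \<le> m \<Longrightarrow> N \<le> n \<Longrightarrow> sqrt (LINT x|M. (cmod (F m x - F n x))\<^sup>2) < e"
        and n: "N \<le> n" and e: "0 < e" for N n e
    proof -
      have "(\<integral>\<^sup>+x. ennreal ((cmod (F n x - f x))\<^sup>2) \<partial>M)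
          = (\<integral>\<^sup>+x. liminf (\<lambda>m. ennreal ((cmod (F n x - F m x))\<^sup>2)) \<partial>M)"
        by (intro nn_integral_cong lim_imp_Liminf[symmetric] tendsto_intros f) auto
      also have "\<dots> \<le> liminf (\<lambda>m. \<integral>\<^sup>+x. ennreal ((cmod (F n x - F m x))\<^sup>2) \<partial>M)"
        by (rule nn_integral_liminf) measurable
      also have "\<dots> \<le> ennreal (e\<^sup>2)"
      proof (rule Liminf_le)
        have "(\<integral>\<^sup>+x. ennreal ((cmod (F n x - F m x))\<^sup>2) \<partial>M) \<le> ennreal (e\<^sup>2)" if "N \<le> m" for m
        proof -
          have "(\<integral>\<^sup>+x. ennreal ((cmod (F n x - F m x))\<^sup>2) \<partial>M)
              = ennreal (LINT x|M. (cmod (F n x - F m x))\<^sup>2)"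
            by (intro nn_integral_eq_integral Vint[OF diff[OF FV FV]]) auto
          also have "(LINT x|M. (cmod (F n x - F m x))\<^sup>2) \<le> e\<^sup>2"
            using N[OF n that] e by (simp add: real_less_lsqrt real_sqrt_less_iff sqrt_le_D less_imp_le)
          finally show ?thesis by (simp add: ennreal_leI)
        qed
        then show "\<forall>\<^sub>F m in sequentially. (\<integral>\<^sup>+x. ennreal ((cmod (F n x - F m x))\<^sup>2) \<partial>M) \<le> ennreal (e\<^sup>2)"
          by (auto simp: eventually_sequentially)
      qed simp
      finally show ?thesis .
    qed
    have "P (\<lambda>x. F n x - f x)" for n
      using Padd[OF VP[OF FV] Pscale[OF Pf, of "-1"], of n] by simp
    then have diffV: "(\<lambda>x. F n x - f x) \<in> V"
      if N: "\<And>m n. N \<le> m \<Longrightarrow> N \<le> n \<Longrightarrow> sqrt (LINT x|M. (cmod (F m x - F n x))\<^sup>2) < e"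
        and n: "N \<le> n" and e: "0 < e" for N n e
      using fatou[OF N n e] by (auto intro!: VI integrableI_bounded simp: le_less_trans)
    obtain N where N: "\<And>m n. N \<le> m \<Longrightarrow> N \<le> n \<Longrightarrow> sqrt (LINT x|M. (cmod (F m x - F n x))\<^sup>2) < 1"
      using Cau[of 1] by auto
    have fV: "f \<in> V"
    proof -
      have "(\<lambda>x. F N x - f x) \<in> V" by (rule diffV[of N 1]) (use N in auto)
      from diff[OF FV[of N] this] show ?thesis by simp
    qed
    have "(\<lambda>n. sqrt (LINT x|M. (cmod (F n x - f x))\<^sup>2)) \<longlonglongrightarrow> 0"
    proof (rule LIMSEQ_I)
      fix e :: real assume e: "0 < e"
      then obtain N where N: "\<And>m n. N \<le> m \<Longrightarrow> N \<le> n \<Longrightarrow> sqrt (LINT x|M. (cmod (F m x - F n x))\<^sup>2) < e / 2"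
        using Cau[of "e / 2"] by auto
      have "norm (sqrt (LINT x|M. (cmod (F n x - f x))\<^sup>2) - 0) < e" if "N \<le> n" for n
      proof -
        have "ennreal (LINT x|M. (cmod (F n x - f x))\<^sup>2) \<le> ennreal ((e / 2)\<^sup>2)"
          using fatou[OF N that] e Vint[OF diff[OF FV fV]] by (simp add: nn_integral_eq_integral)
        then have "(LINT x|M. (cmod (F n x - f x))\<^sup>2) \<le> (e / 2)\<^sup>2"
          by (simp add: ennreal_le_iff)
        then have "sqrt (LINT x|M. (cmod (F n x - f x))\<^sup>2) \<le> e / 2"
          using e by (intro real_le_lsqrt) auto
        moreover have "0 \<le> sqrt (LINT x|M. (cmod (F n x - f x))\<^sup>2)" by simp
        ultimately show ?thesis using e by (simp only: diff_0_right real_norm_def abs_of_nonneg)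
      qed
      then show "\<exists>N. \<forall>n\<ge>N. norm (sqrt (LINT x|M. (cmod (F n x - f x))\<^sup>2) - 0) < e" by blast
    qed
    then show "\<exists>f\<in>V. (\<lambda>n. sqrt (Re (LINT x|M. (F n x - f x) * cnj (F n x - f x)))) \<longlonglongrightarrow> 0"
      using fV by (intro bexI[of _ f]) (simp_all only: self Re_complex_of_real)
  next
    fix f g assume fg: "f \<in> V" "g \<in> V"
    show "(LINT x|M. g x * cnj (f x)) = cnj (LINT x|M. f x * cnj (g x))"
      by (rule trans[OF _ Bochner_Integration.integral_cnj], rule Bochner_Integration.integral_cong) (simp_all add: mult.commute)
  next
    fix x
    show "\<exists>C. \<forall>f\<in>V. cmod (f x) \<le> C * sqrt (Re (LINT x|M. f x * cnj (f x)))"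
      using eval[of x] by (simp only: self Re_complex_of_real)
  next
    fix f g h assume "f \<in> V" "g \<in> V" "h \<in> V"
    then show "(LINT x|M. (f x + g x) * cnj (h x)) = (LINT x|M. f x * cnj (h x)) + (LINT x|M. g x * cnj (h x))"
      by (simp add: distrib_right prod_int)
  next
    fix f assume "f \<in> V"
    show "0 \<le> Re (LINT x|M. f x * cnj (f x))" by (simp only: self Re_complex_of_real) simp
  qed (auto intro: add scale simp: mult.assoc)
qed

text \<open>
  Square-summable sequences are the square-integrable functions for counting measure.
\<close>

interpretation l2: function_hilbert_space "Collect in_l2"
  "\<lambda>a b. LINT n|count_space (UNIV :: nat set). a n * cnj (b n)"
proof -
  let ?M = "count_space (UNIV :: nat set)"
  have eval: "cmod (c n) \<le> sqrt (LINT n|?M. (cmod (c n))\<^sup>2)"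
    if "integrable ?M (\<lambda>n. (cmod (c n))\<^sup>2)" for c n
  proof (rule real_le_rsqrt)
    have "summable (\<lambda>n. (cmod (c n))\<^sup>2)" using that by (simp add: integrable_count_space_nat_iff)
    then have "(\<Sum>k\<in>{n}. (cmod (c k))\<^sup>2) \<le> (\<Sum>n. (cmod (c n))\<^sup>2)" by (intro sum_le_suminf) auto
    then show "(cmod (c n))\<^sup>2 \<le> (LINT n|?M. (cmod (c n))\<^sup>2)"
      using integral_count_space_nat[OF that] by simp
  qed
  have "function_hilbert_space {c. True \<and> integrable ?M (\<lambda>n. (cmod (c n))\<^sup>2)} (\<lambda>a b. LINT n|?M. a n * cnj (b n))"
    by (rule function_hilbert_space_L2I) (auto intro!: exI[of _ "1::real"] eval)
  moreover have "{c. True \<and> integrable ?M (\<lambda>n. (cmod (c n))\<^sup>2)} = Collect in_l2"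
    by (auto simp: in_l2_def integrable_count_space_nat_iff)
  ultimately show "function_hilbert_space (Collect in_l2) (\<lambda>a b. LINT n|?M. a n * cnj (b n))" by simp
qed

abbreviation l2_inner :: "(nat \<Rightarrow> complex) \<Rightarrow> (nat \<Rightarrow> complex) \<Rightarrow> complex" where
  "l2_inner a b \<equiv> LINT n|count_space UNIV. a n * cnj (b n)"

lemma l2_inner_sums:
  assumes "in_l2 a" "in_l2 b" shows "(\<lambda>n. a n * cnj (b n)) sums l2_inner a b"
proof (rule sums_integral_count_space_nat, unfold integrable_count_space_nat_iff, rule summable_comparison_test')
  show "summable (\<lambda>n. (cmod (a n))\<^sup>2 + (cmod (b n))\<^sup>2)"
    using assms by (auto simp: in_l2_def intro: summable_add)
  have "x * y \<le> x\<^sup>2 + y\<^sup>2" if "0 \<le> x" "0 \<le> y" for x y :: real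
    using zero_le_power2[of "x - y"] mult_nonneg_nonneg[OF that] by (simp add: power2_diff)
  then show "norm (norm (a n * cnj (b n))) \<le> (cmod (a n))\<^sup>2 + (cmod (b n))\<^sup>2" if "0 \<le> n" for n
    by (simp add: norm_mult)
qed

lemma l2_nrm_power2: "in_l2 c \<Longrightarrow> (l2.nrm c)\<^sup>2 = (\<Sum>n. (cmod (c n))\<^sup>2)"
proof -
  assume c: "in_l2 c"
  have "(\<lambda>n. complex_of_real ((cmod (c n))\<^sup>2)) sums complex_of_real ((l2.nrm c)\<^sup>2)"
    using l2_inner_sums[OF c c] l2.ip_self[of c] c by (simp flip: complex_norm_square)
  then show ?thesis by (subst (asm) sums_of_real_iff) (rule sums_unique)
qed

lemma l2_norm_eq: "in_l2 c \<Longrightarrow> l2_norm c = l2.nrm c"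
  using l2_nrm_power2[of c] l2.nrm_nonneg[of c] by (simp add: l2_norm_def real_sqrt_unique)

lemma l2_sum_le: "in_l2 c \<Longrightarrow> (\<Sum>n<N. (cmod (c n))\<^sup>2) \<le> (l2.nrm c)\<^sup>2"
  by (simp add: l2_nrm_power2) (simp add: in_l2_def sum_le_suminf)

lemma l2_component_le: "in_l2 c \<Longrightarrow> cmod (c n) \<le> l2.nrm c"
  using l2.nrm_nonneg[of c] l2_nrm_power2[of c] sum_le_suminf[of "\<lambda>n. (cmod (c n))\<^sup>2" "{n}"]
  by (auto simp: in_l2_def intro!: power2_le_imp_le[of "cmod (c n)"])

section \<open>The principle of uniform boundedness\<close>

context function_hilbert_space
begin

text \<open>
  The principle of uniform boundedness for seminorms, by Sokal's argument. If the operator norms \<open>N i\<close> are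
  unbounded, choose indices along which they grow faster than \<open>3 ^ n\<close> and build a sequence of steps
  of length at most \<open>(1/3) ^ n\<close>, each moving to a point where the current seminorm is large. The remaining
  steps are too short to undo this, so the limit violates the pointwise bound.
\<close>

theorem uniform_boundedness:
  fixes p :: "'i \<Rightarrow> ('a \<Rightarrow> complex) \<Rightarrow> real"
  assumes sub: "\<And>i f g. f \<in> H \<Longrightarrow> g \<in> H \<Longrightarrow> p i (\<lambda>x. f x + g x) \<le> p i f + p i g"
    and hom: "\<And>i f c. f \<in> H \<Longrightarrow> p i (\<lambda>x. c * f x) = cmod c * p i f"
    and cont: "\<And>i. \<exists>C. \<forall>f\<in>H. p i f \<le> C * nrm f"
    and ptw: "\<And>f. f \<in> H \<Longrightarrow> \<exists>K. \<forall>i. p i f \<le> K"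
  obtains M where "0 < M" "\<And>i f. f \<in> H \<Longrightarrow> p i f \<le> M * nrm f"
proof -
  define B where "B = {f \<in> H. nrm f \<le> 1}"
  define N where "N = (\<lambda>i. SUP f\<in>B. p i f)"
  have p0: "p i (\<lambda>x. 0) = 0" for i using hom[of "\<lambda>x. 0" i 0] by (simp add: zero_mem)
  have neg: "p i (\<lambda>x. - f x) = p i f" if "f \<in> H" for i f
    using hom[OF that, of i "-1"] by simp
  have sub': "p i (\<lambda>x. f x - g x) \<le> p i f + p i g" if "f \<in> H" "g \<in> H" for i f g
    using sub[of f "\<lambda>x. - g x" i] neg[OF that(2), of i] that scale_mem[OF that(2), of "-1"] by simp
  have bdd: "bdd_above (p i ` B)" for i
  proof -
    obtain C where C: "\<And>f. f \<in> H \<Longrightarrow> p i f \<le> C * nrm f" using cont by blast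
    have "p i f \<le> \<bar>C\<bar>" if "f \<in> B" for f
    proof -
      have "C * nrm f \<le> \<bar>C\<bar> * nrm f" using nrm_nonneg that by (intro mult_right_mono) (auto simp: B_def)
      also have "\<dots> \<le> \<bar>C\<bar> * 1" using that by (intro mult_left_mono) (auto simp: B_def)
      finally show ?thesis using C[of f] that by (simp add: B_def)
    qed
    then show ?thesis by (intro bdd_aboveI2)
  qed
  have p_le: "p i f \<le> N i * nrm f" if f: "f \<in> H" for i f
  proof (cases "nrm f = 0")
    case True
    then show ?thesis using cont[of i] f by auto
  next
    case False
    then have pos: "0 < nrm f" using nrm_nonneg[OF f] by simp
    have "(\<lambda>x. complex_of_real (1 / nrm f) * f x) \<in> B"
      unfolding B_def using pos scale_mem[OF f] nrm_scale[OF f, of "complex_of_real (1 / nrm f)"]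
      by (simp only: mem_Collect_eq simp_thms) (simp add: norm_divide)
    then have "p i (\<lambda>x. complex_of_real (1 / nrm f) * f x) \<le> N i"
      unfolding N_def using bdd by (rule cSUP_upper)
    then have "(1 / nrm f) * p i f \<le> N i" using hom[OF f, of i "complex_of_real (1 / nrm f)"] pos by (simp add: norm_divide)
    then show ?thesis using pos by (simp add: field_simps)
  qed
  show ?thesis
  proof (cases "\<exists>M. \<forall>i. N i \<le> M")
    case True
    then obtain M where M: "\<And>i. N i \<le> M" by blast
    have "p i f \<le> max M 1 * nrm f" if f: "f \<in> H" for i f
    proof -
      have "N i * nrm f \<le> max M 1 * nrm f"
        using M[of i] nrm_nonneg[OF f] by (intro mult_right_mono) auto
      then show ?thesis using p_le[OF f, of i] by linarith
    qed
    then show ?thesis using that[of "max M 1"] by simp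
  next
    case False
    \<comment> \<open>The limit below keeps at least a sixth of \<open>(1/3) ^ n * N (I n)\<close>: two thirds from the step,
        less one half for the tail.\<close>
    then have "\<exists>i. 6 * 3 ^ n * (real n + 1) < N i" for n :: nat by (meson not_le)
    then obtain I where I: "\<And>n. 6 * 3 ^ n * (real n + 1) < N (I n)" by metis
    have Npos: "0 < N (I n)" for n using I[of n] by (smt (verit) of_nat_0_le_iff zero_less_mult_iff zero_less_power)
    have "\<exists>e\<in>B. 2 / 3 * N (I n) < p (I n) e" for n
    proof -
      have "2 / 3 * N (I n) < (SUP f\<in>B. p (I n) f)" using Npos[of n] by (simp add: N_def)
      moreover have "B \<noteq> {}" using zero_mem nrm_zero by (auto simp: B_def)
      ultimately show ?thesis using less_cSUP_iff[OF _ bdd] by blast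
    qed
    then obtain e where e: "\<And>n. e n \<in> B" "\<And>n. 2 / 3 * N (I n) < p (I n) (e n)" by metis
    have eH: "e n \<in> H" "nrm (e n) \<le> 1" for n using e(1)[of n] by (auto simp: B_def)
    \<comment> \<open>One of the two points \<open>f \<plusminus> e n / 3 ^ n\<close> has a large seminorm, since their difference has.\<close>
    have step: "\<exists>g. g \<in> H \<and> nrm (\<lambda>x. g x - f x) \<le> (1/3) ^ n \<and> (1/3) ^ n * (2 / 3 * N (I n)) \<le> p (I n) g"
      if f: "f \<in> H" for f n
    proof -
      define d where "d = (\<lambda>x. (1/3) ^ n * e n x)"
      have dH: "d \<in> H" unfolding d_def using eH by (intro scale_mem)
      have nd: "nrm d = (1/3) ^ n * nrm (e n)" and pd: "p (I n) d = (1/3) ^ n * p (I n) (e n)"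
        unfolding d_def using nrm_scale[OF eH(1)] hom[OF eH(1)] by (simp_all add: norm_power norm_divide)
      have nd1: "nrm d \<le> (1/3) ^ n" unfolding nd using eH(2)[of n] by (simp add: field_simps)
      have "2 * p (I n) d = p (I n) (\<lambda>x. (f x + d x) - (f x - d x))"
        using hom[OF dH, of "I n" 2] by simp
      also have "\<dots> \<le> p (I n) (\<lambda>x. f x + d x) + p (I n) (\<lambda>x. f x - d x)"
        using f dH by (intro sub' mem)
      finally have "p (I n) d \<le> p (I n) (\<lambda>x. f x + d x) \<or> p (I n) d \<le> p (I n) (\<lambda>x. f x - d x)" by linarith
      moreover have "(1/3) ^ n * (2 / 3 * N (I n)) \<le> p (I n) d"
        unfolding pd using e(2)[of n] by (intro mult_left_mono) auto
      moreover have "nrm (\<lambda>x. (f x + d x) - f x) \<le> (1/3) ^ n" using nd1 by simp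
      moreover have "nrm (\<lambda>x. (f x - d x) - f x) \<le> (1/3) ^ n"
        using nd1 nrm_scale[OF dH, of "-1"] by simp
      ultimately show ?thesis using mem(2)[OF f dH] mem(4)[OF f dH]
        by (meson order_trans)
    qed
    obtain X where X: "\<And>n. X n \<in> H" "\<And>n. nrm (\<lambda>x. X (Suc n) x - X n x) \<le> (1/3) ^ n"
        "\<And>n. (1/3) ^ n * (2 / 3 * N (I n)) \<le> p (I n) (X (Suc n))"
    proof -
      have "\<exists>X. \<forall>n. X n \<in> H \<and> (nrm (\<lambda>x. X (Suc n) x - X n x) \<le> (1/3) ^ n
          \<and> (1/3) ^ n * (2 / 3 * N (I n)) \<le> p (I n) (X (Suc n)))"
        by (rule dependent_nat_choice) (use zero_mem step in blast)+
      then show ?thesis using that by blast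
    qed
    have dist: "nrm (\<lambda>x. X (n + k) x - X n x) \<le> 3/2 * ((1/3) ^ n - (1/3) ^ (n + k))" for n k
    proof (induction k)
      case (Suc k)
      show ?case
        using nrm_triangle[OF X(1)[of "n + Suc k"] X(1)[of "n + k"] X(1)[of n]] X(2)[of "n + k"] Suc by simp
    qed (simp add: nrm_zero)
    have dist': "nrm (\<lambda>x. X m x - X n x) \<le> 3/2 * (1/3) ^ n" if "n \<le> m" for m n
    proof -
      have "nrm (\<lambda>x. X m x - X n x) \<le> 3/2 * ((1/3) ^ n - (1/3) ^ m)"
        using dist[of n "m - n"] that by simp
      also have "\<dots> \<le> 3/2 * (1/3) ^ n" by simp
      finally show ?thesis .
    qed
    obtain x where x: "x \<in> H" "(\<lambda>n. nrm (\<lambda>t. X n t - x t)) \<longlonglongrightarrow> 0"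
    proof (rule complete[of X])
      fix r :: real assume r: "0 < r"
      then obtain K where K: "(1/3) ^ K < r / 3" using real_arch_pow_inv[of "r / 3" "1/3"] by auto
      have "nrm (\<lambda>x. X m x - X n x) < r" if "K \<le> m" "K \<le> n" for m n
        using nrm_triangle[OF X(1)[of m] X(1)[of K] X(1)[of n]] dist'[OF that(1)] dist'[OF that(2)]
          nrm_diff_commute[OF X(1)[of K] X(1)[of n]] K by simp
      then show "\<exists>K. \<forall>m\<ge>K. \<forall>n\<ge>K. nrm (\<lambda>x. X m x - X n x) < r" by blast
    qed (use X in auto)
    have tail: "nrm (\<lambda>t. X n t - x t) \<le> 3/2 * (1/3) ^ n" for n
    proof (rule LIMSEQ_le_const)
      show "(\<lambda>m. 3/2 * (1/3) ^ n + nrm (\<lambda>t. X m t - x t)) \<longlonglongrightarrow> 3/2 * (1/3) ^ n"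
        using tendsto_add[OF tendsto_const x(2), of "3/2 * (1/3) ^ n"] by simp
      show "\<exists>M. \<forall>m\<ge>M. nrm (\<lambda>t. X n t - x t) \<le> 3/2 * (1/3) ^ n + nrm (\<lambda>t. X m t - x t)"
      proof (intro exI allI impI)
        fix m assume "n \<le> m"
        then show "nrm (\<lambda>t. X n t - x t) \<le> 3/2 * (1/3) ^ n + nrm (\<lambda>t. X m t - x t)"
          using nrm_triangle[OF X(1)[of n] X(1)[of m] x(1)] nrm_diff_commute[OF X(1)[of n] X(1)[of m]]
            dist'[of n m] by linarith
      qed
    qed
    obtain K where K: "\<And>i. p i x \<le> K" using ptw x by blast
    obtain n where n: "K < real n" using reals_Archimedean2 by blast
    have "p (I n) (X (Suc n)) \<le> p (I n) x + p (I n) (\<lambda>t. X (Suc n) t - x t)"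
      using sub[of x "\<lambda>t. X (Suc n) t - x t" "I n"] X(1) x(1) by (simp add: mem)
    moreover have "p (I n) (\<lambda>t. X (Suc n) t - x t) \<le> N (I n) * (3/2 * (1/3) ^ Suc n)"
      using p_le[OF diff_mem[OF X(1)[of "Suc n"] x(1)], of "I n"]
        mult_left_mono[OF tail[of "Suc n"] less_imp_le[OF Npos[of n]]] by linarith
    moreover have "N (I n) * (3/2 * (1/3) ^ Suc n) = (1/3) ^ n * N (I n) / 2"
      "(1/3) ^ n * (2/3 * N (I n)) = 2/3 * ((1/3) ^ n * N (I n))" by simp_all
    ultimately have "(1/3) ^ n * N (I n) / 6 \<le> p (I n) x"
      using X(3)[of n] by linarith
    moreover have "real n + 1 < (1/3) ^ n * N (I n) / 6"
      using I[of n] by (simp add: field_simps power_divide)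
    ultimately show ?thesis using K[of "I n"] n by simp
  qed
qed

section \<open>Bessel sequences and synthesis\<close>

definition sums_to :: "(nat \<Rightarrow> 'a \<Rightarrow> complex) \<Rightarrow> ('a \<Rightarrow> complex) \<Rightarrow> bool" where
  "sums_to u s \<longleftrightarrow> (\<forall>n. u n \<in> H) \<and> s \<in> H \<and> (\<lambda>N. nrm (\<lambda>x. (\<Sum>n<N. u n x) - s x)) \<longlonglongrightarrow> 0"

definition bessel :: "(nat \<Rightarrow> 'a \<Rightarrow> complex) \<Rightarrow> bool" where
  "bessel u \<longleftrightarrow> (\<forall>n. u n \<in> H) \<and> (\<exists>B>0. \<forall>f\<in>H.
     summable (\<lambda>n. (cmod (ip f (u n)))\<^sup>2) \<and> (\<Sum>n. (cmod (ip f (u n)))\<^sup>2) \<le> B * (nrm f)\<^sup>2)"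

lemma bessel_mem: "bessel u \<Longrightarrow> u n \<in> H"
  by (simp add: bessel_def)

lemma besselE:
  assumes "bessel u"
  obtains B where "0 < B" "\<And>f. f \<in> H \<Longrightarrow> summable (\<lambda>n. (cmod (ip f (u n)))\<^sup>2)"
    "\<And>f. f \<in> H \<Longrightarrow> (\<Sum>n. (cmod (ip f (u n)))\<^sup>2) \<le> B * (nrm f)\<^sup>2"
proof -
  have "\<exists>B>0. \<forall>f\<in>H. summable (\<lambda>n. (cmod (ip f (u n)))\<^sup>2) \<and>
      (\<Sum>n. (cmod (ip f (u n)))\<^sup>2) \<le> B * (nrm f)\<^sup>2"
    using assms by (simp add: bessel_def)
  then obtain B where "0 < B" and B: "\<forall>f\<in>H. summable (\<lambda>n. (cmod (ip f (u n)))\<^sup>2) \<and>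
      (\<Sum>n. (cmod (ip f (u n)))\<^sup>2) \<le> B * (nrm f)\<^sup>2"
    by (elim exE conjE)
  with that[of B] show ?thesis by simp
qed

lemma bessel_l2: "bessel u \<Longrightarrow> f \<in> H \<Longrightarrow> in_l2 (\<lambda>n. ip f (u n))"
  by (auto simp: bessel_def in_l2_def)

lemma sums_to_ip_right:
  assumes s: "sums_to (\<lambda>n x. c n * u n x) s" and u: "\<And>n. u n \<in> H" and f: "f \<in> H"
  shows "(\<lambda>n. cnj (c n) * ip f (u n)) sums ip f s"
proof -
  have "(\<lambda>N. ip f (\<lambda>x. \<Sum>n<N. c n * u n x)) \<longlonglongrightarrow> ip f s"
    using s u f by (intro ip_tendsto_right sum_mem scale_mem) (auto simp: sums_to_def)
  then show ?thesis using u f by (simp add: sums_def ip_sum_right)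
qed

lemma besselI:
  assumes u: "\<And>n. u n \<in> H" and M: "\<And>f N. f \<in> H \<Longrightarrow> (\<Sum>n<N. (cmod (ip f (u n)))\<^sup>2) \<le> M\<^sup>2 * (nrm f)\<^sup>2"
    and "0 < M"
  shows "bessel u"
  unfolding bessel_def
proof (intro conjI allI u exI[of _ "M\<^sup>2"] ballI)
  fix f assume f: "f \<in> H"
  show "summable (\<lambda>n. (cmod (ip f (u n)))\<^sup>2)"
    by (rule bounded_imp_summable[of _ "M\<^sup>2 * (nrm f)\<^sup>2"])
      (use M[OF f, of "Suc _"] in \<open>simp_all add: lessThan_Suc_atMost\<close>)
  then show "(\<Sum>n. (cmod (ip f (u n)))\<^sup>2) \<le> M\<^sup>2 * (nrm f)\<^sup>2"
    using M[OF f] by (intro suminf_le_const) auto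
qed (use assms in simp)

text \<open>
  Duality with analysis: the square norm of a block \<open>y\<close> of the series is the pairing of its coefficients
  with the inner products of \<open>y\<close> with \<open>u\<close>, hence at most the \<open>l2\<close> norm of those coefficients
  times \<open>sqrt B * \<parallel>y\<parallel>\<close>. So the partial sums are Cauchy.
\<close>

lemma bessel_synthesis:
  assumes u: "bessel u" and c: "in_l2 c"
  obtains s where "sums_to (\<lambda>n x. c n * u n x) s"
proof -
  have uH: "u n \<in> H" for n using u bessel_mem by blast
  obtain B where B: "0 < B" "\<And>f. f \<in> H \<Longrightarrow> summable (\<lambda>n. (cmod (ip f (u n)))\<^sup>2)"
      "\<And>f. f \<in> H \<Longrightarrow> (\<Sum>n. (cmod (ip f (u n)))\<^sup>2) \<le> B * (nrm f)\<^sup>2"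
    by (rule besselE[OF u]) blast
  define S where "S = (\<lambda>N x. \<Sum>n<N. c n * u n x)"
  have SH: "S N \<in> H" for N unfolding S_def using uH by (intro sum_mem scale_mem)
  have block: "(nrm (\<lambda>x. \<Sum>n\<in>A. c n * u n x))\<^sup>2 \<le> B * (\<Sum>n\<in>A. (cmod (c n))\<^sup>2)" if A: "finite A" for A
  proof -
    define y where "y = (\<lambda>x. \<Sum>n\<in>A. c n * u n x)"
    have yH: "y \<in> H" unfolding y_def using uH by (intro sum_mem scale_mem)
    have "(nrm y)\<^sup>2 = cmod (ip y y)" using ip_self[OF yH] by (simp add: norm_power)
    also have "ip y y = (\<Sum>n\<in>A. cnj (c n) * ip y (u n))"
      using ip_sum_right[of A u y c] uH yH by (simp add: y_def)
    also have "cmod \<dots> \<le> (\<Sum>n\<in>A. \<bar>cmod (c n)\<bar> * \<bar>cmod (ip y (u n))\<bar>)"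
      by (rule order_trans[OF norm_sum]) (simp add: norm_mult)
    also have "\<dots> \<le> L2_set (\<lambda>n. cmod (c n)) A * L2_set (\<lambda>n. cmod (ip y (u n))) A"
      by (rule L2_set_mult_ineq)
    also have "\<dots> \<le> L2_set (\<lambda>n. cmod (c n)) A * (sqrt B * nrm y)"
    proof (intro mult_left_mono)
      have "(\<Sum>n\<in>A. (cmod (ip y (u n)))\<^sup>2) \<le> B * (nrm y)\<^sup>2"
        using sum_le_suminf[OF B(2)[OF yH] A] B(3)[OF yH] by simp
      then have "L2_set (\<lambda>n. cmod (ip y (u n))) A \<le> sqrt (B * (nrm y)\<^sup>2)"
        unfolding L2_set_def by (rule real_sqrt_le_mono)
      then show "L2_set (\<lambda>n. cmod (ip y (u n))) A \<le> sqrt B * nrm y"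
        using nrm_nonneg[OF yH] by (simp add: real_sqrt_mult)
    qed simp
    finally have "nrm y * nrm y \<le> (sqrt B * L2_set (\<lambda>n. cmod (c n)) A) * nrm y"
      by (simp add: power2_eq_square algebra_simps)
    then have "nrm y \<le> sqrt B * L2_set (\<lambda>n. cmod (c n)) A"
      using nrm_nonneg[OF yH] B(1) by (cases "nrm y = 0") auto
    then have "(nrm y)\<^sup>2 \<le> (sqrt B * L2_set (\<lambda>n. cmod (c n)) A)\<^sup>2"
      using nrm_nonneg[OF yH] by (intro power_mono)
    also have "\<dots> = B * (\<Sum>n\<in>A. (cmod (c n))\<^sup>2)"
      using B(1) by (simp add: power_mult_distrib L2_set_def sum_nonneg)
    finally show ?thesis by (simp add: y_def)
  qed
  have diff: "(\<lambda>x. S m x - S n x) = (\<lambda>x. \<Sum>k\<in>{n..<m}. c k * u k x)" if "n \<le> m" for m n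
  proof
    fix x
    show "S m x - S n x = (\<Sum>k\<in>{n..<m}. c k * u k x)"
      using sum_diff_nat_ivl[of 0 n m "\<lambda>k. c k * u k x"] that by (simp add: S_def atLeast0LessThan)
  qed
  obtain s where "s \<in> H" "(\<lambda>n. nrm (\<lambda>x. S n x - s x)) \<longlonglongrightarrow> 0"
  proof (rule complete[of S])
    fix e :: real assume e: "0 < e"
    have "summable (\<lambda>n. (cmod (c n))\<^sup>2)" using c by (simp add: in_l2_def)
    then obtain N where N: "\<And>m n. N \<le> m \<Longrightarrow> norm (\<Sum>k\<in>{m..<n}. (cmod (c k))\<^sup>2) < e\<^sup>2 / B"
    proof -
      have "0 < e\<^sup>2 / B" using e B(1) by simp
      with \<open>summable _\<close> have "\<exists>N. \<forall>m\<ge>N. \<forall>n. norm (\<Sum>k\<in>{m..<n}. (cmod (c k))\<^sup>2) < e\<^sup>2 / B"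
        unfolding summable_Cauchy by blast
      then show ?thesis using that by blast
    qed
    have le: "nrm (\<lambda>x. S m x - S n x) < e" if "N \<le> n" "n \<le> m" for m n
    proof (rule power_less_imp_less_base)
      have "(nrm (\<lambda>x. S m x - S n x))\<^sup>2 \<le> B * (\<Sum>k\<in>{n..<m}. (cmod (c k))\<^sup>2)"
        unfolding diff[OF that(2)] by (rule block) simp
      also have "\<dots> < B * (e\<^sup>2 / B)" using N[OF that(1), of m] B(1) by (intro mult_strict_left_mono) auto
      finally show "(nrm (\<lambda>x. S m x - S n x))\<^sup>2 < e\<^sup>2" using B(1) by simp
    qed (use e in simp)
    have "nrm (\<lambda>x. S m x - S n x) < e" if "N \<le> m" "N \<le> n" for m n
      using le[of n m] le[of m n] that nrm_diff_commute[OF SH SH, of m n] by (cases "n \<le> m") auto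
    then show "\<exists>N. \<forall>m\<ge>N. \<forall>n\<ge>N. nrm (\<lambda>x. S m x - S n x) < e" by blast
  qed (use SH in auto)
  then have "sums_to (\<lambda>n x. c n * u n x) s"
    using uH by (simp add: sums_to_def S_def scale_mem)
  then show ?thesis using that by blast
qed

text \<open>
  Convergence for all square-summable coefficients makes the partial synthesis operators on \<open>l2\<close> pointwise
  bounded, hence uniformly bounded. Their adjoints are the truncated analysis operators.
\<close>

lemma bessel_if_synthesis:
  assumes u: "\<And>n. u n \<in> H" and syn: "\<And>c. in_l2 c \<Longrightarrow> \<exists>s. sums_to (\<lambda>n x. c n * u n x) s"
  shows "bessel u"
proof -
  define p where "p = (\<lambda>N c. nrm (\<lambda>x. \<Sum>n<N. c n * u n x))"
  have SH: "(\<lambda>x. \<Sum>n<N. c n * u n x) \<in> H" for N c using u by (intro sum_mem scale_mem)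
  obtain M where M: "0 < M" "\<And>N c. c \<in> Collect in_l2 \<Longrightarrow> p N c \<le> M * l2.nrm c"
  proof (rule l2.uniform_boundedness[of p])
    fix N a b
    show "p N (\<lambda>n. a n + b n) \<le> p N a + p N b"
      using nrm_add[OF SH[where c=a and N=N] SH[where c=b and N=N]] by (simp add: p_def distrib_right sum.distrib)
  next
    fix N a k
    show "p N (\<lambda>n. k * a n) = cmod k * p N a"
      using nrm_scale[OF SH[where c=a and N=N], of k] by (simp add: p_def sum_distrib_left mult.assoc)
  next
    fix N
    have "p N c \<le> (\<Sum>n<N. nrm (u n)) * l2.nrm c" if c: "in_l2 c" for c
    proof -
      have "p N c \<le> (\<Sum>n<N. nrm (\<lambda>x. c n * u n x))"
        unfolding p_def using u by (intro nrm_sum_le scale_mem) auto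
      also have "\<dots> \<le> (\<Sum>n<N. nrm (u n) * l2.nrm c)"
        using l2_component_le[OF c] nrm_nonneg[OF u]
        by (intro sum_mono) (simp add: nrm_scale u mult.commute[of "cmod _"] mult_left_mono)
      finally show ?thesis by (simp add: sum_distrib_right)
    qed
    then show "\<exists>C. \<forall>c\<in>Collect in_l2. p N c \<le> C * l2.nrm c" by blast
  next
    fix c assume "c \<in> Collect in_l2"
    then obtain s where s: "sums_to (\<lambda>n x. c n * u n x) s" using syn by blast
    then have "(\<lambda>N. p N c) \<longlonglongrightarrow> nrm s"
      unfolding p_def using SH by (intro nrm_tendsto) (auto simp: sums_to_def)
    then have "Bseq (\<lambda>N. p N c)" by (intro convergent_imp_Bseq convergentI)
    then show "\<exists>K. \<forall>N. p N c \<le> K" by (auto simp: Bseq_def abs_le_iff)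
  qed blast
  show ?thesis
  proof (rule besselI[OF u _ M(1)])
    fix f N assume f: "f \<in> H"
    \<comment> \<open>Test the synthesis bound on the truncated analysis of \<open>f\<close>.\<close>
    define c where "c = (\<lambda>n. if n < N then ip f (u n) else 0)"
    define S where "S = (\<Sum>n<N. (cmod (ip f (u n)))\<^sup>2)"
    have S0: "0 \<le> S" by (simp add: S_def sum_nonneg)
    have sums: "(\<lambda>n. (cmod (c n))\<^sup>2) sums S"
      using sums_finite[of "{..<N}" "\<lambda>n. (cmod (c n))\<^sup>2"] by (simp add: c_def S_def)
    then have c: "in_l2 c" by (auto simp: in_l2_def sums_iff)
    have "(l2.nrm c)\<^sup>2 = S" using l2_nrm_power2[OF c] sums by (simp add: sums_iff)
    then have nc: "l2.nrm c = sqrt S"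
      using l2.nrm_nonneg[of c] c by (intro real_sqrt_unique[symmetric]) auto
    have "ip f (\<lambda>x. \<Sum>n<N. c n * u n x) = (\<Sum>n<N. cnj (c n) * ip f (u n))"
      using f u by (intro ip_sum_right) auto
    also have "\<dots> = (\<Sum>n<N. complex_of_real ((cmod (ip f (u n)))\<^sup>2))"
      unfolding complex_norm_square by (intro sum.cong) (auto simp: c_def)
    finally have "complex_of_real S = ip f (\<lambda>x. \<Sum>n<N. c n * u n x)"
      by (simp add: S_def)
    then have "S = cmod (ip f (\<lambda>x. \<Sum>n<N. c n * u n x))"
      using S0 norm_of_real[of S, where 'a = complex] by simp
    also have "\<dots> \<le> nrm f * p N c" unfolding p_def by (rule Cauchy_Schwarz[OF f SH])
    also have "\<dots> \<le> nrm f * (M * sqrt S)"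
      using M(2)[of c N] c nc nrm_nonneg[OF f] by (intro mult_left_mono) auto
    finally have *: "sqrt S * sqrt S \<le> (M * nrm f) * sqrt S" using S0 by (simp add: algebra_simps)
    have "sqrt S \<le> M * nrm f"
    proof (cases "S = 0")
      case False
      then have "0 < sqrt S" using S0 by simp
      with * show ?thesis by (rule mult_right_le_imp_le)
    qed (use M(1) nrm_nonneg[OF f] in simp)
    then have "S \<le> (M * nrm f)\<^sup>2" using S0 by (simp add: sqrt_le_D)
    then show "(\<Sum>n<N. (cmod (ip f (u n)))\<^sup>2) \<le> M\<^sup>2 * (nrm f)\<^sup>2"
      by (simp add: S_def power_mult_distrib)
  qed
qed

text \<open>
  Pointwise summability is pointwise boundedness of the truncated analysis operators.
\<close>

lemma bessel_if_summable:
  assumes u: "\<And>n. u n \<in> H" and summ: "\<And>f. f \<in> H \<Longrightarrow> summable (\<lambda>n. (cmod (ip f (u n)))\<^sup>2)"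
  shows "bessel u"
proof -
  define p where "p = (\<lambda>N f. L2_set (\<lambda>n. cmod (ip f (u n))) {..<N})"
  obtain M where M: "0 < M" "\<And>N f. f \<in> H \<Longrightarrow> p N f \<le> M * nrm f"
  proof (rule uniform_boundedness[of p])
    fix N f g assume fg: "f \<in> H" "g \<in> H"
    have "p N (\<lambda>x. f x + g x) \<le> L2_set (\<lambda>n. cmod (ip f (u n)) + cmod (ip g (u n))) {..<N}"
      unfolding p_def using fg u by (intro L2_set_mono) (simp_all add: ip_simps norm_triangle_ineq)
    also have "\<dots> \<le> p N f + p N g" unfolding p_def by (rule L2_set_triangle_ineq)
    finally show "p N (\<lambda>x. f x + g x) \<le> p N f + p N g" .
  next
    fix N f k assume f: "f \<in> H"
    show "p N (\<lambda>x. k * f x) = cmod k * p N f"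
      using f u by (simp add: p_def ip_simps norm_mult L2_set_right_distrib)
  next
    fix N
    have "p N f \<le> (\<Sum>n<N. nrm (u n)) * nrm f" if f: "f \<in> H" for f
    proof -
      have "p N f \<le> (\<Sum>n<N. cmod (ip f (u n)))" unfolding p_def by (rule L2_set_le_sum) simp
      also have "\<dots> \<le> (\<Sum>n<N. nrm (u n) * nrm f)"
        using Cauchy_Schwarz[OF f u] by (intro sum_mono) (simp add: mult.commute)
      finally show ?thesis by (simp add: sum_distrib_right)
    qed
    then show "\<exists>C. \<forall>f\<in>H. p N f \<le> C * nrm f" by blast
  next
    fix f assume "f \<in> H"
    then have "p N f \<le> sqrt (\<Sum>n. (cmod (ip f (u n)))\<^sup>2)" for N
      unfolding p_def L2_set_def using summ by (intro real_sqrt_le_mono sum_le_suminf) auto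
    then show "\<exists>K. \<forall>N. p N f \<le> K" by blast
  qed blast
  show ?thesis
  proof (rule besselI[OF u _ M(1)])
    fix f N assume f: "f \<in> H"
    have "(\<Sum>n<N. (cmod (ip f (u n)))\<^sup>2) = (p N f)\<^sup>2"
      by (simp add: p_def L2_set_def sum_nonneg)
    also have "\<dots> \<le> (M * nrm f)\<^sup>2" using M(2)[OF f, of N] by (intro power_mono) (simp_all add: p_def)
    finally show "(\<Sum>n<N. (cmod (ip f (u n)))\<^sup>2) \<le> M\<^sup>2 * (nrm f)\<^sup>2" by (simp add: power_mult_distrib)
  qed
qed

end

section \<open>Douglas factorization and atomic systems\<close>

context function_hilbert_space
begin

definition adjoint_pair ::
  "(('a \<Rightarrow> complex) \<Rightarrow> 'a \<Rightarrow> complex) \<Rightarrow> (('a \<Rightarrow> complex) \<Rightarrow> 'a \<Rightarrow> complex) \<Rightarrow> bool" where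
  "adjoint_pair L K \<longleftrightarrow>
     (\<forall>f\<in>H. L f \<in> H \<and> K f \<in> H) \<and> (\<forall>f\<in>H. \<forall>g\<in>H. ip (L f) g = ip f (K g))"

lemma adjoint_pair_sym: "adjoint_pair L K \<Longrightarrow> adjoint_pair K L"
proof -
  assume LK: "adjoint_pair L K"
  have "ip (K f) g = ip f (L g)" if fg: "f \<in> H" "g \<in> H" for f g
  proof -
    have "ip (K f) g = cnj (ip g (K f))"
      using LK fg ip_commute[of g "K f"] by (simp add: adjoint_pair_def)
    also have "\<dots> = cnj (ip (L g) f)" using LK fg by (simp add: adjoint_pair_def)
    also have "\<dots> = ip f (L g)"
      using LK fg ip_commute[of "L g" f] by (simp add: adjoint_pair_def)
    finally show ?thesis .
  qed
  then show ?thesis using LK by (simp add: adjoint_pair_def)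
qed

lemma adjoint_exists:
  assumes mem: "\<And>f. f \<in> H \<Longrightarrow> L f \<in> H"
    and add: "\<And>f g. f \<in> H \<Longrightarrow> g \<in> H \<Longrightarrow> L (\<lambda>x. f x + g x) = (\<lambda>x. L f x + L g x)"
    and scale: "\<And>f c. f \<in> H \<Longrightarrow> L (\<lambda>x. c * f x) = (\<lambda>x. c * L f x)"
    and bound: "\<And>f. f \<in> H \<Longrightarrow> nrm (L f) \<le> C * nrm f"
    and g: "g \<in> H"
  shows "\<exists>!k. k \<in> H \<and> (\<forall>f\<in>H. ip (L f) g = ip f k)"
proof (rule riesz[where C = "C * nrm g"])
  fix f assume f: "f \<in> H"
  have "cmod (ip (L f) g) \<le> nrm (L f) * nrm g" using Cauchy_Schwarz mem f g by blast
  also have "\<dots> \<le> (C * nrm f) * nrm g" using bound[OF f] nrm_nonneg[OF g] by (rule mult_right_mono)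
  finally show "cmod (ip (L f) g) \<le> C * nrm g * nrm f" by (simp add: algebra_simps)
qed (use g in \<open>simp_all add: mem add scale ip_simps\<close>)

text \<open>
  The factorization \<open>L = T* X\<close> passes to \<open>L* = X* T\<close>: both series converge since the sequences are
  Bessel, so the identity can be tested weakly, where it is the conjugate of the given one. Exchanging
  \<open>u\<close> with \<open>g\<close> and \<open>L\<close> with \<open>K\<close> gives the converse passage.
\<close>

lemma bessel_sums_adjoint:
  assumes LK: "adjoint_pair L K" and u: "bessel u" and g: "bessel g"
    and L: "\<And>h. h \<in> H \<Longrightarrow> sums_to (\<lambda>n x. ip h (g n) * u n x) (L h)"
    and f: "f \<in> H"
  shows "sums_to (\<lambda>n x. ip f (u n) * g n x) (K f)"
proof -
  have uH: "u n \<in> H" and gH: "g n \<in> H" for n using u g bessel_mem by blast+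
  have KH: "K f \<in> H" using LK f by (simp add: adjoint_pair_def)
  obtain s where s: "sums_to (\<lambda>n x. ip f (u n) * g n x) s"
    using bessel_synthesis[OF g bessel_l2[OF u f]] by blast
  have sH: "s \<in> H" using s by (simp add: sums_to_def)
  have "ip h s = ip h (K f)" if h: "h \<in> H" for h
  proof -
    have LH: "L h \<in> H" using LK h by (simp add: adjoint_pair_def)
    have "(\<lambda>n. cnj (cnj (ip h (g n)) * ip f (u n))) sums cnj (ip f (L h))"
      using sums_to_ip_right[OF L[OF h] uH f] by (simp only: sums_cnj)
    then have "(\<lambda>n. cnj (ip f (u n)) * ip h (g n)) sums cnj (ip f (L h))"
      by (simp add: mult.commute)
    moreover have "cnj (ip f (L h)) = ip h (K f)"
      using LK h f ip_commute[OF f LH] by (simp add: adjoint_pair_def)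
    ultimately show ?thesis
      using sums_unique2[OF sums_to_ip_right[OF s gH h]] by simp
  qed
  then have "s = K f" by (rule eq_if_ip_eq[OF sH KH])
  then show ?thesis using s by simp
qed

text \<open>
  Majorization gives factorization. For fixed \<open>h\<close>, the number \<open>ip f (L h) = ip (K f) h\<close> is controlled by
  the norm of \<open>T f\<close>, so it is a bounded functional of \<open>T f\<close> in \<open>l2\<close> and is represented by a sequence
  \<open>b\<close> in the closure of the range of \<open>T\<close>. Being unique, \<open>b\<close> depends linearly on \<open>h\<close>, and its norm is
  at most a constant times the norm of \<open>h\<close>. Each coordinate \<open>b n\<close> is therefore a bounded functional of
  \<open>h\<close>, represented by a vector \<open>g n\<close>, and the bound for \<open>b\<close> is the Bessel bound for \<open>g\<close>.
\<close>

theorem douglas_factorization: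
  assumes LK: "adjoint_pair L K" and u: "bessel u"
    and dom: "\<And>f. f \<in> H \<Longrightarrow> A * (nrm (K f))\<^sup>2 \<le> (\<Sum>n. (cmod (ip f (u n)))\<^sup>2)" and A: "0 < A"
  obtains g where "bessel g" "\<And>h. h \<in> H \<Longrightarrow> sums_to (\<lambda>n x. ip h (g n) * u n x) (L h)"
proof -
  have uH: "u n \<in> H" for n using u bessel_mem by blast
  have LH: "L f \<in> H" and KH: "K f \<in> H" if "f \<in> H" for f
    using LK that by (auto simp: adjoint_pair_def)
  have adj: "ip f (L h) = ip (K f) h" if "f \<in> H" "h \<in> H" for f h
    using adjoint_pair_sym[OF LK] that by (simp add: adjoint_pair_def)
  define T where "T = (\<lambda>f n. ip f (u n))"
  have T2: "in_l2 (T f)" if "f \<in> H" for f using bessel_l2[OF u that] by (simp add: T_def)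
  have K_le: "nrm (K f) \<le> l2.nrm (T f) / sqrt A" if f: "f \<in> H" for f
  proof -
    have "A * (nrm (K f))\<^sup>2 \<le> (l2.nrm (T f))\<^sup>2" using dom[OF f] l2_nrm_power2[OF T2[OF f]] by (simp add: T_def)
    then have "(nrm (K f))\<^sup>2 \<le> (l2.nrm (T f) / sqrt A)\<^sup>2" using A by (simp add: power_divide field_simps)
    then show ?thesis
      by (rule power2_le_imp_le) (use A l2.nrm_nonneg[of "T f"] T2[OF f] in simp)
  qed
  \<comment> \<open>\<open>R h b\<close>: the sequence \<open>b\<close> represents \<open>h\<close> and lies in the closure of the range of \<open>T\<close>. Stating
      the closure as a double orthogonal complement makes linearity of \<open>R\<close> immediate.\<close>
  define R where "R = (\<lambda>h b. in_l2 b \<and> (\<forall>f\<in>H. ip f (L h) = l2_inner (T f) b) \<and>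
    (\<forall>d. in_l2 d \<longrightarrow> (\<forall>f\<in>H. l2_inner (T f) d = 0) \<longrightarrow> l2_inner b d = 0))"
  have R_ex: "\<exists>b. R h b \<and> l2.nrm b \<le> nrm h / sqrt A" if h: "h \<in> H" for h
  proof -
    let ?G = "{(T f, ip f (L h)) | f. f \<in> H}"
    obtain b where b: "b \<in> Collect in_l2" "\<And>w s. (w, s) \<in> ?G \<Longrightarrow> s = l2_inner w b"
      "l2.nrm b \<le> \<bar>nrm h / sqrt A\<bar>"
      "\<And>d. d \<in> Collect in_l2 \<Longrightarrow> (\<And>w s. (w, s) \<in> ?G \<Longrightarrow> l2_inner w d = 0) \<Longrightarrow> l2_inner b d = 0"
    proof (rule l2.riesz_relation[of ?G])
      show "?G \<subseteq> Collect in_l2 \<times> UNIV" using T2 by auto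
      show "((\<lambda>n. 0), 0) \<in> ?G"
        using zero_mem uH LH[OF h] by (auto simp: T_def ip_zero_left intro!: exI[of _ "\<lambda>x. 0"])
    next
      fix a s a' s' assume "(a, s) \<in> ?G" "(a', s') \<in> ?G"
      then obtain f f' where f: "f \<in> H" "a = T f" "s = ip f (L h)" and f': "f' \<in> H" "a' = T f'" "s' = ip f' (L h)"
        by blast
      then have "(\<lambda>n. a n + a' n) = T (\<lambda>x. f x + f' x)" "s + s' = ip (\<lambda>x. f x + f' x) (L h)"
        using uH LH[OF h] by (simp_all add: T_def ip_simps)
      then show "((\<lambda>n. a n + a' n), s + s') \<in> ?G" using add_mem[OF f(1) f'(1)] by blast
    next
      fix a s c assume "(a, s) \<in> ?G"
      then obtain f where f: "f \<in> H" "a = T f" "s = ip f (L h)" by blast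
      then have "(\<lambda>n. c * a n) = T (\<lambda>x. c * f x)" "c * s = ip (\<lambda>x. c * f x) (L h)"
        using uH LH[OF h] by (simp_all add: T_def ip_simps)
      then show "((\<lambda>n. c * a n), c * s) \<in> ?G" using scale_mem[OF f(1)] by blast
    next
      fix a s assume "(a, s) \<in> ?G"
      then obtain f where f: "f \<in> H" "a = T f" "s = ip f (L h)" by blast
      have "cmod s \<le> nrm (K f) * nrm h" using f adj h KH Cauchy_Schwarz by simp
      also have "\<dots> \<le> (l2.nrm a / sqrt A) * nrm h"
        using K_le[OF f(1)] nrm_nonneg[OF h] f(2) by (intro mult_right_mono) auto
      finally show "cmod s \<le> nrm h / sqrt A * l2.nrm a" by (simp add: mult.commute)
    qed blast
    have "R h b" unfolding R_def
    proof (intro conjI ballI allI impI)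
      show "in_l2 b" using b by simp
      show "ip f (L h) = l2_inner (T f) b" if "f \<in> H" for f using b(2)[of "T f"] that by blast
      show "l2_inner b d = 0" if "in_l2 d" "\<forall>f\<in>H. l2_inner (T f) d = 0" for d
        using b(4)[of d] that by blast
    qed
    moreover have "\<bar>nrm h / sqrt A\<bar> = nrm h / sqrt A" using nrm_nonneg[OF h] A by simp
    ultimately show ?thesis using b(3) by auto
  qed
  have R_unique: "b = b'" if R: "R h b" "R h b'" for h b b'
  proof -
    have in2: "in_l2 b" "in_l2 b'" using R by (auto simp: R_def)
    define d where "d = (\<lambda>n. b n - b' n)"
    have d: "in_l2 d" using l2.diff_mem[of b b'] in2 by (simp add: d_def)
    have "l2_inner (T f) d = 0" if "f \<in> H" for f
      using l2.ip_diff_right[of b b' "T f"] in2 T2[OF that] R that unfolding R_def d_def by simp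
    then have "l2_inner b d = 0" "l2_inner b' d = 0" using R d by (auto simp: R_def)
    then have "l2_inner d d = 0" using l2.ip_diff_left[of b b' d] in2 d by (simp add: d_def)
    then have "l2.nrm d = 0" by (simp add: l2.nrm_def)
    then have "d = (\<lambda>n. 0)" using l2.nrm_eq_0D[of d] d by simp
    then show ?thesis by (auto simp: d_def fun_eq_iff)
  qed
  have R_bound: "l2.nrm b \<le> nrm h / sqrt A" if "h \<in> H" "R h b" for h b
    using R_ex[OF that(1)] R_unique[OF that(2)] by blast
  have R_0: "R (\<lambda>x. 0) (\<lambda>n. 0)"
  proof -
    obtain b where b: "R (\<lambda>x. 0) b" using R_ex[OF zero_mem] by blast
    have "l2.nrm b \<le> 0" using R_bound[OF zero_mem b] by (simp add: nrm_zero)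
    then have "l2.nrm b = 0" using l2.nrm_nonneg[of b] b by (simp add: R_def)
    then have "b = (\<lambda>n. 0)" using l2.nrm_eq_0D[of b] b by (simp add: R_def)
    then show ?thesis using b by simp
  qed
  have L_add: "L (\<lambda>x. h x + h' x) = (\<lambda>x. L h x + L h' x)" if "h \<in> H" "h' \<in> H" for h h'
    using that by (intro eq_if_ip_eq) (auto simp: mem LH ip_simps adj KH)
  have L_scale: "L (\<lambda>x. c * h x) = (\<lambda>x. c * L h x)" if "h \<in> H" for h c
    using that by (intro eq_if_ip_eq) (auto simp: mem LH ip_simps adj KH)
  have R_add: "R (\<lambda>x. h x + h' x) (\<lambda>n. b n + b' n)" if "h \<in> H" "h' \<in> H" "R h b" "R h' b'" for h h' b b'
  proof -
    have in2: "b \<in> Collect in_l2" "b' \<in> Collect in_l2" using that by (auto simp: R_def)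
    have "ip f (L (\<lambda>x. h x + h' x)) = l2_inner (T f) (\<lambda>n. b n + b' n)" if f: "f \<in> H" for f
      using l2.ip_add_right[OF in2, of "T f"] T2[OF f] L_add \<open>h \<in> H\<close> \<open>h' \<in> H\<close> LH f
        \<open>R h b\<close> \<open>R h' b'\<close> by (simp add: ip_simps R_def)
    moreover have "l2_inner (\<lambda>n. b n + b' n) d = 0" if d: "in_l2 d" "\<forall>f\<in>H. l2_inner (T f) d = 0" for d
      using l2.ip_add_left[OF in2, of d] d \<open>R h b\<close> \<open>R h' b'\<close> by (simp add: R_def)
    ultimately show ?thesis using l2.add_mem[OF in2] unfolding R_def by blast
  qed
  have R_scale: "R (\<lambda>x. c * h x) (\<lambda>n. c * b n)" if "h \<in> H" "R h b" for h b c
  proof -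
    have in2: "b \<in> Collect in_l2" using that by (auto simp: R_def)
    have "ip f (L (\<lambda>x. c * h x)) = l2_inner (T f) (\<lambda>n. c * b n)" if f: "f \<in> H" for f
      using l2.ip_scale_right[OF in2, of "T f" c] T2[OF f] L_scale \<open>h \<in> H\<close> LH f
        \<open>R h b\<close> by (simp add: ip_simps R_def)
    moreover have "l2_inner (\<lambda>n. c * b n) d = 0" if d: "in_l2 d" "\<forall>f\<in>H. l2_inner (T f) d = 0" for d
      using l2.ip_scale_left[OF in2, of d c] d \<open>R h b\<close> by (simp add: R_def)
    ultimately show ?thesis using l2.scale_mem[OF in2] unfolding R_def by blast
  qed
  have "\<exists>g. g \<in> H \<and> (\<forall>h\<in>H. \<forall>b. R h b \<longrightarrow> b n = ip h g)" for n
  proof -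
    let ?G = "{(h, b n) | h b. h \<in> H \<and> R h b}"
    obtain g where "g \<in> H" "\<And>h s. (h, s) \<in> ?G \<Longrightarrow> s = ip h g"
    proof (rule riesz_relation[of ?G "1 / sqrt A"])
      show "?G \<subseteq> H \<times> UNIV" by auto
      show "((\<lambda>x. 0), 0) \<in> ?G" using zero_mem R_0 by fastforce
    next
      fix h s h' s' assume "(h, s) \<in> ?G" "(h', s') \<in> ?G"
      then show "((\<lambda>x. h x + h' x), s + s') \<in> ?G" using add_mem R_add by fastforce
    next
      fix h s c assume "(h, s) \<in> ?G"
      then show "((\<lambda>x. c * h x), c * s) \<in> ?G" using scale_mem R_scale by fastforce
    next
      fix h s assume "(h, s) \<in> ?G"
      then obtain b where b: "h \<in> H" "R h b" "s = b n" by blast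
      then have "cmod s \<le> l2.nrm b" using l2_component_le[of b n] by (simp add: R_def)
      then show "cmod s \<le> 1 / sqrt A * nrm h" using R_bound[OF b(1,2)] by simp
    qed blast
    then show ?thesis by blast
  qed
  then obtain g where g: "\<And>n. g n \<in> H" "\<And>n h b. h \<in> H \<Longrightarrow> R h b \<Longrightarrow> b n = ip h (g n)" by metis
  have R_g: "R h (\<lambda>n. ip h (g n))" if h: "h \<in> H" for h
  proof -
    obtain b where b: "R h b" using R_ex h by blast
    then have "b = (\<lambda>n. ip h (g n))" using g(2)[OF h b] by auto
    then show ?thesis using b by simp
  qed
  have bg: "bessel g"
  proof (rule besselI[where M = "1 / sqrt A", OF g(1)])
    fix f N assume f: "f \<in> H"
    have c: "in_l2 (\<lambda>n. ip f (g n))" using R_g[OF f] by (simp add: R_def)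
    have "(\<Sum>n<N. (cmod (ip f (g n)))\<^sup>2) \<le> (l2.nrm (\<lambda>n. ip f (g n)))\<^sup>2" using l2_sum_le[OF c] .
    also have "\<dots> \<le> (nrm f / sqrt A)\<^sup>2"
      using R_bound[OF f R_g[OF f]] l2.nrm_nonneg c by (intro power_mono) auto
    finally show "(\<Sum>n<N. (cmod (ip f (g n)))\<^sup>2) \<le> (1 / sqrt A)\<^sup>2 * (nrm f)\<^sup>2"
      by (simp add: power_divide)
  qed (use A in simp)
  moreover have "sums_to (\<lambda>n x. ip h (g n) * u n x) (L h)" if h: "h \<in> H" for h
  proof -
    have c: "in_l2 (\<lambda>n. ip h (g n))" using R_g[OF h] by (simp add: R_def)
    obtain s where s: "sums_to (\<lambda>n x. ip h (g n) * u n x) s" using bessel_synthesis[OF u c] by blast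
    have sH: "s \<in> H" using s by (simp add: sums_to_def)
    have "ip f s = ip f (L h)" if f: "f \<in> H" for f
    proof -
      have "(\<lambda>n. cnj (ip h (g n)) * ip f (u n)) sums ip f s"
        by (rule sums_to_ip_right[OF s uH f])
      moreover have "(\<lambda>n. cnj (ip h (g n)) * ip f (u n)) sums l2_inner (T f) (\<lambda>n. ip h (g n))"
        using l2_inner_sums[OF T2[OF f] c] by (simp add: T_def mult.commute)
      moreover have "ip f (L h) = l2_inner (T f) (\<lambda>n. ip h (g n))"
        using R_g[OF h] f by (simp add: R_def)
      ultimately show ?thesis using sums_unique2 by simp
    qed
    then have "s = L h" by (rule eq_if_ip_eq[OF sH LH[OF h]])
    then show ?thesis using s by simp
  qed
  ultimately show ?thesis using that by blast
qed

text \<open>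
  Expand \<open>L (K f)\<close> in atoms and pair with \<open>f\<close>: the result is \<open>\<parallel>K f\<parallel>\<^sup>2\<close>, and it is also the pairing of \<open>T f\<close>
  with coefficients of norm at most \<open>C * \<parallel>K f\<parallel>\<close>.
\<close>

lemma atomic_lower_bound:
  assumes LK: "adjoint_pair L K" and u: "bessel u" and C: "0 < C"
    and atoms: "\<And>f. f \<in> H \<Longrightarrow> \<exists>a. in_l2 a \<and> l2.nrm a \<le> C * nrm f \<and> sums_to (\<lambda>n x. a n * u n x) (L f)"
    and f: "f \<in> H"
  shows "1 / C\<^sup>2 * (nrm (K f))\<^sup>2 \<le> (\<Sum>n. (cmod (ip f (u n)))\<^sup>2)"
proof -
  have uH: "u n \<in> H" for n using u bessel_mem by blast
  have KH: "K f \<in> H" and LKH: "L (K f) \<in> H" using LK f by (auto simp: adjoint_pair_def)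
  define c where "c = (\<lambda>n. ip f (u n))"
  have c: "in_l2 c" using bessel_l2[OF u f] by (simp add: c_def)
  obtain a where a: "in_l2 a" "l2.nrm a \<le> C * nrm (K f)" "sums_to (\<lambda>n x. a n * u n x) (L (K f))"
    using atoms[OF KH] by blast
  have "(\<lambda>n. cnj (a n) * ip f (u n)) sums ip f (L (K f))"
    by (rule sums_to_ip_right[OF a(3) uH f])
  moreover have "(\<lambda>n. cnj (a n) * ip f (u n)) sums l2_inner c a"
    using l2_inner_sums[OF c a(1)] by (simp add: c_def mult.commute)
  ultimately have "ip f (L (K f)) = l2_inner c a" by (rule sums_unique2)
  moreover have "ip f (L (K f)) = ip (K f) (K f)"
    using adjoint_pair_sym[OF LK] f KH by (simp add: adjoint_pair_def)
  ultimately have eq: "l2_inner c a = complex_of_real ((nrm (K f))\<^sup>2)"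
    using ip_self[OF KH] by (simp only:)
  have "(nrm (K f))\<^sup>2 = cmod (l2_inner c a)"
    unfolding eq by (simp only: norm_of_real) simp
  also have "\<dots> \<le> l2.nrm c * l2.nrm a" using l2.Cauchy_Schwarz c a(1) by simp
  also have "\<dots> \<le> l2.nrm c * (C * nrm (K f))"
    using a(2) l2.nrm_nonneg c by (intro mult_left_mono) auto
  finally have "nrm (K f) * nrm (K f) \<le> (C * l2.nrm c) * nrm (K f)"
    by (simp add: power2_eq_square algebra_simps)
  then have "nrm (K f) \<le> C * l2.nrm c"
    using nrm_nonneg[OF KH] l2.nrm_nonneg[of c] c C by (cases "nrm (K f) = 0") auto
  then have "(nrm (K f))\<^sup>2 \<le> (C * l2.nrm c)\<^sup>2" using nrm_nonneg[OF KH] by (intro power_mono)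
  also have "\<dots> = C\<^sup>2 * (\<Sum>n. (cmod (ip f (u n)))\<^sup>2)"
    using l2_nrm_power2[OF c] by (simp add: power_mult_distrib c_def)
  finally show ?thesis using C by (simp add: field_simps)
qed

theorem atomic_system_equivalences:
  assumes LK: "adjoint_pair L K" and u: "\<And>n. u n \<in> H"
  defines "atomic \<equiv> (\<forall>c. in_l2 c \<longrightarrow> (\<exists>s. sums_to (\<lambda>n x. c n * u n x) s)) \<and>
      (\<exists>C>0. \<forall>f\<in>H. \<exists>a. in_l2 a \<and> l2_norm a \<le> C * nrm f \<and> sums_to (\<lambda>n x. a n * u n x) (L f))"
    and "sampling \<equiv> (\<exists>A>0. \<exists>B>0. \<forall>f\<in>H. summable (\<lambda>n. (cmod (ip f (u n)))\<^sup>2) \<and>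
      A * (nrm (K f))\<^sup>2 \<le> (\<Sum>n. (cmod (ip f (u n)))\<^sup>2) \<and>
      (\<Sum>n. (cmod (ip f (u n)))\<^sup>2) \<le> B * (nrm f)\<^sup>2)"
    and "expands_L \<equiv> bessel u \<and>
      (\<exists>g. bessel g \<and> (\<forall>f\<in>H. sums_to (\<lambda>n x. ip f (g n) * u n x) (L f)))"
    and "expands_K \<equiv> (\<forall>f\<in>H. summable (\<lambda>n. (cmod (ip f (u n)))\<^sup>2)) \<and>
      (\<exists>g. bessel g \<and> (\<forall>f\<in>H. sums_to (\<lambda>n x. ip f (u n) * g n x) (K f)))"
  shows "(atomic \<longleftrightarrow> sampling) \<and> (sampling \<longleftrightarrow> expands_L) \<and> (expands_L \<longleftrightarrow> expands_K)"
proof -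
  have "sampling" if atomic
  proof -
    have bu: "bessel u" using bessel_if_synthesis[OF u] that by (simp add: atomic_def)
    have "\<exists>C>0. \<forall>f\<in>H. \<exists>a. in_l2 a \<and> l2_norm a \<le> C * nrm f \<and> sums_to (\<lambda>n x. a n * u n x) (L f)"
      using that by (simp only: atomic_def)
    then obtain C where C: "0 < C" and
      a: "\<forall>f\<in>H. \<exists>a. in_l2 a \<and> l2_norm a \<le> C * nrm f \<and> sums_to (\<lambda>n x. a n * u n x) (L f)"
      by (elim exE conjE)
    have lower: "1 / C\<^sup>2 * (nrm (K f))\<^sup>2 \<le> (\<Sum>n. (cmod (ip f (u n)))\<^sup>2)" if "f \<in> H" for f
    proof (rule atomic_lower_bound[OF LK bu C _ that])
      fix h assume "h \<in> H"
      with a obtain a where "in_l2 a" "l2_norm a \<le> C * nrm h" "sums_to (\<lambda>n x. a n * u n x) (L h)"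
        by blast
      then show "\<exists>a. in_l2 a \<and> l2.nrm a \<le> C * nrm h \<and> sums_to (\<lambda>n x. a n * u n x) (L h)"
        by (intro exI[of _ a]) (simp add: l2_norm_eq)
    qed
    obtain B where B: "0 < B" "\<And>f. f \<in> H \<Longrightarrow> summable (\<lambda>n. (cmod (ip f (u n)))\<^sup>2)"
        "\<And>f. f \<in> H \<Longrightarrow> (\<Sum>n. (cmod (ip f (u n)))\<^sup>2) \<le> B * (nrm f)\<^sup>2"
      by (rule besselE[OF bu]) blast
    have "0 < 1 / C\<^sup>2" using C by simp
    moreover have "\<forall>f\<in>H. summable (\<lambda>n. (cmod (ip f (u n)))\<^sup>2) \<and>
        1 / C\<^sup>2 * (nrm (K f))\<^sup>2 \<le> (\<Sum>n. (cmod (ip f (u n)))\<^sup>2) \<and>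
        (\<Sum>n. (cmod (ip f (u n)))\<^sup>2) \<le> B * (nrm f)\<^sup>2"
      using B(2,3) lower by (intro ballI conjI)
    ultimately show ?thesis unfolding sampling_def using B(1) by (intro exI conjI)
  qed
  moreover have "expands_L" if sampling
  proof -
    obtain A B where "0 < A" "0 < B" and AB: "\<forall>f\<in>H. summable (\<lambda>n. (cmod (ip f (u n)))\<^sup>2) \<and>
        A * (nrm (K f))\<^sup>2 \<le> (\<Sum>n. (cmod (ip f (u n)))\<^sup>2) \<and>
        (\<Sum>n. (cmod (ip f (u n)))\<^sup>2) \<le> B * (nrm f)\<^sup>2"
      using \<open>sampling\<close> unfolding sampling_def by (elim exE conjE)
    have bu: "bessel u"
      unfolding bessel_def using u \<open>0 < B\<close> AB by (intro conjI allI exI[of _ B]) simp_all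
    obtain g where "bessel g" "\<And>h. h \<in> H \<Longrightarrow> sums_to (\<lambda>n x. ip h (g n) * u n x) (L h)"
      by (rule douglas_factorization[OF LK bu _ \<open>0 < A\<close>]) (use AB in simp_all)
    with bu show ?thesis unfolding expands_L_def by blast
  qed
  moreover have "atomic" if expands_L
  proof -
    obtain g where bu: "bessel u" and bg: "bessel g"
      and g: "\<And>f. f \<in> H \<Longrightarrow> sums_to (\<lambda>n x. ip f (g n) * u n x) (L f)"
      using \<open>expands_L\<close> unfolding expands_L_def by blast
    obtain B where B: "0 < B" "\<And>f. f \<in> H \<Longrightarrow> (\<Sum>n. (cmod (ip f (g n)))\<^sup>2) \<le> B * (nrm f)\<^sup>2"
      by (rule besselE[OF bg]) blast
    have "in_l2 (\<lambda>n. ip f (g n)) \<and> l2_norm (\<lambda>n. ip f (g n)) \<le> sqrt B * nrm f" if f: "f \<in> H" for f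
    proof
      have "l2_norm (\<lambda>n. ip f (g n)) \<le> sqrt (B * (nrm f)\<^sup>2)"
        unfolding l2_norm_def using B(2)[OF f] by (rule real_sqrt_le_mono)
      then show "l2_norm (\<lambda>n. ip f (g n)) \<le> sqrt B * nrm f"
        using nrm_nonneg[OF f] by (simp add: real_sqrt_mult)
    qed (rule bessel_l2[OF bg f])
    moreover have "\<exists>s. sums_to (\<lambda>n x. c n * u n x) s" if "in_l2 c" for c
      using bessel_synthesis[OF bu that] by blast
    moreover have "0 < sqrt B" using B(1) by simp
    ultimately show ?thesis using g unfolding atomic_def by blast
  qed
  moreover have "expands_K" if expands_L
  proof -
    obtain g where bu: "bessel u" and bg: "bessel g"
      and g: "\<And>f. f \<in> H \<Longrightarrow> sums_to (\<lambda>n x. ip f (g n) * u n x) (L f)"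
      using \<open>expands_L\<close> unfolding expands_L_def by blast
    have "summable (\<lambda>n. (cmod (ip f (u n)))\<^sup>2)" if "f \<in> H" for f
      using bessel_l2[OF bu that] by (simp add: in_l2_def)
    then show ?thesis
      using bessel_sums_adjoint[OF LK bu bg g] bg unfolding expands_K_def by blast
  qed
  moreover have "expands_L" if expands_K
  proof -
    obtain g where bg: "bessel g" and g: "\<And>f. f \<in> H \<Longrightarrow> sums_to (\<lambda>n x. ip f (u n) * g n x) (K f)"
      using \<open>expands_K\<close> unfolding expands_K_def by blast
    have bu: "bessel u"
      by (rule bessel_if_summable[OF u]) (use \<open>expands_K\<close> in \<open>simp add: expands_K_def\<close>)
    show ?thesis
      using bessel_sums_adjoint[OF adjoint_pair_sym[OF LK] bg bu g] bu bg unfolding expands_L_def by blast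
  qed
  ultimately show ?thesis by blast
qed

end

section \<open>The area mean value property\<close>

text \<open>
  Identifying the complex plane with \<open>real ^ 2\<close> turns a rotation into an orthogonal map, and so carries the
  orthogonal invariance of Lebesgue measure over to the plane.
\<close>

definition cart :: "real ^ 2 \<Rightarrow> complex" where "cart v = Complex (v $ 1) (v $ 2)"

definition uncart :: "complex \<Rightarrow> real ^ 2" where "uncart z = vector [Re z, Im z]"

lemma uncart_nth [simp]: "uncart z $ 1 = Re z" "uncart z $ 2 = Im z"
  by (simp_all add: uncart_def)

lemma cart_uncart [simp]: "cart (uncart z) = z"
  by (simp add: cart_def)

lemma uncart_cart [simp]: "uncart (cart v) = v"
  by (simp add: vec_eq_iff forall_2 cart_def)

lemma linear_cart: "linear cart"
  by (rule linearI) (simp_all add: cart_def complex_eq_iff)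

lemma linear_uncart: "linear uncart"
  by (rule linearI) (simp_all add: vec_eq_iff forall_2)

lemma norm_uncart [simp]: "norm (uncart z) = cmod z"
  by (simp add: norm_vec_def L2_set_def sum_2 cmod_def)

lemma norm_cart [simp]: "cmod (cart v) = norm v"
  using norm_uncart[of "cart v"] by simp

lemma borel_measurable_cart [measurable]: "cart \<in> borel_measurable borel"
  by (intro borel_measurable_continuous_onI linear_continuous_on linear_cart linear_conv_bounded_linear[THEN iffD1])

lemma distr_cart_lborel: "distr lborel borel cart = lborel"
proof (rule lborel_eqI[symmetric])
  fix l u :: complex assume le: "\<And>b. b \<in> Basis \<Longrightarrow> l \<bullet> b \<le> u \<bullet> b"
  have B: "(Basis :: (real ^ 2) set) = {axis 1 1, axis 2 1}"
    by (auto simp: Basis_vec_def UNIV_2)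
  have ne: "(axis 1 1 :: real ^ 2) \<noteq> axis 2 1" by (simp add: axis_eq_axis)
  have "cart -` box l u = box (uncart l) (uncart u)"
    by (auto simp: box_def B inner_axis Basis_complex_def cart_def)
  then have "emeasure (distr lborel borel cart) (box l u) = emeasure lborel (box (uncart l) (uncart u))"
    by (simp add: emeasure_distr)
  also have "\<dots> = (\<Prod>b\<in>Basis. (uncart u - uncart l) \<bullet> b)"
    using le[of 1] le[of \<i>] by (intro emeasure_lborel_box) (auto simp: B inner_axis Basis_complex_def)
  also have "(\<Prod>b\<in>Basis. (uncart u - uncart l) \<bullet> b) = (\<Prod>b\<in>Basis. (u - l) \<bullet> b)"
    using ne by (simp add: B inner_axis Basis_complex_def complex_eq_iff)
  finally show "emeasure (distr lborel borel cart) (box l u) = (\<Prod>b\<in>Basis. (u - l) \<bullet> b)" .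
qed simp

lemma distr_rotation_lborel:
  fixes a :: complex assumes a: "cmod a = 1"
  shows "distr lborel borel ((*) a) = lborel"
proof (rule lborel_eqI[symmetric])
  fix l u :: complex assume le: "\<And>b. b \<in> Basis \<Longrightarrow> l \<bullet> b \<le> u \<bullet> b"
  define \<rho> where "\<rho> = (\<lambda>v. uncart (a * cart v))"
  define S where "S = cart -` ((*) a -` box l u)"
  have "linear \<rho>"
    unfolding \<rho>_def using linear_compose[OF linear_compose[OF linear_cart bounded_linear.linear[OF bounded_linear_mult_right]] linear_uncart]
    by (simp add: o_def)
  then have \<rho>: "orthogonal_transformation \<rho>"
    using a by (simp add: orthogonal_transformation \<rho>_def norm_mult)
  have img: "\<rho> ` S = cart -` box l u"
  proof safe
    fix v assume v: "cart v \<in> box l u"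
    define w where "w = uncart (cart v / a)"
    have "a \<noteq> 0" using a by auto
    then have "v = \<rho> w" "w \<in> S" using v by (simp_all add: w_def \<rho>_def S_def)
    then show "v \<in> \<rho> ` S" by blast
  qed (simp add: \<rho>_def S_def)
  have cont: "continuous_on UNIV cart"
    by (intro linear_continuous_on linear_cart linear_conv_bounded_linear[THEN iffD1])
  have "open ((\<lambda>v. a * cart v) -` box l u)"
    by (intro open_vimage continuous_on_mult_left cont open_box)
  then have "open S" by (simp add: S_def vimage_def)
  moreover have "bounded S"
  proof -
    obtain K where K: "\<And>z. z \<in> box l u \<Longrightarrow> cmod z \<le> K"
      using bounded_box[of l u] by (auto simp: bounded_iff)
    have "norm v \<le> K" if "v \<in> S" for v
      using K[of "a * cart v"] that a by (simp add: S_def norm_mult)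
    then show ?thesis by (auto simp: bounded_iff)
  qed
  ultimately have S: "S \<in> lmeasurable" by (rule lmeasurable_open[rotated])
  have T: "cart -` box l u \<in> lmeasurable"
    using measurable_orthogonal_image[OF \<rho> S] by (simp add: img)
  have em: "emeasure lborel X = measure lebesgue X" if "X \<in> lmeasurable" "X \<in> sets borel" for X :: "(real ^ 2) set"
  proof -
    have "emeasure lborel X = emeasure lebesgue X" using that(2) by simp
    then show ?thesis using emeasure_eq_measure2[OF that(1)] by simp
  qed
  have "emeasure (distr lborel borel ((*) a)) (box l u) = emeasure (distr lborel borel cart) ((*) a -` box l u)"
    by (simp add: emeasure_distr distr_cart_lborel)
  also have "\<dots> = emeasure lborel S"
  proof (subst emeasure_distr)
    show "(*) a -` box l u \<in> sets borel"
      using measurable_sets[of "(*) a" borel borel "box l u"] by simp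
  qed (simp_all add: S_def)
  also have "\<dots> = measure lebesgue S" using S \<open>open S\<close> by (intro em) auto
  also have "\<dots> = measure lebesgue (cart -` box l u)"
    using measure_orthogonal_image[OF \<rho> S] by (simp add: img)
  also have "\<dots> = emeasure lborel (cart -` box l u)"
  proof (rule em[symmetric, OF T])
    show "cart -` box l u \<in> sets borel"
      using measurable_sets[OF borel_measurable_cart, of "box l u"] by simp
  qed
  also have "\<dots> = emeasure (distr lborel borel cart) (box l u)"
    by (simp add: emeasure_distr)
  also have "\<dots> = (\<Prod>b\<in>Basis. (u - l) \<bullet> b)"
    using le by (simp add: distr_cart_lborel)
  finally show "emeasure (distr lborel borel ((*) a)) (box l u) = (\<Prod>b\<in>Basis. (u - l) \<bullet> b)" .
qed simp

text \<open>
  Rotation by \<open>pi / k\<close> preserves the disk and area but changes the sign of \<open>z ^ k\<close>.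
\<close>

lemma integral_ball_power:
  assumes "0 < k" shows "(LINT z:ball (0::complex) r|lborel. z ^ k) = 0"
proof -
  let ?f = "\<lambda>z::complex. indicator (ball 0 r) z *\<^sub>R z ^ k"
  define a where "a = cis (pi / real k)"
  have ak: "a ^ k = -1" using assms by (simp add: a_def Complex.DeMoivre)
  have na: "cmod a = 1" by (simp add: a_def)
  have "integral\<^sup>L lborel ?f = integral\<^sup>L (distr lborel borel ((*) a)) ?f"
    by (simp add: distr_rotation_lborel[OF na])
  also have "\<dots> = integral\<^sup>L lborel (\<lambda>z. ?f (a * z))"
    by (intro integral_distr borel_measurable_scaleR borel_measurable_indicator borel_measurable_power) auto
  also have "\<dots> = integral\<^sup>L lborel (\<lambda>z. - ?f z)"
    using na ak by (intro Bochner_Integration.integral_cong)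
      (auto simp: power_mult_distrib norm_mult split: split_indicator)
  also have "\<dots> = - integral\<^sup>L lborel ?f" by simp
  finally show ?thesis by (simp add: set_lebesgue_integral_def)
qed

lemma measure_disk: "0 \<le> r \<Longrightarrow> emeasure lborel (ball (p::complex) r) = ennreal (pi * r\<^sup>2)"
  by (simp add: emeasure_ball unit_ball_vol_2)

text \<open>
  Integrate the power series termwise; all terms but the constant one vanish by rotation invariance.
\<close>

theorem area_mean_value:
  assumes holf: "f holomorphic_on ball 0 R" and r: "0 < r" "r < R"
  shows "(LINT z:ball 0 r|lborel. f z) = complex_of_real (pi * r\<^sup>2) * f 0"
proof -
  define a where "a = (\<lambda>n. (deriv ^^ n) f 0 / fact n)"
  let ?I = "\<lambda>z::complex. indicator (ball 0 r) z :: real"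
  define F where "F = (\<lambda>n z. ?I z *\<^sub>R (a n * z ^ n))"
  have series: "(\<lambda>n. a n * z ^ n) sums f z" if "z \<in> ball 0 R" for z
    using holomorphic_power_series[OF holf that] by (simp add: a_def)
  have summ: "summable (\<lambda>n. cmod (a n) * r ^ n)"
  proof -
    define t where "t = (r + R) / 2"
    have t: "0 < t" "r < t" "t < R" using r by (simp_all add: t_def)
    then have "summable (\<lambda>n. a n * of_real t ^ n)"
      using series[of "of_real t"] by (auto simp: sums_iff)
    then have "summable (\<lambda>n. norm (a n * of_real r ^ n))"
      by (rule powser_insidea) (use r t in simp)
    then show ?thesis using r by (simp add: norm_mult norm_power)
  qed
  have intF: "integrable lborel (F n)" for n
  proof -
    have "set_integrable lborel (cball 0 r) (\<lambda>z. a n * z ^ n)"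
      unfolding set_integrable_def by (intro borel_integrable_compact continuous_intros compact_cball)
    then have "set_integrable lborel (ball 0 r) (\<lambda>z. a n * z ^ n)"
      by (rule set_integrable_subset) auto
    then show ?thesis by (simp add: set_integrable_def F_def)
  qed
  have bound: "norm (F n z) \<le> ?I z * (cmod (a n) * r ^ n)" for n z
    by (auto simp: F_def norm_mult norm_power split: split_indicator intro!: mult_left_mono power_mono)
  have Fint: "integral\<^sup>L lborel (F n) = (if n = 0 then complex_of_real (pi * r\<^sup>2) * f 0 else 0)" for n
  proof (cases "n = 0")
    case True
    have "a 0 = f 0" by (simp add: a_def)
    moreover have "measure lborel (ball 0 r :: complex set) = pi * r\<^sup>2"
      using measure_disk[of r 0] r by (simp add: measure_def)
    ultimately show ?thesis using True by (simp add: F_def scaleR_conv_of_real)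
  next
    case False
    have "integral\<^sup>L lborel (F n) = a n * (LINT z:ball 0 r|lborel. z ^ n)"
      by (simp add: F_def set_lebesgue_integral_def flip: mult_scaleR_right)
    then show ?thesis using integral_ball_power[of n r] False by simp
  qed
  have "(\<lambda>n. integral\<^sup>L lborel (F n)) sums (\<integral>z. (\<Sum>n. F n z) \<partial>lborel)"
  proof (rule sums_integral[OF intF])
    have "summable (\<lambda>n. norm (F n z))" for z
      by (rule summable_comparison_test'[where N=0 and g="\<lambda>n. ?I z * (cmod (a n) * r ^ n)"])
        (use bound in \<open>auto intro!: summable_mult summ\<close>)
    then show "AE z in lborel. summable (\<lambda>n. norm (F n z))" by simp
    show "summable (\<lambda>n. \<integral>z. norm (F n z) \<partial>lborel)"
    proof (rule summable_comparison_test'[where N=0])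
      show "summable (\<lambda>n. (cmod (a n) * r ^ n) * (\<integral>z. ?I z \<partial>lborel))"
        by (intro summable_mult2 summ)
      have I: "integrable lborel ?I" using measure_disk[of r 0] r by simp
      have "(\<integral>z. norm (F n z) \<partial>lborel) \<le> (\<integral>z. ?I z * (cmod (a n) * r ^ n) \<partial>lborel)" for n
        by (intro integral_mono integrable_norm intF integrable_mult_left I bound)
      then show "norm (\<integral>z. norm (F n z) \<partial>lborel) \<le> (cmod (a n) * r ^ n) * (\<integral>z. ?I z \<partial>lborel)"
        if "0 \<le> n" for n by (simp add: mult.commute)
    qed
  qed
  moreover have "(\<lambda>n. integral\<^sup>L lborel (F n)) sums (complex_of_real (pi * r\<^sup>2) * f 0)"
    unfolding Fint using sums_single[of 0 "\<lambda>_. complex_of_real (pi * r\<^sup>2) * f 0"] by (simp add: eq_commute)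
  moreover have "(\<integral>z. (\<Sum>n. F n z) \<partial>lborel) = (LINT z:ball 0 r|lborel. f z)"
    unfolding set_lebesgue_integral_def
  proof (rule Bochner_Integration.integral_cong)
    fix z :: complex
    show "(\<Sum>n. F n z) = ?I z *\<^sub>R f z"
      using series[of z] r by (auto simp: F_def sums_iff split: split_indicator)
  qed simp
  ultimately show ?thesis using sums_unique2 by metis
qed

text \<open>
  The form that combines with a weight: a lower bound for an extended nonnegative integral, against the
  completed measure with respect to which weights are measurable.
\<close>

corollary area_submean:
  assumes holf: "f holomorphic_on ball p R" and r: "0 < r" "r < R"
  shows "ennreal (pi * r\<^sup>2 * cmod (f p)) \<le> (\<integral>\<^sup>+z\<in>ball p r. ennreal (cmod (f z)) \<partial>lebesgue)"
proof -
  define g where "g = (\<lambda>z. f (p + z))"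
  have "g holomorphic_on ball 0 R"
    unfolding g_def by (rule holomorphic_on_compose_gen[OF _ holf, unfolded o_def])
      (auto simp: dist_norm intro!: holomorphic_intros)
  then have eq: "(LINT z:ball 0 r|lborel. g z) = complex_of_real (pi * r\<^sup>2) * f p"
    using area_mean_value[of g R r] r by (simp add: g_def)
  have contf: "continuous_on (ball p r) f"
    using holomorphic_on_imp_continuous_on[OF holf] by (rule continuous_on_subset) (use r in auto)
  have meas: "(\<lambda>z. indicator (ball p r) z *\<^sub>R f z) \<in> borel_measurable borel"
    using borel_measurable_continuous_on_indicator[OF _ contf] by simp
  have meas': "(\<lambda>z. ennreal (norm (indicator (ball p r) z *\<^sub>R f z))) \<in> borel_measurable borel"
    by (rule measurable_compose[OF measurable_compose[OF meas borel_measurable_norm] measurable_ennreal])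
  have "ennreal (pi * r\<^sup>2 * cmod (f p)) = ennreal (cmod (LINT z:ball 0 r|lborel. g z))"
    unfolding eq using r by (simp add: norm_mult norm_power)
  also have "\<dots> \<le> (\<integral>\<^sup>+z. norm (indicator (ball 0 r) z *\<^sub>R g z) \<partial>lborel)"
    unfolding set_lebesgue_integral_def
    using integral_norm_bound_ennreal[of lborel "\<lambda>z. indicator (ball 0 r) z *\<^sub>R g z"]
    by (cases "integrable lborel (\<lambda>z. indicator (ball 0 r) z *\<^sub>R g z)")
      (auto simp: not_integrable_integral_eq)
  also have "\<dots> = (\<integral>\<^sup>+z. norm (indicator (ball p r) (p + z) *\<^sub>R f (p + z)) \<partial>lborel)"
    by (intro nn_integral_cong) (auto simp: g_def dist_norm split: split_indicator)
  also have "\<dots> = (\<integral>\<^sup>+z. norm (indicator (ball p r) z *\<^sub>R f z) \<partial>distr lborel borel ((+) p))"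
  proof (rule nn_integral_distr[symmetric])
    show "(+) p \<in> lborel \<rightarrow>\<^sub>M borel" by simp
  qed (simp only: measurable_distr_eq1 meas')
  also have "\<dots> = (\<integral>\<^sup>+z\<in>ball p r. ennreal (cmod (f z)) \<partial>lebesgue)"
    unfolding lborel_distr_plus nn_integral_completion
    by (intro nn_integral_cong) (auto split: split_indicator)
  finally show ?thesis .
qed

section \<open>Weighted Bergman spaces are Hilbert spaces\<close>

lemma open_unit_disk: "open unit_disk"
  by (simp add: unit_disk_def)

lemma sets_unit_disk: "unit_disk \<in> sets lebesgue"
  by (simp add: unit_disk_def)

lemma space_disk_area: "space disk_area = unit_disk"
  by (simp add: disk_area_def)

lemma measurable_disk_area: "f \<in> borel_measurable disk_area \<longleftrightarrow> f \<in> borel_measurable (lebesgue_on unit_disk)"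
  by (simp add: disk_area_def)

lemma nn_integral_disk_area:
  assumes "f \<in> borel_measurable (lebesgue_on unit_disk)"
  shows "(\<integral>\<^sup>+z. f z \<partial>disk_area) = ennreal (1 / pi) * (\<integral>\<^sup>+z\<in>unit_disk. f z \<partial>lebesgue)"
  using assms sets_unit_disk
  by (simp add: disk_area_def nn_integral_density nn_integral_cmult nn_integral_restrict_space)

lemma bergman_measurable:
  "f holomorphic_on unit_disk \<Longrightarrow> f \<in> borel_measurable (lebesgue_on unit_disk)"
  by (intro continuous_imp_measurable_on_sets_lebesgue holomorphic_on_imp_continuous_on sets_unit_disk)

lemma weight_nonneg: "is_weight w \<Longrightarrow> AE z in disk_area. 0 \<le> w z"
  by (rule AE_I2) (auto simp: is_weight_def space_disk_area less_imp_le)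

text \<open>
  The factor \<open>pi\<close> converts normalised area to Lebesgue measure.
\<close>

lemma bergman_energy:
  assumes w: "is_weight w" and f: "f \<in> bergman_space w"
  shows "(\<integral>\<^sup>+z\<in>unit_disk. ennreal ((cmod (f z))\<^sup>2 * w z) \<partial>lebesgue) = ennreal (pi * (bergman_norm w f)\<^sup>2)"
    (is "?X = _")
proof -
  have int: "integrable disk_area (\<lambda>z. (cmod (f z))\<^sup>2 * w z)" using f by (simp add: bergman_space_def)
  have nonneg: "AE z in disk_area. 0 \<le> (cmod (f z))\<^sup>2 * w z" using weight_nonneg[OF w] by eventually_elim simp
  have "(\<lambda>z. ennreal ((cmod (f z))\<^sup>2 * w z)) \<in> borel_measurable (lebesgue_on unit_disk)"
    using borel_measurable_integrable[OF int] by (simp add: measurable_disk_area)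
  then have "ennreal (1 / pi) * ?X = (\<integral>\<^sup>+z. ennreal ((cmod (f z))\<^sup>2 * w z) \<partial>disk_area)"
    by (rule nn_integral_disk_area[symmetric])
  also have "\<dots> = ennreal ((bergman_norm w f)\<^sup>2)"
    using nn_integral_eq_integral[OF int nonneg] integral_nonneg_AE[OF nonneg] by (simp add: bergman_norm_def)
  finally have "ennreal pi * (ennreal (1 / pi) * ?X) = ennreal pi * ennreal ((bergman_norm w f)\<^sup>2)"
    by simp
  moreover have "ennreal pi * (ennreal (1 / pi) * ?X) = ?X"
    by (simp flip: mult.assoc ennreal_mult)
  ultimately show ?thesis by (simp add: ennreal_mult)
qed

text \<open>
  Cauchy-Schwarz for \<open>\<bar>f\<bar> = (\<bar>f\<bar> sqrt w) (1 / sqrt w)\<close> over the disk, in the pointwise form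
  \<open>\<bar>f\<bar> \<le> t / 2 * \<bar>f\<bar>\<^sup>2 w + 1 / (2 t w)\<close> with the constant \<open>t\<close> chosen afterwards, so that no product of
  integrals appears.
\<close>

lemma evaluation_bound:
  assumes w: "is_weight w" and sub: "ball p R \<subseteq> unit_disk" and r: "0 < r" "r < R"
    and I: "(\<integral>\<^sup>+z\<in>ball p r. ennreal (1 / w z) \<partial>lebesgue) \<le> ennreal I" and I0: "0 \<le> I"
    and f: "f \<in> bergman_space w"
  shows "cmod (f p) \<le> (pi + I) / (2 * pi * r\<^sup>2) * bergman_norm w f"
proof -
  let ?N = "lebesgue_on (ball p r)"
  define b where "b = bergman_norm w f"
  have b0: "0 \<le> b" unfolding b_def bergman_norm_def
    using weight_nonneg[OF w] by (intro real_sqrt_ge_zero integral_nonneg_AE) (auto elim: eventually_mono)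
  have holf: "f holomorphic_on unit_disk" using f by (simp add: bergman_space_def)
  have ball: "ball p r \<subseteq> unit_disk" using sub r by (meson order_trans subset_ball less_imp_le)
  have w_pos: "0 < w z" if "z \<in> ball p r" for z using w ball that by (auto simp: is_weight_def)
  have [measurable]: "f \<in> borel_measurable ?N"
    by (rule measurable_restrict_mono[OF bergman_measurable[OF holf] ball])
  have "w \<in> borel_measurable (lebesgue_on unit_disk)" using w by (simp add: is_weight_def)
  from measurable_restrict_mono[OF this ball] have [measurable]: "w \<in> borel_measurable ?N" .
  have restr: "(\<integral>\<^sup>+z\<in>ball p r. g z \<partial>lebesgue) = (\<integral>\<^sup>+z. g z \<partial>?N)" for g :: "complex \<Rightarrow> ennreal"
    by (subst nn_integral_restrict_space) auto
  have est: "pi * r\<^sup>2 * cmod (f p) \<le> (pi + I) / 2 * (b + e)" if e: "0 < e" for e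
  proof -
    \<comment> \<open>With \<open>1 / b\<close> both terms of the bound become multiples of \<open>b\<close>; \<open>e\<close> covers the case \<open>b = 0\<close>.\<close>
    define t where "t = 1 / (b + e)"
    have t: "0 < t" using b0 e by (simp add: t_def)
    have amgm: "cmod (f z) \<le> t / 2 * ((cmod (f z))\<^sup>2 * w z) + 1 / (2 * t) * (1 / w z)" if z: "z \<in> ball p r" for z
    proof -
      have "0 \<le> (t * w z * cmod (f z) - 1)\<^sup>2 / (2 * t * w z)" using t w_pos[OF z] by simp
      also have "\<dots> = t / 2 * ((cmod (f z))\<^sup>2 * w z) + 1 / (2 * t) * (1 / w z) - cmod (f z)"
        using t w_pos[OF z] by (simp add: field_simps power2_eq_square)
      finally show ?thesis by simp
    qed
    have "ennreal (pi * r\<^sup>2 * cmod (f p)) \<le> (\<integral>\<^sup>+z. ennreal (cmod (f z)) \<partial>?N)"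
      using area_submean[OF holomorphic_on_subset[OF holf sub] r] by (simp add: restr)
    also have "\<dots> \<le> (\<integral>\<^sup>+z. ennreal (t / 2) * ennreal ((cmod (f z))\<^sup>2 * w z) + ennreal (1 / (2 * t)) * ennreal (1 / w z) \<partial>?N)"
    proof (rule nn_integral_mono)
      fix z assume "z \<in> space ?N"
      then have z: "z \<in> ball p r" by simp
      have "ennreal (t / 2) * ennreal ((cmod (f z))\<^sup>2 * w z) + ennreal (1 / (2 * t)) * ennreal (1 / w z)
          = ennreal (t / 2 * ((cmod (f z))\<^sup>2 * w z) + 1 / (2 * t) * (1 / w z))"
        using t w_pos[OF z] by (simp flip: ennreal_mult ennreal_plus)
      then show "ennreal (cmod (f z)) \<le> ennreal (t / 2) * ennreal ((cmod (f z))\<^sup>2 * w z) + ennreal (1 / (2 * t)) * ennreal (1 / w z)"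
        using amgm[OF z] by (simp only: ennreal_leI)
    qed
    also have "\<dots> = ennreal (t / 2) * (\<integral>\<^sup>+z. ennreal ((cmod (f z))\<^sup>2 * w z) \<partial>?N)
        + ennreal (1 / (2 * t)) * (\<integral>\<^sup>+z. ennreal (1 / w z) \<partial>?N)"
      by (simp add: nn_integral_add nn_integral_cmult)
    also have "\<dots> \<le> ennreal (t / 2) * ennreal (pi * b\<^sup>2) + ennreal (1 / (2 * t)) * ennreal I"
    proof (intro add_mono mult_left_mono)
      have "(\<integral>\<^sup>+z. ennreal ((cmod (f z))\<^sup>2 * w z) \<partial>?N)
          \<le> (\<integral>\<^sup>+z\<in>unit_disk. ennreal ((cmod (f z))\<^sup>2 * w z) \<partial>lebesgue)"
        unfolding restr[symmetric] using ball by (intro nn_set_integral_set_mono)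
      then show "(\<integral>\<^sup>+z. ennreal ((cmod (f z))\<^sup>2 * w z) \<partial>?N) \<le> ennreal (pi * b\<^sup>2)"
        using bergman_energy[OF w f] by (simp add: b_def)
      show "(\<integral>\<^sup>+z. ennreal (1 / w z) \<partial>?N) \<le> ennreal I" using I by (simp add: restr)
    qed auto
    also have "\<dots> = ennreal (t / 2 * (pi * b\<^sup>2) + 1 / (2 * t) * I)"
      using t I0 by (simp flip: ennreal_mult ennreal_plus)
    finally have "pi * r\<^sup>2 * cmod (f p) \<le> t / 2 * (pi * b\<^sup>2) + 1 / (2 * t) * I"
      using t I0 by (subst (asm) ennreal_le_iff) auto
    also have "t * b\<^sup>2 \<le> b + e"
    proof -
      have "b\<^sup>2 \<le> (b + e)\<^sup>2" using b0 e by (intro power_mono) auto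
      then show ?thesis using b0 e by (simp add: t_def field_simps power2_eq_square)
    qed
    then have "t / 2 * (pi * b\<^sup>2) + 1 / (2 * t) * I \<le> pi / 2 * (b + e) + (b + e) / 2 * I"
      using mult_left_mono[of "t * b\<^sup>2" "b + e" "pi / 2"] by (simp add: t_def algebra_simps)
    also have "pi / 2 * (b + e) + (b + e) / 2 * I = (pi + I) / 2 * (b + e)"
      by (simp add: algebra_simps add_divide_distrib)
    finally show ?thesis .
  qed
  have "pi * r\<^sup>2 * cmod (f p) \<le> (pi + I) / 2 * b"
  proof (rule field_le_epsilon)
    fix e :: real assume e: "0 < e"
    have K: "0 < (pi + I) / 2" using I0 by (simp add: add_pos_nonneg)
    then have "(pi + I) / 2 * (b + e / ((pi + I) / 2)) = (pi + I) / 2 * b + e"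
      by (simp add: distrib_left)
    then show "pi * r\<^sup>2 * cmod (f p) \<le> (pi + I) / 2 * b + e"
      using est[OF divide_pos_pos[OF e K]] by (simp only:)
  qed
  then show ?thesis using r by (simp add: b_def field_simps)
qed

text \<open>
  The origin is excluded because it lies in no Carleson square, so that the Bekolle condition says nothing
  directly about a neighbourhood of it.
\<close>

definition inverse_locally_integrable :: "(complex \<Rightarrow> real) \<Rightarrow> bool" where
  "inverse_locally_integrable w \<longleftrightarrow> (\<forall>p\<in>unit_disk - {0}. \<exists>r>0. ball p r \<subseteq> unit_disk \<and>
     (\<integral>\<^sup>+z\<in>ball p r. ennreal (1 / w z) \<partial>lebesgue) < \<infinity>)"

text \<open>
  A disk of half the radius around any point of the smaller ball stays inside the given neighbourhood, which
  makes the bound uniform over the smaller ball.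
\<close>

lemma evaluation_bound_near:
  assumes w: "is_weight w" "inverse_locally_integrable w" and p: "p \<in> unit_disk" "p \<noteq> 0"
  obtains r C where "0 < r"
    "\<And>q f. q \<in> ball p r \<Longrightarrow> f \<in> bergman_space w \<Longrightarrow> cmod (f q) \<le> C * bergman_norm w f"
proof -
  obtain r where r: "0 < r" "ball p r \<subseteq> unit_disk" "(\<integral>\<^sup>+z\<in>ball p r. ennreal (1 / w z) \<partial>lebesgue) < \<infinity>"
    using w(2) p by (auto simp: inverse_locally_integrable_def)
  define I where "I = enn2real (\<integral>\<^sup>+z\<in>ball p r. ennreal (1 / w z) \<partial>lebesgue)"
  show ?thesis
  proof (rule that)
    fix q f assume q: "q \<in> ball p (r / 2)" and f: "f \<in> bergman_space w"
    have "ball q (r / 2) \<subseteq> ball p r"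
    proof
      fix z assume "z \<in> ball q (r / 2)"
      then show "z \<in> ball p r" using q dist_triangle[of p z q] by simp
    qed
    moreover have "ball q (r / 4) \<subseteq> ball q (r / 2)" using r by (intro subset_ball) simp
    ultimately have balls: "ball q (r / 4) \<subseteq> ball p r" "ball q (r / 2) \<subseteq> unit_disk"
      using r(2) by blast+
    show "cmod (f q) \<le> (pi + I) / (2 * pi * (r / 4)\<^sup>2) * bergman_norm w f"
    proof (rule evaluation_bound[OF w(1) balls(2) _ _ _ _ f])
      have "(\<integral>\<^sup>+z\<in>ball q (r / 4). ennreal (1 / w z) \<partial>lebesgue) \<le> (\<integral>\<^sup>+z\<in>ball p r. ennreal (1 / w z) \<partial>lebesgue)"
        using balls(1) by (intro nn_set_integral_set_mono)
      then show "(\<integral>\<^sup>+z\<in>ball q (r / 4). ennreal (1 / w z) \<partial>lebesgue) \<le> ennreal I"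
        using r(3) by (simp add: I_def)
    qed (use r in \<open>auto simp: I_def\<close>)
  qed (use r in simp)
qed

text \<open>
  The local bounds are uniform on the circle of radius \<open>\<rho>\<close> by compactness, and the maximum principle extends
  them to the closed disk, including the origin.
\<close>

lemma evaluation_bound_cball:
  assumes w: "is_weight w" "inverse_locally_integrable w" and \<rho>: "0 < \<rho>" "\<rho> < 1"
  obtains C where "0 \<le> C"
    "\<And>z f. z \<in> cball 0 \<rho> \<Longrightarrow> f \<in> bergman_space w \<Longrightarrow> cmod (f z) \<le> C * bergman_norm w f"
proof -
  have norm0: "0 \<le> bergman_norm w f" for f
    unfolding bergman_norm_def using weight_nonneg[OF w(1)]
    by (intro real_sqrt_ge_zero integral_nonneg_AE) (auto elim: eventually_mono)
  let ?S = "sphere (0::complex) \<rho>"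
  have "\<exists>r C. 0 < r \<and> (\<forall>q\<in>ball p r. \<forall>f\<in>bergman_space w. cmod (f q) \<le> C * bergman_norm w f)"
    if "p \<in> ?S" for p
  proof -
    have "p \<in> unit_disk" "p \<noteq> 0" using that \<rho> by (auto simp: unit_disk_def)
    from evaluation_bound_near[OF w this] show ?thesis by metis
  qed
  then obtain r C where r: "\<And>p. p \<in> ?S \<Longrightarrow> 0 < r p"
    and C: "\<And>p q f. p \<in> ?S \<Longrightarrow> q \<in> ball p (r p) \<Longrightarrow> f \<in> bergman_space w \<Longrightarrow> cmod (f q) \<le> C p * bergman_norm w f"
    by metis
  obtain F where F: "F \<subseteq> ?S" "finite F" "?S \<subseteq> (\<Union>p\<in>F. ball p (r p))"
    by (rule compactE_image[OF compact_sphere[of 0 \<rho>], of ?S "\<lambda>p. ball p (r p)"]) (use r in auto)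
  define K where "K = (\<Sum>p\<in>F. \<bar>C p\<bar>)"
  have bound: "cmod (f z) \<le> K * bergman_norm w f" if z: "z \<in> ?S" and f: "f \<in> bergman_space w" for z f
  proof -
    obtain p where p: "p \<in> F" "z \<in> ball p (r p)" using F(3) z by blast
    have "C p \<le> K" unfolding K_def
      using member_le_sum[of p F "\<lambda>p. \<bar>C p\<bar>"] p F(2) by auto
    then have "C p * bergman_norm w f \<le> K * bergman_norm w f" using norm0 by (rule mult_right_mono)
    then show ?thesis using C[of p z f] p F(1) f by force
  qed
  show ?thesis
  proof (rule that)
    show "0 \<le> K" by (simp add: K_def sum_nonneg)
    fix z f assume z: "z \<in> cball (0::complex) \<rho>" and f: "f \<in> bergman_space w"
    have holf: "f holomorphic_on unit_disk" using f by (simp add: bergman_space_def)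
    have sub: "cball 0 \<rho> \<subseteq> unit_disk" using \<rho> by (auto simp: unit_disk_def)
    show "cmod (f z) \<le> K * bergman_norm w f"
    proof (rule maximum_modulus_frontier[OF _ _ bounded_cball _ z])
      show "f holomorphic_on interior (cball 0 \<rho>)"
        using sub by (intro holomorphic_on_subset[OF holf]) auto
      show "continuous_on (closure (cball 0 \<rho>)) f"
        using sub by (intro continuous_on_subset[OF holomorphic_on_imp_continuous_on[OF holf]]) auto
      show "cmod (f y) \<le> K * bergman_norm w f" if "y \<in> frontier (cball 0 \<rho>)" for y
        using bound[OF _ f, of y] that by simp
    qed
  qed
qed

text \<open>
  The weighted inner product agrees with integration against the measure with density \<open>w\<close> for measurable
  functions, hence on the carrier but not for arbitrary arguments.
\<close>

lemma function_hilbert_space_cong: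
  assumes "function_hilbert_space H ip" and eq: "\<And>f g. f \<in> H \<Longrightarrow> g \<in> H \<Longrightarrow> ip' f g = ip f g"
  shows "function_hilbert_space H ip'"
proof -
  interpret function_hilbert_space H ip by fact
  show ?thesis
  proof
    fix F :: "nat \<Rightarrow> _"
    assume F: "\<And>n. F n \<in> H" and
      "\<And>e. 0 < e \<Longrightarrow> \<exists>N. \<forall>m\<ge>N. \<forall>n\<ge>N. sqrt (Re (ip' (\<lambda>x. F m x - F n x) (\<lambda>x. F m x - F n x))) < e"
    then have "\<And>e. 0 < e \<Longrightarrow> \<exists>N. \<forall>m\<ge>N. \<forall>n\<ge>N. nrm (\<lambda>x. F m x - F n x) < e"
      by (simp add: eq diff_mem nrm_def)
    then obtain f where "f \<in> H" "(\<lambda>n. nrm (\<lambda>x. F n x - f x)) \<longlonglongrightarrow> 0"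
      using complete[of F] F by blast
    then show "\<exists>f\<in>H. (\<lambda>n. sqrt (Re (ip' (\<lambda>x. F n x - f x) (\<lambda>x. F n x - f x)))) \<longlonglongrightarrow> 0"
      using F by (intro bexI[of _ f]) (simp_all add: eq diff_mem nrm_def)
  next
    fix x show "\<exists>C. \<forall>f\<in>H. cmod (f x) \<le> C * sqrt (Re (ip' f f))"
      using evaluation_bounded[of x] by (simp add: eq)
  qed (auto simp: eq mem ip_simps ip_self_nonneg intro: ip_commute)
qed

lemma bergman_norm_eq: "bergman_norm w f = sqrt (Re (bergman_inner w f f))"
proof -
  have "bergman_inner w f f = (LINT z|disk_area. complex_of_real ((cmod (f z))\<^sup>2 * w z))"
    unfolding bergman_inner_def of_real_mult complex_norm_square ..
  then show ?thesis by (simp add: bergman_norm_def del: of_real_mult)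
qed

text \<open>
  The space consists of the square-integrable functions for the measure with density \<open>w\<close> that are holomorphic in
  the disk. The locally uniform evaluation bound makes norm-Cauchy sequences locally uniformly Cauchy,
  so their pointwise limits are holomorphic.
\<close>

theorem bergman_hilbert_space:
  assumes w: "is_weight w" "inverse_locally_integrable w"
  shows "function_hilbert_space (bergman_space w) (bergman_inner w)"
proof -
  define P where "P = (\<lambda>f. f holomorphic_on unit_disk \<and> (\<forall>z. z \<notin> unit_disk \<longrightarrow> f z = (0::complex)))"
  define M where "M = density disk_area (\<lambda>z. ennreal (w z))"
  have w_meas: "w \<in> borel_measurable disk_area"
    using w(1) by (simp add: is_weight_def measurable_disk_area)
  have P_meas: "f \<in> borel_measurable disk_area" if "P f" for f
    using bergman_measurable[of f] that by (simp add: P_def measurable_disk_area)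
  have sq: "(\<lambda>z. (cmod (f z))\<^sup>2) \<in> borel_measurable disk_area" if "P f" for f
    using P_meas[OF that] by measurable
  have V: "{f. P f \<and> integrable M (\<lambda>z. (cmod (f z))\<^sup>2)} = bergman_space w"
  proof -
    have "integrable M (\<lambda>z. (cmod (f z))\<^sup>2) \<longleftrightarrow> integrable disk_area (\<lambda>z. (cmod (f z))\<^sup>2 * w z)" if "P f" for f
      using integrable_density[OF sq[OF that] w_meas weight_nonneg[OF w(1)]]
      by (simp add: M_def mult.commute)
    then show ?thesis by (auto simp: bergman_space_def P_def)
  qed
  have VP: "P f" if "f \<in> bergman_space w" for f using that by (simp add: bergman_space_def P_def)
  have norm: "sqrt (LINT z|M. (cmod (f z))\<^sup>2) = bergman_norm w f" if "P f" for f
    using integral_density[OF sq[OF that] w_meas weight_nonneg[OF w(1)]]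
    by (simp add: M_def bergman_norm_def mult.commute)
  have "function_hilbert_space {f. P f \<and> integrable M (\<lambda>z. (cmod (f z))\<^sup>2)} (\<lambda>f g. LINT z|M. f z * cnj (g z))"
  proof (rule function_hilbert_space_L2I, unfold V)
    show "f \<in> borel_measurable M" if "P f" for f using P_meas[OF that] by (simp add: M_def)
    show "P (\<lambda>z. 0)" by (simp add: P_def)
    show "P (\<lambda>z. f z + g z)" if "P f" "P g" for f g using that by (auto simp: P_def intro: holomorphic_intros)
    show "P (\<lambda>z. c * f z)" if "P f" for f c using that by (auto simp: P_def intro: holomorphic_intros)
  next
    fix z
    show "\<exists>C. \<forall>f\<in>bergman_space w. cmod (f z) \<le> C * sqrt (LINT z|M. (cmod (f z))\<^sup>2)"
    proof (cases "z \<in> unit_disk")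
      case True
      then have "0 < (1 + cmod z) / 2" "(1 + cmod z) / 2 < 1" "z \<in> cball 0 ((1 + cmod z) / 2)"
        by (auto simp: unit_disk_def add_pos_nonneg)
      then obtain C where "\<And>f. f \<in> bergman_space w \<Longrightarrow> cmod (f z) \<le> C * bergman_norm w f"
        using evaluation_bound_cball[OF w, of "(1 + cmod z) / 2"] by metis
      then show ?thesis using norm VP by (intro exI[of _ C]) simp
    next
      case False
      then show ?thesis by (intro exI[of _ 0]) (auto simp: bergman_space_def)
    qed
  next
    fix F :: "nat \<Rightarrow> complex \<Rightarrow> complex" and f
    assume F: "\<And>n. F n \<in> bergman_space w" and lim: "\<And>z. (\<lambda>n. F n z) \<longlonglongrightarrow> f z"
      and diff: "\<And>m n. (\<lambda>z. F m z - F n z) \<in> bergman_space w"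
      and Cau: "\<And>e. 0 < e \<Longrightarrow> \<exists>N. \<forall>m\<ge>N. \<forall>n\<ge>N. sqrt (LINT z|M. (cmod (F m z - F n z))\<^sup>2) < e"
    have "f z = 0" if "z \<notin> unit_disk" for z
      using lim[of z] F that by (simp add: bergman_space_def LIMSEQ_const_iff)
    moreover have "f holomorphic_on unit_disk"
    proof (rule holomorphic_uniform_sequence[OF open_unit_disk])
      show "F n holomorphic_on unit_disk" for n using F by (simp add: bergman_space_def)
      fix x assume x: "x \<in> unit_disk"
      define \<rho> where "\<rho> = (1 + cmod x) / 2"
      have \<rho>: "0 < \<rho>" "\<rho> < 1" "cmod x < \<rho>" using x by (auto simp: \<rho>_def unit_disk_def add_pos_nonneg)
      have sub: "cball x (\<rho> - cmod x) \<subseteq> cball 0 \<rho>"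
      proof
        fix y assume "y \<in> cball x (\<rho> - cmod x)"
        then show "y \<in> cball 0 \<rho>"
          using norm_triangle_sub[of y x] by (simp add: dist_norm norm_minus_commute)
      qed
      obtain C where C: "0 \<le> C" "\<And>z g. z \<in> cball 0 \<rho> \<Longrightarrow> g \<in> bergman_space w \<Longrightarrow> cmod (g z) \<le> C * bergman_norm w g"
        by (rule evaluation_bound_cball[OF w \<rho>(1,2)]) blast
      have "uniform_limit (cball x (\<rho> - cmod x)) F f sequentially"
      proof (rule uniform_limitI)
        fix e :: real assume e: "0 < e"
        then have "0 < e / (2 * (C + 1))" using C(1) by simp
        then obtain N where N: "\<And>m n. N \<le> m \<Longrightarrow> N \<le> n \<Longrightarrow>
            sqrt (LINT z|M. (cmod (F m z - F n z))\<^sup>2) < e / (2 * (C + 1))"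
          using Cau by blast
        have "dist (F n z) (f z) < e" if n: "N \<le> n" and z: "z \<in> cball x (\<rho> - cmod x)" for n z
        proof -
          have "cmod (F n z - F m z) \<le> e / 2" if m: "N \<le> m" for m
          proof -
            have "cmod (F n z - F m z) \<le> C * bergman_norm w (\<lambda>z. F n z - F m z)"
              using C(2)[OF subsetD[OF sub z] diff] .
            also have "\<dots> \<le> C * (e / (2 * (C + 1)))"
              using N[OF n m] norm[OF VP[OF diff]] C(1) by (intro mult_left_mono) (auto simp: less_imp_le)
            also have "\<dots> \<le> e / 2" using C(1) e by (simp add: field_simps)
            finally show ?thesis .
          qed
          moreover have "(\<lambda>m. cmod (F n z - F m z)) \<longlonglongrightarrow> cmod (F n z - f z)"
            by (intro tendsto_intros lim)
          ultimately have "cmod (F n z - f z) \<le> e / 2" by (intro LIMSEQ_le_const2) auto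
          then show ?thesis using e by (simp add: dist_norm)
        qed
        then show "\<forall>\<^sub>F n in sequentially. \<forall>z\<in>cball x (\<rho> - cmod x). dist (F n z) (f z) < e"
          unfolding eventually_sequentially by blast
      qed
      moreover have "cball x (\<rho> - cmod x) \<subseteq> unit_disk" using sub \<rho> by (force simp: unit_disk_def)
      ultimately show "\<exists>d>0. cball x d \<subseteq> unit_disk \<and> uniform_limit (cball x d) F f sequentially"
        using \<rho>(3) by (intro exI[of _ "\<rho> - cmod x"]) simp
    qed
    ultimately show "P f" by (simp add: P_def)
  qed
  then have "function_hilbert_space (bergman_space w) (\<lambda>f g. LINT z|M. f z * cnj (g z))" by (simp only: V)
  then show ?thesis
  proof (rule function_hilbert_space_cong)
    fix f g assume fg: "f \<in> bergman_space w" "g \<in> bergman_space w"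
    have "(\<lambda>z. cnj (g z)) \<in> borel_measurable disk_area"
      by (rule measurable_compose[OF P_meas[OF VP[OF fg(2)]] borel_measurable_continuous_onI]) (intro continuous_intros)
    then have "(\<lambda>z. f z * cnj (g z)) \<in> borel_measurable disk_area"
      using P_meas[OF VP[OF fg(1)]] by measurable
    from integral_density[OF this w_meas weight_nonneg[OF w(1)]]
    show "bergman_inner w f g = (LINT z|M. f z * cnj (g z))"
      by (simp add: M_def bergman_inner_def scaleR_conv_of_real mult_ac)
  qed
qed

section \<open>Bekolle weights are locally invertible\<close>

text \<open>
  A negative power of \<open>u\<close> is dominated by the single term of the sum for the dyadic interval that contains \<open>u\<close>.
\<close>

lemma powr_le_dyadic_suminf:
  assumes s: "0 < s" and u: "0 < u" "u \<le> 1"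
  shows "ennreal (u powr (- s)) \<le>
    (\<Sum>k. ennreal (2 powr (real (Suc k) * s)) * indicator {..(1/2) ^ k} u)"
proof -
  define k where "k = (LEAST k. (1/2) ^ Suc k < u)"
  obtain n where "(1/2) ^ n < u" using real_arch_pow_inv[OF u(1), of "1/2"] by auto
  moreover have "(1/2::real) ^ Suc n \<le> (1/2) ^ n" by simp
  ultimately have "(1/2) ^ Suc n < u" by linarith
  then have k: "(1/2) ^ Suc k < u" unfolding k_def by (rule LeastI)
  have k': "u \<le> (1/2) ^ k"
  proof (cases k)
    case (Suc j)
    then have "\<not> (1/2) ^ Suc j < u" using not_less_Least[of j "\<lambda>k. (1/2) ^ Suc k < u"] by (simp add: k_def)
    then show ?thesis using Suc by simp
  qed (use u in simp)
  have "u powr (- s) \<le> ((1/2) ^ Suc k) powr (- s)"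
    using k s by (intro powr_mono2') auto
  also have "\<dots> = 2 powr (real (Suc k) * s)"
  proof -
    have "(1/2::real) ^ Suc k = 2 powr (- real (Suc k))"
      by (subst powr_minus, subst powr_realpow) (auto simp: power_divide inverse_eq_divide)
    then show ?thesis by (simp add: powr_powr del: power_Suc) (simp add: algebra_simps)
  qed
  finally have "ennreal (u powr (- s)) \<le> (\<Sum>k\<in>{k}. ennreal (2 powr (real (Suc k) * s)) * indicator {..(1/2) ^ k} u)"
    using k' by (simp add: ennreal_leI)
  also have "\<dots> \<le> (\<Sum>k. ennreal (2 powr (real (Suc k) * s)) * indicator {..(1/2) ^ k} u)"
    by (intro sum_le_suminf) auto
  finally show ?thesis .
qed

text \<open>
  The exponent \<open>\<eta> > -1\<close> is compared with some \<open>-s\<close>, where \<open>0 < s < 1\<close>. The annulus at distance at most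
  \<open>(1/2) ^ k\<close> from the boundary has area at most a constant times \<open>(1/2) ^ k\<close>, so the dyadic decomposition
  is dominated by a geometric series with ratio \<open>2 powr s / 2\<close>.
\<close>

lemma nn_integral_boundary_power_finite:
  assumes \<eta>: "-1 < \<eta>"
  shows "(\<integral>\<^sup>+z\<in>unit_disk. ennreal ((1 - (cmod z)\<^sup>2) powr \<eta>) \<partial>lebesgue) < \<infinity>"
proof -
  define s where "s = max (- \<eta>) (1/2)"
  have s: "0 < s" "s < 1" "- s \<le> \<eta>" using \<eta> by (auto simp: s_def)
  define A where "A = (\<lambda>k. ball 0 1 - ball (0::complex) (1 - (1/2) ^ k))"
  have A_sets: "A k \<in> sets lborel" for k by (simp add: A_def)
  have emA: "emeasure lborel (A k) \<le> ennreal (2 * pi * (1/2) ^ k)" for k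
  proof -
    let ?q = "(1/2::real) ^ k"
    have q: "0 < ?q" "?q \<le> 1" by (auto simp: power_le_one)
    have "emeasure lborel (A k) = emeasure lborel (ball (0::complex) 1) - emeasure lborel (ball (0::complex) (1 - ?q))"
    proof -
      have "ball 0 (1 - ?q) \<subseteq> ball (0::complex) 1" using q by (intro subset_ball) simp
      then show ?thesis
        unfolding A_def using q measure_disk[of "1 - ?q" 0] by (intro emeasure_Diff) simp_all
    qed
    also have "\<dots> = ennreal (pi - pi * (1 - ?q)\<^sup>2)"
      using q measure_disk[of "1 - ?q" 0] measure_disk[of 1 0] by (simp add: ennreal_minus)
    also have "pi - pi * (1 - ?q)\<^sup>2 \<le> 2 * pi * ?q"
      by (simp add: power2_diff algebra_simps)
    finally show ?thesis by (simp add: ennreal_leI)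
  qed
  have pointwise: "ennreal ((1 - (cmod z)\<^sup>2) powr \<eta>) \<le> (\<Sum>k. ennreal (2 powr (real (Suc k) * s)) * indicator (A k) z)"
    if z: "z \<in> unit_disk" for z
  proof -
    have c: "cmod z < 1" using z by (simp add: unit_disk_def)
    have le: "1 - cmod z \<le> 1 - (cmod z)\<^sup>2" using c by (simp add: power2_eq_square mult_left_le)
    have t: "0 < 1 - (cmod z)\<^sup>2" "1 - (cmod z)\<^sup>2 \<le> 1" using le c by auto
    have "(1 - (cmod z)\<^sup>2) powr \<eta> \<le> (1 - (cmod z)\<^sup>2) powr (- s)"
      using t s by (intro powr_mono') auto
    also have "\<dots> \<le> (1 - cmod z) powr (- s)" using le c s by (intro powr_mono2') auto
    finally have "ennreal ((1 - (cmod z)\<^sup>2) powr \<eta>) \<le> ennreal ((1 - cmod z) powr (- s))" by (rule ennreal_leI)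
    also have "\<dots> \<le> (\<Sum>k. ennreal (2 powr (real (Suc k) * s)) * indicator {..(1/2) ^ k} (1 - cmod z))"
      using c s by (intro powr_le_dyadic_suminf) auto
    also have "\<dots> = (\<Sum>k. ennreal (2 powr (real (Suc k) * s)) * indicator (A k) z)"
      using c by (intro suminf_cong) (auto simp: A_def split: split_indicator)
    finally show ?thesis .
  qed
  have "(\<integral>\<^sup>+z\<in>unit_disk. ennreal ((1 - (cmod z)\<^sup>2) powr \<eta>) \<partial>lebesgue)
      \<le> (\<integral>\<^sup>+z. (\<Sum>k. ennreal (2 powr (real (Suc k) * s)) * indicator (A k) z) \<partial>lborel)"
    unfolding nn_integral_completion
    by (intro nn_integral_mono) (use pointwise in \<open>auto split: split_indicator\<close>)
  also have "\<dots> = (\<Sum>k. \<integral>\<^sup>+z. ennreal (2 powr (real (Suc k) * s)) * indicator (A k) z \<partial>lborel)"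
    using A_sets by (intro nn_integral_suminf) auto
  also have "\<dots> = (\<Sum>k. ennreal (2 powr (real (Suc k) * s)) * emeasure lborel (A k))"
    using A_sets by (intro suminf_cong nn_integral_cmult_indicator)
  also have "\<dots> \<le> (\<Sum>k. ennreal (2 powr (real (Suc k) * s) * (2 * pi * (1/2) ^ k)))"
    using emA by (intro suminf_le) (auto simp: ennreal_mult intro: mult_left_mono)
  also have "\<dots> < \<infinity>"
  proof -
    have "2 powr (real (Suc k) * s) * (2 * pi * (1/2) ^ k) = 2 powr s * 2 * pi * (2 powr s / 2) ^ k" for k
    proof -
      have "2 powr (real (Suc k) * s) = 2 powr s * (2 powr s) ^ k"
        by (simp add: powr_add algebra_simps powr_power)
      then show ?thesis by (simp add: power_divide)
    qed
    moreover have "summable (\<lambda>k. 2 powr s * 2 * pi * (2 powr s / 2) ^ k)"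
    proof (intro summable_mult summable_geometric)
      have "2 powr s < (2::real) powr 1" using s by (intro powr_less_mono) auto
      then show "norm (2 powr s / 2 :: real) < 1" by simp
    qed
    ultimately have "summable (\<lambda>k. 2 powr (real (Suc k) * s) * (2 * pi * (1/2) ^ k))" by (simp only:)
    then have "(\<Sum>k. ennreal (2 powr (real (Suc k) * s) * (2 * pi * (1/2) ^ k))) \<noteq> top"
      by (rule ennreal_suminf_neq_top) simp
    then show ?thesis by (simp only: less_top infinity_ennreal_def)
  qed
  finally show ?thesis .
qed

lemma nn_integral_weighted_area:
  assumes g: "g \<in> borel_measurable (lebesgue_on unit_disk)" and "U \<in> sets lebesgue" "U \<subseteq> unit_disk" and \<eta>: "-1 < \<eta>"
  shows "(\<integral>\<^sup>+z\<in>U. g z \<partial>weighted_area \<eta>)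
    = (\<integral>\<^sup>+z\<in>U. ennreal ((\<eta> + 1) / pi * (1 - (cmod z)\<^sup>2) powr \<eta>) * g z \<partial>lebesgue)"
proof -
  have U: "U \<in> sets (lebesgue_on unit_disk)"
    using assms by (auto simp: sets_restrict_space_iff sets_unit_disk)
  have [measurable]: "g \<in> borel_measurable (lebesgue_on unit_disk)" by fact
  have [measurable]: "cmod \<in> borel_measurable (lebesgue_on unit_disk)"
    by (intro continuous_imp_measurable_on_sets_lebesgue sets_unit_disk continuous_intros)
  have [measurable]: "indicator U \<in> borel_measurable (lebesgue_on unit_disk)"
    using U by (rule borel_measurable_indicator)
  have "(\<integral>\<^sup>+z\<in>U. g z \<partial>weighted_area \<eta>)
      = (\<integral>\<^sup>+z. ennreal ((\<eta> + 1) * (1 - (cmod z)\<^sup>2) powr \<eta>) * (g z * indicator U z) \<partial>disk_area)"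
    unfolding weighted_area_def by (intro nn_integral_density) (simp_all add: measurable_disk_area)
  also have "\<dots> = ennreal (1 / pi) * (\<integral>\<^sup>+z\<in>unit_disk.
      ennreal ((\<eta> + 1) * (1 - (cmod z)\<^sup>2) powr \<eta>) * (g z * indicator U z) \<partial>lebesgue)"
    by (intro nn_integral_disk_area) measurable
  also have "\<dots> = (\<integral>\<^sup>+z. ennreal (1 / pi) *
      (ennreal ((\<eta> + 1) * (1 - (cmod z)\<^sup>2) powr \<eta>) * (g z * indicator U z)) \<partial>lebesgue_on unit_disk)"
    using sets_unit_disk by (subst nn_integral_cmult) (auto simp: nn_integral_restrict_space)
  also have "\<dots> = (\<integral>\<^sup>+z\<in>U. ennreal ((\<eta> + 1) / pi * (1 - (cmod z)\<^sup>2) powr \<eta>) * g z \<partial>lebesgue)"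
    using sets_unit_disk assms(3) \<eta>
    by (subst nn_integral_restrict_space)
      (auto intro!: nn_integral_cong split: split_indicator simp flip: ennreal_mult mult.assoc)
  finally show ?thesis .
qed

lemma weighted_area_finite:
  assumes \<eta>: "-1 < \<eta>" shows "emeasure (weighted_area \<eta>) S < \<infinity>"
proof -
  have sp: "space (weighted_area \<eta>) = unit_disk" by (simp add: weighted_area_def space_disk_area)
  have "emeasure (weighted_area \<eta>) S \<le> emeasure (weighted_area \<eta>) unit_disk"
    using emeasure_space[of "weighted_area \<eta>" S] by (simp add: sp)
  also have "\<dots> = (\<integral>\<^sup>+z\<in>unit_disk. 1 \<partial>weighted_area \<eta>)"
    using sets.top[of "weighted_area \<eta>"] by (simp add: sp)
  also have "\<dots> = (\<integral>\<^sup>+z\<in>unit_disk. ennreal ((\<eta> + 1) / pi * (1 - (cmod z)\<^sup>2) powr \<eta>) \<partial>lebesgue)"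
    using nn_integral_weighted_area[of "\<lambda>_. 1" unit_disk \<eta>] sets_unit_disk \<eta> by simp
  also have "\<dots> = ennreal ((\<eta> + 1) / pi) * (\<integral>\<^sup>+z\<in>unit_disk. ennreal ((1 - (cmod z)\<^sup>2) powr \<eta>) \<partial>lebesgue)"
  proof -
    have [measurable]: "cmod \<in> borel_measurable lebesgue"
      using continuous_imp_measurable_on_sets_lebesgue[of UNIV cmod] by (simp add: continuous_intros)
    have [measurable]: "unit_disk \<in> sets lebesgue" by (rule sets_unit_disk)
    have eq: "ennreal ((\<eta> + 1) / pi * (1 - (cmod z)\<^sup>2) powr \<eta>)
        = ennreal ((\<eta> + 1) / pi) * ennreal ((1 - (cmod z)\<^sup>2) powr \<eta>)" for z :: complex
      using \<eta> by (intro ennreal_mult) auto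
    show ?thesis unfolding eq mult.assoc by (intro nn_integral_cmult) measurable
  qed
  also have "\<dots> < \<infinity>"
    using nn_integral_boundary_power_finite[OF \<eta>] by (simp add: ennreal_mult_less_top)
  finally show ?thesis .
qed

lemma carleson_square_subset: "h \<le> 1 \<Longrightarrow> carleson_square \<theta> h \<subseteq> unit_disk"
  by (auto simp: carleson_square_def unit_disk_def norm_mult)

text \<open>
  Take the square centred at the argument of \<open>p\<close> that reaches down to half its modulus. A point \<open>z\<close> near \<open>p\<close>
  has angular coordinate \<open>\<theta> + Arg (z / p)\<close>, which is close to \<open>\<theta>\<close> also when \<open>p\<close> lies on a branch cut of
  the argument. The last conclusion keeps the neighbourhood away from the unit circle.
\<close>

lemma carleson_square_neighbourhood:
  assumes p: "p \<in> unit_disk" "p \<noteq> 0"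
  obtains \<theta> h r where "\<theta> \<in> {0..2 * pi}" "h \<in> {0<..<1}" "0 < r" "ball p r \<subseteq> carleson_square \<theta> h"
    "\<And>z. z \<in> ball p r \<Longrightarrow> cmod z < (1 + cmod p) / 2"
proof -
  define \<theta> where "\<theta> = Arg2pi p"
  define h where "h = 1 - cmod p / 2"
  have p1: "0 < cmod p" "cmod p < 1" using p by (auto simp: unit_disk_def)
  have pc: "p = of_real (cmod p) * cis \<theta>" using Arg2pi_eq[of p] by (simp add: \<theta>_def cis_conv_exp)
  have h: "0 < h" "h < 1" using p1 by (auto simp: h_def)
  have "isCont (\<lambda>z. Arg (z / p)) p"
  proof (rule isCont_o2[where f = "\<lambda>z. z / p" and g = Arg])
    show "isCont (\<lambda>z. z / p) p" by (intro isCont_divide continuous_ident continuous_const p(2))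
    show "isCont Arg (p / p)" using p(2) continuous_at_Arg[of 1] by simp
  qed
  then have "(\<lambda>z. \<bar>Arg (z / p)\<bar>) \<midarrow>p\<rightarrow> \<bar>Arg (p / p)\<bar>" by (intro tendsto_rabs) (simp only: isCont_def)
  then have "((\<lambda>z. \<bar>Arg (z / p)\<bar>) \<longlongrightarrow> \<bar>Arg (p / p)\<bar>) (nhds p)"
    using tendsto_at_iff_tendsto_nhds[of "\<lambda>z. \<bar>Arg (z / p)\<bar>" p] by (simp only:)
  then have "((\<lambda>z. \<bar>Arg (z / p)\<bar>) \<longlongrightarrow> 0) (nhds p)" using p(2) by simp
  then have "\<forall>\<^sub>F z in nhds p. \<bar>Arg (z / p)\<bar> < h / 2" using h by (intro order_tendstoD) auto
  moreover have cm: "((\<lambda>z. cmod z) \<longlongrightarrow> cmod p) (nhds p)" by (intro tendsto_intros filterlim_ident)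
  moreover have "\<forall>\<^sub>F z in nhds p. cmod z < (1 + cmod p) / 2" "\<forall>\<^sub>F z in nhds p. cmod p / 2 < cmod z"
    using p1 by (intro order_tendstoD[OF cm]; simp)+
  ultimately have "\<forall>\<^sub>F z in nhds p. \<bar>Arg (z / p)\<bar> < h / 2 \<and> cmod z < (1 + cmod p) / 2 \<and> cmod p / 2 < cmod z"
    by (intro eventually_conj)
  then obtain r where r: "0 < r" "\<And>z. dist z p < r \<Longrightarrow> \<bar>Arg (z / p)\<bar> < h / 2 \<and> cmod z < (1 + cmod p) / 2 \<and> cmod p / 2 < cmod z"
    unfolding eventually_nhds_metric by blast
  have "z \<in> carleson_square \<theta> h" if "z \<in> ball p r" for z
  proof -
    have z: "\<bar>Arg (z / p)\<bar> < h / 2" "cmod z < (1 + cmod p) / 2" "cmod p / 2 < cmod z"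
      using r(2)[of z] that by (auto simp: dist_commute)
    have z0: "z \<noteq> 0" using z(3) p1 by auto
    have "z / p = of_real (cmod (z / p)) * cis (Arg (z / p))"
      using rcis_cmod_Arg[of "z / p"] by (simp add: rcis_def)
    then have "z = (of_real (cmod (z / p)) * cis (Arg (z / p))) * (of_real (cmod p) * cis \<theta>)"
      using pc p(2) by (metis nonzero_divide_eq_eq)
    also have "\<dots> = of_real (cmod z) * cis (\<theta> + Arg (z / p))"
      using p(2) by (simp add: norm_divide cis_mult[symmetric])
    finally show ?thesis
      using z p1 unfolding carleson_square_def
      by (intro CollectI exI[of _ "cmod z"] exI[of _ "\<theta> + Arg (z / p)"]) (auto simp: h_def)
  qed
  then have "ball p r \<subseteq> carleson_square \<theta> h" by blast
  moreover have "\<theta> \<in> {0..2 * pi}" using Arg2pi_ge_0[of p] Arg2pi_lt_2pi[of p] by (simp add: \<theta>_def)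
  ultimately show ?thesis using that[of \<theta> h r] h r by (auto simp: dist_commute)
qed

text \<open>
  Restrict both integrals of the Bekolle condition to a neighbourhood inside a Carleson square. Their product
  stays finite because Carleson squares have finite measure, and the first integral is positive because the
  weight is, so the second one is finite. Away from the unit circle its integrand is comparable
  to \<open>1 / w\<close>.
\<close>

theorem bekolle_inverse_locally_integrable:
  assumes \<eta>: "-1 < \<eta>" and w: "is_weight w"
    and B2: "(\<lambda>z. w z / (1 - (cmod z)\<^sup>2) powr \<eta>) \<in> bekolle_B2 \<eta>"
  shows "inverse_locally_integrable w"
  unfolding inverse_locally_integrable_def
proof
  fix p assume "p \<in> unit_disk - {0}"
  then have p: "p \<in> unit_disk" "p \<noteq> 0" by auto
  define v where "v = (\<lambda>z. w z / (1 - (cmod z)\<^sup>2) powr \<eta>)"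
  obtain c where c: "0 < c" "\<And>\<theta> h. \<theta> \<in> {0..2 * pi} \<Longrightarrow> h \<in> {0<..<1} \<Longrightarrow>
      (\<integral>\<^sup>+ z \<in> carleson_square \<theta> h. ennreal (v z) \<partial>weighted_area \<eta>) *
      (\<integral>\<^sup>+ z \<in> carleson_square \<theta> h. ennreal (inverse (v z)) \<partial>weighted_area \<eta>)
      \<le> ennreal c * (emeasure (weighted_area \<eta>) (carleson_square \<theta> h))\<^sup>2"
    using B2 unfolding bekolle_B2_def v_def by blast
  have v_meas[measurable]: "v \<in> borel_measurable (lebesgue_on unit_disk)"
    using B2 by (simp add: bekolle_B2_def is_weight_def v_def)
  obtain \<theta> h r where S: "\<theta> \<in> {0..2 * pi}" "h \<in> {0<..<1}" and r: "0 < r" "ball p r \<subseteq> carleson_square \<theta> h"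
    and near: "\<And>z. z \<in> ball p r \<Longrightarrow> cmod z < (1 + cmod p) / 2"
    by (rule carleson_square_neighbourhood[OF p]) blast
  let ?U = "ball p r"
  have U: "?U \<subseteq> unit_disk" using r(2) carleson_square_subset[of h \<theta>] S(2) by auto
  define X where "X = (\<integral>\<^sup>+z\<in>?U. ennreal (v z) \<partial>weighted_area \<eta>)"
  define Y where "Y = (\<integral>\<^sup>+z\<in>?U. ennreal (inverse (v z)) \<partial>weighted_area \<eta>)"
  have pos: "0 < 1 - (cmod z)\<^sup>2" if "z \<in> unit_disk" for z
    using that by (simp add: unit_disk_def power_less_one_iff abs_square_less_1)
  have w_pos: "0 < w z" if "z \<in> unit_disk" for z using w that by (simp add: is_weight_def)
  have "X * Y \<le> (\<integral>\<^sup>+ z \<in> carleson_square \<theta> h. ennreal (v z) \<partial>weighted_area \<eta>) *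
      (\<integral>\<^sup>+ z \<in> carleson_square \<theta> h. ennreal (inverse (v z)) \<partial>weighted_area \<eta>)"
    unfolding X_def Y_def using r(2) by (intro mult_mono nn_set_integral_set_mono) auto
  also have "\<dots> \<le> ennreal c * (emeasure (weighted_area \<eta>) (carleson_square \<theta> h))\<^sup>2"
    using c(2) S by blast
  also have "\<dots> < \<infinity>"
    using weighted_area_finite[OF \<eta>] by (simp add: ennreal_mult_less_top power2_eq_square)
  finally have XY: "X * Y < \<infinity>" .
  have "X \<noteq> 0"
  proof
    assume "X = 0"
    have "X = (\<integral>\<^sup>+z\<in>?U. ennreal ((\<eta> + 1) / pi * (1 - (cmod z)\<^sup>2) powr \<eta>) * ennreal (v z) \<partial>lebesgue)"
      unfolding X_def using U \<eta> by (intro nn_integral_weighted_area) auto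
    also have "\<dots> = (\<integral>\<^sup>+z. ennreal ((\<eta> + 1) / pi * w z) \<partial>lebesgue_on ?U)"
    proof (subst nn_integral_restrict_space)
      show "(\<integral>\<^sup>+z\<in>?U. ennreal ((\<eta> + 1) / pi * (1 - (cmod z)\<^sup>2) powr \<eta>) * ennreal (v z) \<partial>lebesgue)
          = (\<integral>\<^sup>+z. ennreal ((\<eta> + 1) / pi * w z) * indicator ?U z \<partial>lebesgue)"
      proof (intro nn_integral_cong)
        fix z
        have "ennreal ((\<eta> + 1) / pi * (1 - (cmod z)\<^sup>2) powr \<eta>) * ennreal (v z) = ennreal ((\<eta> + 1) / pi * w z)"
          if "z \<in> ?U"
        proof -
          have "z \<in> unit_disk" using that U by blast
          then show ?thesis
            using pos[of z] w_pos[of z] \<eta> by (simp add: v_def flip: ennreal_mult)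
        qed
        then show "ennreal ((\<eta> + 1) / pi * (1 - (cmod z)\<^sup>2) powr \<eta>) * ennreal (v z) * indicator ?U z
            = ennreal ((\<eta> + 1) / pi * w z) * indicator ?U z"
          by (simp split: split_indicator)
      qed
    qed simp
    finally have "(\<integral>\<^sup>+z. ennreal ((\<eta> + 1) / pi * w z) \<partial>lebesgue_on ?U) = 0" using \<open>X = 0\<close> by simp
    moreover have "w \<in> borel_measurable (lebesgue_on ?U)"
      using w by (intro measurable_restrict_mono[OF _ U]) (simp add: is_weight_def)
    ultimately have "AE z in lebesgue_on ?U. ennreal ((\<eta> + 1) / pi * w z) = 0"
      by (subst (asm) nn_integral_0_iff_AE) auto
    then have "AE z in lebesgue_on ?U. False"
    proof (rule AE_mp, intro AE_I2 impI)
      fix z assume "z \<in> space (lebesgue_on ?U)" and z0: "ennreal ((\<eta> + 1) / pi * w z) = 0"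
      then have "0 < w z" using U w_pos by auto
      then have "0 < (\<eta> + 1) / pi * w z" using \<eta> by simp
      then show False using z0 by (simp add: ennreal_eq_0_iff)
    qed
    then have "emeasure (lebesgue_on ?U) ?U = 0"
      by (simp add: eventually_False ae_filter_eq_bot_iff)
    moreover have "0 < pi * r\<^sup>2" using r(1) by simp
    ultimately show False
      using measure_disk[of r p] r(1) by (simp add: emeasure_restrict_space ennreal_eq_0_iff del: mult_pos_pos)
  qed
  then have Y: "Y < \<infinity>" using XY by (auto simp: ennreal_mult_less_top)
  \<comment> \<open>On the neighbourhood \<open>1 - (cmod z)\<^sup>2\<close> lies between \<open>d\<close> and \<open>1\<close>, so \<open>m\<close> bounds its power from
      below whatever the sign of \<open>\<eta>\<close>.\<close>
  define d where "d = 1 - ((1 + cmod p) / 2)\<^sup>2"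
  define m where "m = min 1 (d powr (2 * \<eta>))"
  have "cmod p < 1" using p by (simp add: unit_disk_def)
  then have "((1 + cmod p) / 2)\<^sup>2 < 1" by (simp add: abs_square_less_1)
  then have d: "0 < d" by (simp add: d_def)
  then have m: "0 < m" by (simp add: m_def)
  have m_le: "m \<le> (1 - (cmod z)\<^sup>2) powr (2 * \<eta>)" if z: "z \<in> ?U" for z
  proof -
    have "(cmod z)\<^sup>2 \<le> ((1 + cmod p) / 2)\<^sup>2" using near[OF z] by (intro power_mono) auto
    then have t: "d \<le> 1 - (cmod z)\<^sup>2" "1 - (cmod z)\<^sup>2 \<le> 1" by (simp_all add: d_def)
    show ?thesis
    proof (cases "0 \<le> \<eta>")
      case True
      then have "d powr (2 * \<eta>) \<le> (1 - (cmod z)\<^sup>2) powr (2 * \<eta>)" using t d by (intro powr_mono2) auto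
      then show ?thesis by (simp add: m_def)
    next
      case False
      then have "1 powr (2 * \<eta>) \<le> (1 - (cmod z)\<^sup>2) powr (2 * \<eta>)" using t d by (intro powr_mono2') auto
      then show ?thesis by (simp add: m_def)
    qed
  qed
  define k where "k = pi / ((\<eta> + 1) * m)"
  have k: "0 < k" using \<eta> m by (simp add: k_def)
  have "(\<integral>\<^sup>+z\<in>?U. ennreal (1 / w z) \<partial>lebesgue)
      \<le> (\<integral>\<^sup>+z\<in>?U. ennreal ((\<eta> + 1) / pi * (1 - (cmod z)\<^sup>2) powr \<eta>) * (ennreal k * ennreal (inverse (v z))) \<partial>lebesgue)"
  proof (intro nn_integral_mono)
    fix z
    have "ennreal (1 / w z) \<le> ennreal ((\<eta> + 1) / pi * (1 - (cmod z)\<^sup>2) powr \<eta>) * (ennreal k * ennreal (inverse (v z)))"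
      if z: "z \<in> ?U"
    proof -
      have zD: "z \<in> unit_disk" using z U by blast
      have "(1 - (cmod z)\<^sup>2) powr \<eta> * (1 - (cmod z)\<^sup>2) powr \<eta> = (1 - (cmod z)\<^sup>2) powr (2 * \<eta>)"
        by (simp flip: powr_add)
      then have "(\<eta> + 1) / pi * (1 - (cmod z)\<^sup>2) powr \<eta> * (k * inverse (v z)) = (1 - (cmod z)\<^sup>2) powr (2 * \<eta>) / m * (1 / w z)"
      proof -
        have "a / pi * x * (pi / (a * m) * inverse (y / x)) = x * x / m * (1 / y)" if "a \<noteq> 0" "y \<noteq> 0" for a x y :: real
          using that m by (simp add: field_simps)
        from this[of "\<eta> + 1" "w z" "(1 - (cmod z)\<^sup>2) powr \<eta>"] show ?thesis
          using \<eta> w_pos[OF zD] \<open>_ = (1 - (cmod z)\<^sup>2) powr (2 * \<eta>)\<close> by (simp add: k_def v_def)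
      qed
      moreover have "1 * (1 / w z) \<le> (1 - (cmod z)\<^sup>2) powr (2 * \<eta>) / m * (1 / w z)"
        using m_le[OF z] m w_pos[OF zD] by (intro mult_right_mono) (auto simp: field_simps)
      ultimately have "1 / w z \<le> (\<eta> + 1) / pi * (1 - (cmod z)\<^sup>2) powr \<eta> * (k * inverse (v z))" by simp
      then have "ennreal (1 / w z) \<le> ennreal ((\<eta> + 1) / pi * (1 - (cmod z)\<^sup>2) powr \<eta> * (k * inverse (v z)))"
        by (rule ennreal_leI)
      also have "\<dots> = ennreal ((\<eta> + 1) / pi * (1 - (cmod z)\<^sup>2) powr \<eta>) * (ennreal k * ennreal (inverse (v z)))"
      proof -
        have *: "ennreal (a * (k * b)) = ennreal a * (ennreal k * ennreal b)" if "0 \<le> a" "0 \<le> b" for a b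
          using that k by (simp add: ennreal_mult)
        show ?thesis by (rule *) (use \<eta> w_pos[OF zD] in \<open>simp_all add: v_def\<close>)
      qed
      finally show ?thesis .
    qed
    then show "ennreal (1 / w z) * indicator ?U z \<le> ennreal ((\<eta> + 1) / pi * (1 - (cmod z)\<^sup>2) powr \<eta>) *
        (ennreal k * ennreal (inverse (v z))) * indicator ?U z"
      by (simp split: split_indicator)
  qed
  also have "\<dots> = (\<integral>\<^sup>+z\<in>?U. ennreal k * ennreal (inverse (v z)) \<partial>weighted_area \<eta>)"
    using U \<eta> by (intro nn_integral_weighted_area[symmetric]) auto
  also have "\<dots> = ennreal k * Y"
  proof -
    have "(\<lambda>z. ennreal (inverse (v z)) * indicator ?U z) \<in> borel_measurable (lebesgue_on unit_disk)"
    proof -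
      have "?U \<in> sets (lebesgue_on unit_disk)" using U by (auto simp: sets_restrict_space_iff sets_unit_disk)
      then show ?thesis by measurable
    qed
    then show ?thesis
      unfolding Y_def mult.assoc
      by (intro nn_integral_cmult) (simp add: weighted_area_def measurable_disk_area)
  qed
  also have "\<dots> < \<infinity>" using Y by (simp add: ennreal_mult_less_top)
  finally show "\<exists>r>0. ball p r \<subseteq> unit_disk \<and> (\<integral>\<^sup>+z\<in>ball p r. ennreal (1 / w z) \<partial>lebesgue) < \<infinity>"
    using r(1) U by blast
qed

section \<open>Atomic systems of normalised reproducing kernels\<close>

theorem corollary7:
  fixes \<alpha> \<eta> :: real
    and \<omega> :: "complex \<Rightarrow> real"
    and L :: "(complex \<Rightarrow> complex) \<Rightarrow> (complex \<Rightarrow> complex)"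
    and l :: "nat \<Rightarrow> complex"
  assumes "0 < \<alpha>" and "\<alpha> < 1" and "\<eta> > -1"
    and "is_weight \<omega>"
    and "(\<lambda>z. \<omega> z / (1 - (cmod z)\<^sup>2) powr \<eta>) \<in> bekolle_B2 \<eta>"
    and "bergman_bounded_operator \<omega> L"
    and "\<And>n. l n \<in> unit_disk" and "inj l"
  defines "i \<equiv> bergman_atomic_system \<omega> L (\<lambda>n. scaled_kernel \<omega> \<alpha> (l n))"
    and "ii \<equiv> sampling_sequence \<omega> \<alpha> L l"
    and "iii \<equiv> bergman_bessel \<omega> (\<lambda>n. scaled_kernel \<omega> \<alpha> (l n)) \<and>
           (\<exists>g. bergman_bessel \<omega> g \<and>
              (\<forall>f\<in>bergman_space \<omega>.
                 bergman_sums \<omega> (\<lambda>n z. bergman_inner \<omega> f (g n) * scaled_kernel \<omega> \<alpha> (l n) z) (L f)))"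
    and "iv \<equiv> (\<forall>f\<in>bergman_space \<omega>. summable (\<lambda>n. (cmod (f (l n)))\<^sup>2 * disk_mass \<omega> \<alpha> (l n))) \<and>
           (\<exists>g. bergman_bessel \<omega> g \<and>
              (\<forall>f\<in>bergman_space \<omega>.
                 bergman_sums \<omega>
                   (\<lambda>n z. f (l n) * complex_of_real (sqrt (disk_mass \<omega> \<alpha> (l n))) * g n z)
                   (bergman_adjoint \<omega> L f)))"
  shows "(i \<longleftrightarrow> ii) \<and> (ii \<longleftrightarrow> iii) \<and> (iii \<longleftrightarrow> iv)"
proof -
  have "inverse_locally_integrable \<omega>"
    using bekolle_inverse_locally_integrable assms(3-5) by blast
  then interpret function_hilbert_space "bergman_space \<omega>" "bergman_inner \<omega>"
    using bergman_hilbert_space assms(4) by blast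
  have nrm: "nrm = bergman_norm \<omega>"
    by (simp add: fun_eq_iff nrm_def bergman_norm_eq)
  define K where "K = bergman_adjoint \<omega> L"
  define k where "k = bergman_kernel \<omega>"
  define m where "m = (\<lambda>n. disk_mass \<omega> \<alpha> (l n))"
  define u where "u = (\<lambda>n. scaled_kernel \<omega> \<alpha> (l n))"
  have kernel: "k x \<in> bergman_space \<omega> \<and> (\<forall>f\<in>bergman_space \<omega>. f x = bergman_inner \<omega> f (k x))" for x
  proof -
    obtain C where "\<forall>f\<in>bergman_space \<omega>. cmod (f x) \<le> C * nrm f"
      using evaluation_bounded[of x] by (auto simp: nrm_def)
    then have "\<exists>!b. b \<in> bergman_space \<omega> \<and> (\<forall>f\<in>bergman_space \<omega>. f x = bergman_inner \<omega> f b)"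
      by (intro riesz[where C = C]) auto
    then show ?thesis unfolding k_def bergman_kernel_def by (rule theI')
  qed
  have LK: "adjoint_pair L K"
  proof -
    obtain C where "\<forall>f\<in>bergman_space \<omega>. nrm (L f) \<le> C * nrm f"
      using assms(6) by (auto simp: bergman_bounded_operator_def nrm)
    then have C: "nrm (L f) \<le> C * nrm f" if "f \<in> bergman_space \<omega>" for f using that by blast
    have L: "L f \<in> bergman_space \<omega>" if "f \<in> bergman_space \<omega>" for f
      using assms(6) that by (simp add: bergman_bounded_operator_def)
    have "K g \<in> bergman_space \<omega> \<and> (\<forall>f\<in>bergman_space \<omega>. bergman_inner \<omega> (L f) g = bergman_inner \<omega> f (K g))"
      if g: "g \<in> bergman_space \<omega>" for g
    proof -
      have "\<exists>!h. h \<in> bergman_space \<omega> \<and> (\<forall>f\<in>bergman_space \<omega>. bergman_inner \<omega> (L f) g = bergman_inner \<omega> f h)"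
        by (rule adjoint_exists[OF L _ _ C g]) (use assms(6) in \<open>auto simp: bergman_bounded_operator_def\<close>)
      then show ?thesis unfolding K_def bergman_adjoint_def by (rule theI')
    qed
    then show ?thesis using L by (simp add: adjoint_pair_def)
  qed
  have m_nonneg: "0 \<le> m n" for n
    unfolding m_def disk_mass_def set_lebesgue_integral_def
    using weight_nonneg[OF assms(4)] by (intro integral_nonneg_AE) (auto elim: eventually_mono)
  have u_eq: "u n = (\<lambda>z. complex_of_real (sqrt (m n)) * k (l n) z)" for n
    by (simp add: u_def scaled_kernel_def k_def m_def mult.commute)
  have u: "u n \<in> bergman_space \<omega>" for n
    unfolding u_eq using kernel by (intro scale_mem) blast
  have ip_u: "bergman_inner \<omega> f (u n) = f (l n) * complex_of_real (sqrt (m n))"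
    if f: "f \<in> bergman_space \<omega>" for f n
  proof -
    have "bergman_inner \<omega> f (u n) = cnj (complex_of_real (sqrt (m n))) * bergman_inner \<omega> f (k (l n))"
      unfolding u_eq using kernel f by (intro ip_scale_right) auto
    also have "bergman_inner \<omega> f (k (l n)) = f (l n)" using kernel[of "l n"] f by simp
    finally show ?thesis by (simp add: mult.commute)
  qed
  have sq_u: "(cmod (bergman_inner \<omega> f (u n)))\<^sup>2 = (cmod (f (l n)))\<^sup>2 * m n"
    if f: "f \<in> bergman_space \<omega>" for f n
    using m_nonneg[of n] by (simp add: ip_u[OF f] norm_mult power_mult_distrib)
  have sums: "bergman_sums \<omega> = sums_to"
    by (simp add: fun_eq_iff bergman_sums_def sums_to_def nrm)
  have bess: "bergman_bessel \<omega> = bessel"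
    by (simp add: fun_eq_iff bergman_bessel_def bessel_def nrm)
  have i_eq: "i \<longleftrightarrow> (\<forall>c. in_l2 c \<longrightarrow> (\<exists>s. sums_to (\<lambda>n x. c n * u n x) s)) \<and>
      (\<exists>C>0. \<forall>f\<in>bergman_space \<omega>. \<exists>a. in_l2 a \<and> l2_norm a \<le> C * nrm f \<and> sums_to (\<lambda>n x. a n * u n x) (L f))"
    by (simp add: i_def bergman_atomic_system_def sums nrm u_def)
  have ii_eq: "ii \<longleftrightarrow> (\<exists>A>0. \<exists>B>0. \<forall>f\<in>bergman_space \<omega>.
      summable (\<lambda>n. (cmod (bergman_inner \<omega> f (u n)))\<^sup>2) \<and>
      A * (nrm (K f))\<^sup>2 \<le> (\<Sum>n. (cmod (bergman_inner \<omega> f (u n)))\<^sup>2) \<and>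
      (\<Sum>n. (cmod (bergman_inner \<omega> f (u n)))\<^sup>2) \<le> B * (nrm f)\<^sup>2)"
    by (simp add: ii_def sampling_sequence_def sq_u nrm K_def m_def cong: ball_cong)
  have iii_eq: "iii \<longleftrightarrow> bessel u \<and> (\<exists>g. bessel g \<and>
      (\<forall>f\<in>bergman_space \<omega>. sums_to (\<lambda>n x. bergman_inner \<omega> f (g n) * u n x) (L f)))"
    by (simp add: iii_def sums bess u_def)
  have iv_eq: "iv \<longleftrightarrow> (\<forall>f\<in>bergman_space \<omega>. summable (\<lambda>n. (cmod (bergman_inner \<omega> f (u n)))\<^sup>2)) \<and>
      (\<exists>g. bessel g \<and> (\<forall>f\<in>bergman_space \<omega>. sums_to (\<lambda>n x. bergman_inner \<omega> f (u n) * g n x) (K f)))"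
  proof -
    have "(\<forall>f\<in>bergman_space \<omega>. summable (\<lambda>n. (cmod (bergman_inner \<omega> f (u n)))\<^sup>2)) \<longleftrightarrow>
        (\<forall>f\<in>bergman_space \<omega>. summable (\<lambda>n. (cmod (f (l n)))\<^sup>2 * disk_mass \<omega> \<alpha> (l n)))"
      by (intro ball_cong refl) (simp add: sq_u m_def)
    moreover have "(\<forall>f\<in>bergman_space \<omega>. sums_to (\<lambda>n x. bergman_inner \<omega> f (u n) * g n x) (K f)) \<longleftrightarrow>
        (\<forall>f\<in>bergman_space \<omega>. sums_to (\<lambda>n z. f (l n) * complex_of_real (sqrt (disk_mass \<omega> \<alpha> (l n))) * g n z)
          (bergman_adjoint \<omega> L f))" for g
      by (intro ball_cong refl) (simp add: ip_u m_def K_def)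
    ultimately show ?thesis unfolding iv_def sums bess by (simp only:)
  qed
  show ?thesis
    unfolding i_eq ii_eq iii_eq iv_eq by (rule atomic_system_equivalences[OF LK u])
qed

end
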